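(* Let $N$ be a nontrivial abelian group and let $\sigma$ be a normalized $\mathbb{T}$-valued 2-cocycle on the wreath product $N\wr\mathbb{Z}$. Let $\sigma'$ denote its restriction to $H=\bigoplus_{\mathbb{Z}}N$. Consider the following conditions: (i) $(H,\sigma')$ satisfies Kleppner's condition. (ii) $(N\wr\mathbb{Z},\sigma)$ has the unique trace property. (iii) $(N\wr\mathbb{Z},\sigma)$ is $C^*$-simple. Then (i) and (ii) are equivalent, and they imply (iii). Moreover, if $N$ is countable, then (iii) holds if and only if the associated action of $\mathbb{Z}$ on $C_r^*(H,\sigma')$ is minimal.
   Context: The wreath product $N\wr\mathbb{Z}$ is the semidirect product $(\bigoplus_{\mathbb{Z}}N)\rtimes\mathbb{Z}$ with $\mathbb{Z}$ acting by translation, $(n\cdot(x_j)_{j\in\mathbb{Z}})_k=x_{k-n}$. For a discrete group $G$ with identity $e$, a normalized 2-cocycle is a map $\sigma:G\times G\to\mathbb{T}$ with $\sigma(g,e)=\sigma(e,g)=1$ and $\sigma(g,h)\sigma(gh,k)=\sigma(h,k)\sigma(g,hk)$ for all $g,h,k$. With $(\lambda_\sigma(g)\xi)(h)=\sigma(g,g^{-1}h)\xi(g^{-1}h)$ on $\ell^2(G)$, $C_r^*(G,\sigma)$ is the C$^*$-algebra generated by $\lambda_\sigma(G)$. $(G,\sigma)$ is $C^*$-simple if $C_r^*(G,\sigma)$ is simple, and has the unique trace property if $C_r^*(G,\sigma)$ has a unique tracial state. An element $g\in G$ is $\sigma$-regular if $\sigma(g,h)=\sigma(h,g)$ whenever $h\in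 G$ commutes with $g$; $(G,\sigma)$ satisfies Kleppner's condition if every nontrivial $\sigma$-regular conjugacy class of $G$ is infinite. With $G=N\wr\mathbb{Z}$, $C_r^*(H,\sigma')$ is identified with the C$^*$-subalgebra of $C_r^*(G,\sigma)$ generated by $\lambda_\sigma(H)$. The associated action of $\mathbb{Z}=G/H$ on $C_r^*(H,\sigma')$ is the (twisted) action in which $k\in\mathbb{Z}$ acts by the restriction of conjugation by $\lambda_\sigma((0,k))$, where $0$ is the identity of $H$. It is minimal if the zero ideal is the only proper two-sided closed ideal of $C_r^*(H,\sigma')$ invariant under all these automorphisms. *)

theory Defs
  imports "HOL-Analysis.Analysis" "HOL-Library.Poly_Mapping"
begin

section \<open>The wreath product of an abelian group with the integers\<close>

text \<open>
  Groups are types of class \<^class>\<open>group_add\<close>, which does not assume commutativity; products,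
  inverses and identities are therefore written additively throughout.  The direct sum
  of copies of \<open>N\<close> indexed by the integers is the type of finitely supported functions.
\<close>

definition shift :: "int \<Rightarrow> (int \<Rightarrow>\<^sub>0 'n::ab_group_add) \<Rightarrow> (int \<Rightarrow>\<^sub>0 'n)"
  where "shift n x = Poly_Mapping.map_key (\<lambda>k. k - n) x"

lemma lookup_shift: "Poly_Mapping.lookup (shift n x) k = Poly_Mapping.lookup x (k - n)"
proof -
  have "inj (\<lambda>k::int. k - n)"
    by (simp add: inj_def)
  then show ?thesis
    by (simp add: shift_def map_key.rep_eq)
qed

lemma shift_add: "shift n (x + y) = shift n x + shift n y"
  by (rule poly_mapping_eqI) (simp add: lookup_shift lookup_add)

lemma shift_shift: "shift m (shift n x) = shift (m + n) x"
  by (rule poly_mapping_eqI) (simp add: lookup_shift algebra_simps)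

lemma shift_0 [simp]: "shift 0 x = x"
  by (rule poly_mapping_eqI) (simp add: lookup_shift)

lemma shift_zero [simp]: "shift n 0 = 0"
  by (rule poly_mapping_eqI) (simp add: lookup_shift)

lemma shift_uminus: "shift n (- x) = - shift n x"
  by (rule poly_mapping_eqI) (simp add: lookup_shift)

declare [[typedef_overloaded]]  (* the finitely supported functions depend on the zero of 'n *)

datatype 'n wreath_int = Wr (wr_base: "int \<Rightarrow>\<^sub>0 'n") (wr_int: int)

declare [[typedef_overloaded = false]]

instantiation wreath_int :: (ab_group_add) group_add
begin

definition "0 = Wr 0 0"
definition "a + b = Wr (wr_base a + shift (wr_int a) (wr_base b)) (wr_int a + wr_int b)"
definition "- a = Wr (- shift (- wr_int a) (wr_base a)) (- wr_int a)"
definition "a - b = a + - (b :: 'a wreath_int)"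

instance
proof
  fix a b c :: "'a wreath_int"
  show "a + b + c = a + (b + c)"
    by (simp add: plus_wreath_int_def shift_add shift_shift add.assoc)
  show "0 + a = a"
    by (simp add: plus_wreath_int_def zero_wreath_int_def)
  show "a + 0 = a"
    by (simp add: plus_wreath_int_def zero_wreath_int_def)
  show "- a + a = 0"
    by (simp add: plus_wreath_int_def zero_wreath_int_def uminus_wreath_int_def)
  show "a + - b = a - b"
    by (simp add: minus_wreath_int_def)
qed

end


section \<open>Cocycles and Kleppner's condition\<close>

definition normalized_2_cocycle :: "('g::group_add \<Rightarrow> 'g \<Rightarrow> complex) \<Rightarrow> bool"
  where "normalized_2_cocycle \<sigma> \<longleftrightarrow>
    (\<forall>g h. cmod (\<sigma> g h) = 1) \<and>
    (\<forall>g. \<sigma> g 0 = 1 \<and> \<sigma> 0 g = 1) \<and>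
    (\<forall>g h k. \<sigma> g h * \<sigma> (g + h) k = \<sigma> h k * \<sigma> g (h + k))"

definition sigma_regular :: "('g::group_add \<Rightarrow> 'g \<Rightarrow> complex) \<Rightarrow> 'g \<Rightarrow> bool"
  where "sigma_regular \<sigma> g \<longleftrightarrow> (\<forall>h. g + h = h + g \<longrightarrow> \<sigma> g h = \<sigma> h g)"

definition conjugacy_class :: "'g::group_add \<Rightarrow> 'g set"
  where "conjugacy_class g = range (\<lambda>h. h + g - h)"

text \<open>
  For a cocycle, regularity is constant on conjugacy classes, so a regular class is the class
  of a regular element; a class is trivial only if it is the class of the identity.
\<close>

definition kleppner :: "('g::group_add \<Rightarrow> 'g \<Rightarrow> complex) \<Rightarrow> bool"
  where "kleppner \<sigma> \<longleftrightarrow> (\<forall>g. g \<noteq> 0 \<longrightarrow> sigma_regular \<sigma> g \<longrightarrow> infinite (conjugacy_class g))"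

definition base_cocycle ::
    "('n::ab_group_add wreath_int \<Rightarrow> 'n wreath_int \<Rightarrow> complex) \<Rightarrow>
      (int \<Rightarrow>\<^sub>0 'n) \<Rightarrow> (int \<Rightarrow>\<^sub>0 'n) \<Rightarrow> complex"
  where "base_cocycle \<sigma> x y = \<sigma> (Wr x 0) (Wr y 0)"


section \<open>The Hilbert space of square-summable functions\<close>

typedef 'g ell2 = "{f :: 'g \<Rightarrow> complex. (\<lambda>x. (cmod (f x))\<^sup>2) summable_on UNIV}"
  by (rule exI [of _ "\<lambda>_. 0"]) simp

setup_lifting type_definition_ell2

lemma ell2_product_summable:
  fixes f g :: "'g \<Rightarrow> complex"
  assumes "(\<lambda>x. (cmod (f x))\<^sup>2) summable_on UNIV" "(\<lambda>x. (cmod (g x))\<^sup>2) summable_on UNIV"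
  shows "(\<lambda>x. cnj (f x) * g x) summable_on UNIV"
proof -
  have "(\<lambda>x. norm (cnj (f x) * g x)) summable_on UNIV"
    using Infinite_Sum.abs_summable_product [of "\<lambda>x. cnj (f x)" UNIV g] assms
    by (simp add: norm_mult power2_eq_square)
  then show ?thesis
    by (rule Infinite_Sum.abs_summable_summable)
qed

lemma ell2_add_summable:
  fixes f g :: "'g \<Rightarrow> complex"
  assumes "(\<lambda>x. (cmod (f x))\<^sup>2) summable_on UNIV" "(\<lambda>x. (cmod (g x))\<^sup>2) summable_on UNIV"
  shows "(\<lambda>x. (cmod (f x + g x))\<^sup>2) summable_on UNIV"
proof -
  have "(\<lambda>x. 2 * (cmod (f x))\<^sup>2 + 2 * (cmod (g x))\<^sup>2) summable_on UNIV"
    using assms by (intro summable_on_add summable_on_cmult_right)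
  moreover have "norm ((cmod (f x + g x))\<^sup>2) \<le> 2 * (cmod (f x))\<^sup>2 + 2 * (cmod (g x))\<^sup>2" for x
  proof -
    have "(cmod (f x + g x))\<^sup>2 \<le> (cmod (f x) + cmod (g x))\<^sup>2"
      by (intro power_mono norm_triangle_ineq) simp
    also have "\<dots> \<le> 2 * (cmod (f x))\<^sup>2 + 2 * (cmod (g x))\<^sup>2"
      using zero_le_power2 [of "cmod (f x) - cmod (g x)"] by (simp add: power2_sum power2_diff)
    finally show ?thesis by simp
  qed
  ultimately have "(\<lambda>x. norm ((cmod (f x + g x))\<^sup>2)) summable_on UNIV"
    by (rule Infinite_Sum.abs_summable_on_comparison_test')
  then show ?thesis by simp
qed

lemma ell2_scale_summable:
  fixes f :: "'g \<Rightarrow> complex"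
  assumes "(\<lambda>x. (cmod (f x))\<^sup>2) summable_on UNIV"
  shows "(\<lambda>x. (cmod (c * f x))\<^sup>2) summable_on UNIV"
  using summable_on_cmult_right [OF assms, of "(cmod c)\<^sup>2"] by (simp add: norm_mult power_mult_distrib)

lift_definition cinner :: "'g ell2 \<Rightarrow> 'g ell2 \<Rightarrow> complex"
  is "\<lambda>f g. \<Sum>\<^sub>\<infinity>x. cnj (f x) * g x" .

lift_definition scaleC :: "complex \<Rightarrow> 'g ell2 \<Rightarrow> 'g ell2" (infixr \<open>*\<^sub>C\<close> 75)
  is "\<lambda>c f x. c * f x"
  by (simp add: ell2_scale_summable)

instantiation ell2 :: (type) real_inner
begin

lift_definition zero_ell2 :: "'a ell2" is "\<lambda>_. 0" by simp

lift_definition plus_ell2 :: "'a ell2 \<Rightarrow> 'a ell2 \<Rightarrow> 'a ell2" is "\<lambda>f g x. f x + g x"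
  by (simp add: ell2_add_summable)

lift_definition uminus_ell2 :: "'a ell2 \<Rightarrow> 'a ell2" is "\<lambda>f x. - f x" by simp

lift_definition minus_ell2 :: "'a ell2 \<Rightarrow> 'a ell2 \<Rightarrow> 'a ell2" is "\<lambda>f g x. f x - g x"
  subgoal for f g using ell2_add_summable [of f "\<lambda>x. - g x"] by simp
  done

definition scaleR_ell2 :: "real \<Rightarrow> 'a ell2 \<Rightarrow> 'a ell2"
  where "scaleR_ell2 r \<xi> = complex_of_real r *\<^sub>C \<xi>"

definition inner_ell2 :: "'a ell2 \<Rightarrow> 'a ell2 \<Rightarrow> real"
  where "inner_ell2 \<xi> \<eta> = Re (cinner \<xi> \<eta>)"

definition norm_ell2 :: "'a ell2 \<Rightarrow> real"
  where "norm_ell2 \<xi> = sqrt (inner \<xi> \<xi>)"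

definition sgn_ell2 :: "'a ell2 \<Rightarrow> 'a ell2"
  where "sgn_ell2 \<xi> = inverse (norm \<xi>) *\<^sub>R \<xi>"

definition dist_ell2 :: "'a ell2 \<Rightarrow> 'a ell2 \<Rightarrow> real"
  where "dist_ell2 \<xi> \<eta> = norm (\<xi> - \<eta>)"

definition [code del]:
  "(uniformity :: ('a ell2 \<times> 'a ell2) filter) = (INF e\<in>{0<..}. principal {(x, y). dist x y < e})"

definition open_ell2 :: "'a ell2 set \<Rightarrow> bool"
  where [code del]: "open_ell2 U = (\<forall>x\<in>U. \<forall>\<^sub>F (x', y) in uniformity. x' = x \<longrightarrow> y \<in> U)"

instance
proof
  fix a b c :: "'a ell2" and r s :: real and U :: "'a ell2 set"
  show "a + b + c = a + (b + c)" by transfer (simp add: add.assoc)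
  show "a + b = b + a" by transfer (simp add: add.commute)
  show "0 + a = a" by transfer simp
  show "- a + a = 0" by transfer simp
  show "a - b = a + - b" by transfer simp
  show "r *\<^sub>R (a + b) = r *\<^sub>R a + r *\<^sub>R b"
    unfolding scaleR_ell2_def by transfer (simp add: algebra_simps)
  show "(r + s) *\<^sub>R a = r *\<^sub>R a + s *\<^sub>R a"
    unfolding scaleR_ell2_def by transfer (simp add: algebra_simps)
  show "r *\<^sub>R s *\<^sub>R a = (r * s) *\<^sub>R a"
    unfolding scaleR_ell2_def by transfer (simp add: algebra_simps)
  show "1 *\<^sub>R a = a"
    unfolding scaleR_ell2_def by transfer simp
  show "sgn a = inverse (norm a) *\<^sub>R a" by (rule sgn_ell2_def)
  show "dist a b = norm (a - b)" by (rule dist_ell2_def)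
  show "(uniformity :: ('a ell2 \<times> 'a ell2) filter) = (INF e\<in>{0<..}. principal {(x, y). dist x y < e})"
    by (rule uniformity_ell2_def)
  show "open U = (\<forall>x\<in>U. \<forall>\<^sub>F (x', y) in uniformity. x' = x \<longrightarrow> y \<in> U)"
    by (rule open_ell2_def)
  show "norm a = sqrt (inner a a)" by (rule norm_ell2_def)
  show "inner a b = inner b a"
  proof -
    have "cinner a b = cnj (cinner b a)"
      by transfer (simp flip: infsum_cnj add: mult.commute)
    then show ?thesis by (simp add: inner_ell2_def)
  qed
  show "inner (a + b) c = inner a c + inner b c"
  proof -
    have "cinner (a + b) c = cinner a c + cinner b c"
      by transfer (simp add: distrib_right infsum_add ell2_product_summable)
    then show ?thesis by (simp add: inner_ell2_def)
  qed
  show "inner (r *\<^sub>R a) b = r * inner a b"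
  proof -
    have "cinner (complex_of_real r *\<^sub>C a) b = complex_of_real r * cinner a b"
      by transfer (simp add: mult.assoc infsum_cmult_right')
    then show ?thesis by (simp add: inner_ell2_def scaleR_ell2_def)
  qed
  have sq: "inner x x = (\<Sum>\<^sub>\<infinity>i. (cmod (Rep_ell2 x i))\<^sup>2)" for x :: "'a ell2"
  proof -
    have "Re (cinner x x) = (\<Sum>\<^sub>\<infinity>i. Re (cnj (Rep_ell2 x i) * Rep_ell2 x i))"
      unfolding cinner.rep_eq
      by (rule infsum_Re [symmetric]) (use Rep_ell2 [of x] in \<open>auto intro: ell2_product_summable\<close>)
    also have "\<dots> = (\<Sum>\<^sub>\<infinity>i. (cmod (Rep_ell2 x i))\<^sup>2)"
      by (intro infsum_cong, subst cmod_power2) (simp add: power2_eq_square)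
    finally show ?thesis by (simp add: inner_ell2_def)
  qed
  show "0 \<le> inner a a"
    unfolding sq by (rule infsum_nonneg) simp
  show "(inner a a = 0) = (a = 0)"
  proof
    assume "inner a a = 0"
    then have "(cmod (Rep_ell2 a i))\<^sup>2 = 0" for i
      unfolding sq using Rep_ell2 [of a]
      by (intro nonneg_infsum_le_0D [where A = UNIV and f = "\<lambda>i. (cmod (Rep_ell2 a i))\<^sup>2"]) auto
    then show "a = 0"
      by (simp add: Rep_ell2_inject [symmetric] zero_ell2.rep_eq fun_eq_iff)
  next
    assume "a = 0"
    then show "inner a a = 0"
      unfolding sq by (simp add: zero_ell2.rep_eq)
  qed
qed

end

lemma norm_ell2_eq: "norm \<xi> = sqrt (\<Sum>\<^sub>\<infinity>x. (cmod (Rep_ell2 \<xi> x))\<^sup>2)"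
proof -
  have "Re (cinner \<xi> \<xi>) = (\<Sum>\<^sub>\<infinity>i. Re (cnj (Rep_ell2 \<xi> i) * Rep_ell2 \<xi> i))"
    unfolding cinner.rep_eq
    by (rule infsum_Re [symmetric]) (use Rep_ell2 [of \<xi>] in \<open>auto intro: ell2_product_summable\<close>)
  also have "\<dots> = (\<Sum>\<^sub>\<infinity>i. (cmod (Rep_ell2 \<xi> i))\<^sup>2)"
    by (intro infsum_cong, subst cmod_power2) (simp add: power2_eq_square)
  finally show ?thesis
    by (simp add: norm_ell2_def inner_ell2_def)
qed

lemma norm_scaleC: "norm (c *\<^sub>C \<xi>) = cmod c * norm \<xi>"
  by (simp add: norm_ell2_eq scaleC.rep_eq norm_mult power_mult_distrib infsum_cmult_right'
      real_sqrt_mult)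

lemma bounded_linear_scaleC: "bounded_linear ((*\<^sub>C) c)"
proof (rule bounded_linear_intro)
  fix \<xi> \<eta> :: "'a ell2" and r :: real
  show "c *\<^sub>C (\<xi> + \<eta>) = c *\<^sub>C \<xi> + c *\<^sub>C \<eta>"
    by transfer (simp add: algebra_simps)
  show "c *\<^sub>C r *\<^sub>R \<xi> = r *\<^sub>R c *\<^sub>C \<xi>"
    unfolding scaleR_ell2_def by transfer (simp add: algebra_simps)
  show "norm (c *\<^sub>C \<xi>) \<le> norm \<xi> * cmod c"
    by (simp add: norm_scaleC)
qed


section \<open>C*-algebras of operators\<close>

text \<open>
  \<^typ>\<open>'g ell2 \<Rightarrow>\<^sub>L 'g ell2\<close> consists of the real-linear bounded operators, with the operator
  norm; C*-subalgebras are required below to consist of complex-linear ones.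
\<close>

type_synonym 'g operator = "'g ell2 \<Rightarrow>\<^sub>L 'g ell2"

definition complex_linear :: "'g operator \<Rightarrow> bool"
  where "complex_linear A \<longleftrightarrow> (\<forall>c \<xi>. A (c *\<^sub>C \<xi>) = c *\<^sub>C A \<xi>)"

lift_definition scalar_op :: "complex \<Rightarrow> 'g operator" is "\<lambda>c \<xi>. c *\<^sub>C \<xi>"
  by (rule bounded_linear_scaleC)

definition adj :: "'g operator \<Rightarrow> 'g operator"
  where "adj A = (THE B :: 'g operator. \<forall>\<xi> \<eta>. cinner (A \<xi>) \<eta> = cinner \<xi> (B \<eta>))"

definition csubspace :: "'g operator set \<Rightarrow> bool"
  where "csubspace V \<longleftrightarrow> 0 \<in> V \<and> (\<forall>A\<in>V. \<forall>B\<in>V. A + B \<in> V) \<and> (\<forall>c. \<forall>A\<in>V. scalar_op c o\<^sub>L A \<in> V)"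

definition cstar_subalgebra :: "'g operator set \<Rightarrow> bool"
  where "cstar_subalgebra \<A> \<longleftrightarrow> (\<forall>A\<in>\<A>. complex_linear A) \<and> csubspace \<A> \<and>
    (\<forall>A\<in>\<A>. \<forall>B\<in>\<A>. A o\<^sub>L B \<in> \<A>) \<and> (\<forall>A\<in>\<A>. adj A \<in> \<A>) \<and> closed \<A>"

definition cstar_generated :: "'g operator set \<Rightarrow> 'g operator set"
  where "cstar_generated X = \<Inter> {\<A>. cstar_subalgebra \<A> \<and> X \<subseteq> \<A>}"

definition closed_ideal :: "'g operator set \<Rightarrow> 'g operator set \<Rightarrow> bool"
  where "closed_ideal \<A> J \<longleftrightarrow> J \<subseteq> \<A> \<and> csubspace J \<and>
    (\<forall>A\<in>\<A>. \<forall>B\<in>J. A o\<^sub>L B \<in> J \<and> B o\<^sub>L A \<in> J) \<and> closed J"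

definition simple_cstar :: "'g operator set \<Rightarrow> bool"
  where "simple_cstar \<A> \<longleftrightarrow> \<A> \<noteq> {0} \<and> (\<forall>J. closed_ideal \<A> J \<longrightarrow> J = {0} \<or> J = \<A>)"

text \<open>
  Only used for algebras containing the identity operator, where a positive functional is a
  state if and only if it maps the identity to 1.  The value outside of the algebra is fixed, so that
  uniqueness of a tracial state means uniqueness as a functional on the algebra.
\<close>

definition tracial_state :: "'g operator set \<Rightarrow> ('g operator \<Rightarrow> complex) \<Rightarrow> bool"
  where "tracial_state \<A> \<tau> \<longleftrightarrow> \<tau> \<in> extensional \<A> \<and>
    (\<forall>A\<in>\<A>. \<forall>B\<in>\<A>. \<tau> (A + B) = \<tau> A + \<tau> B) \<and>
    (\<forall>c. \<forall>A\<in>\<A>. \<tau> (scalar_op c o\<^sub>L A) = c * \<tau> A) \<and>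
    (\<forall>A\<in>\<A>. \<tau> (adj A o\<^sub>L A) \<in> \<real>\<^sub>\<ge>\<^sub>0) \<and>
    \<tau> id_blinfun = 1 \<and>
    (\<forall>A\<in>\<A>. \<forall>B\<in>\<A>. \<tau> (A o\<^sub>L B) = \<tau> (B o\<^sub>L A))"


section \<open>Reduced twisted group C*-algebras\<close>

text \<open>
  For a cocycle the function below is bounded and linear, see \<open>lambda_op_apply\<close>; for other
  arguments the operator is unspecified.
\<close>

definition lambda_op :: "('g::group_add \<Rightarrow> 'g \<Rightarrow> complex) \<Rightarrow> 'g \<Rightarrow> 'g operator"
  where "lambda_op \<sigma> g =
    Blinfun (\<lambda>\<xi>. Abs_ell2 (\<lambda>h. \<sigma> g (- g + h) * Rep_ell2 \<xi> (- g + h)))"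

definition reduced_cstar :: "('g::group_add \<Rightarrow> 'g \<Rightarrow> complex) \<Rightarrow> 'g operator set"
  where "reduced_cstar \<sigma> = cstar_generated (range (lambda_op \<sigma>))"

definition cstar_simple :: "('g::group_add \<Rightarrow> 'g \<Rightarrow> complex) \<Rightarrow> bool"
  where "cstar_simple \<sigma> \<longleftrightarrow> simple_cstar (reduced_cstar \<sigma>)"

definition unique_trace_property :: "('g::group_add \<Rightarrow> 'g \<Rightarrow> complex) \<Rightarrow> bool"
  where "unique_trace_property \<sigma> \<longleftrightarrow> (\<exists>!\<tau>. tracial_state (reduced_cstar \<sigma>) \<tau>)"

text \<open>
  The algebra of \<open>H\<close> with the restricted cocycle, realised inside the algebra of the wreath product.
\<close>

definition base_cstar ::
    "('n::ab_group_add wreath_int \<Rightarrow> 'n wreath_int \<Rightarrow> complex) \<Rightarrow> 'n wreath_int operator set"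
  where "base_cstar \<sigma> = cstar_generated (range (\<lambda>x. lambda_op \<sigma> (Wr x 0)))"

definition int_action ::
    "('n::ab_group_add wreath_int \<Rightarrow> 'n wreath_int \<Rightarrow> complex) \<Rightarrow> int \<Rightarrow>
      'n wreath_int operator \<Rightarrow> 'n wreath_int operator"
  where "int_action \<sigma> k A = lambda_op \<sigma> (Wr 0 k) o\<^sub>L A o\<^sub>L adj (lambda_op \<sigma> (Wr 0 k))"

definition minimal_int_action ::
    "('n::ab_group_add wreath_int \<Rightarrow> 'n wreath_int \<Rightarrow> complex) \<Rightarrow> bool"
  where "minimal_int_action \<sigma> \<longleftrightarrow>
    {J. closed_ideal (base_cstar \<sigma>) J \<and> J \<noteq> base_cstar \<sigma> \<and> (\<forall>k. int_action \<sigma> k ` J \<subseteq> J)} = {{0}}"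


section \<open>Well-definedness of the operators\<close>

lemma adj_eqI:
  fixes A B :: "'g operator"
  assumes B: "\<And>\<xi> \<eta>. cinner (A \<xi>) \<eta> = cinner \<xi> (B \<eta>)"
  shows "adj A = B"
  unfolding adj_def
proof (rule the_equality)
  show "\<forall>\<xi> \<eta>. cinner (A \<xi>) \<eta> = cinner \<xi> (B \<eta>)"
    using B by simp
next
  fix C :: "'g operator"
  assume C: "\<forall>\<xi> \<eta>. cinner (A \<xi>) \<eta> = cinner \<xi> (C \<eta>)"
  show "C = B"
  proof (rule blinfun_eqI)
    fix \<eta>
    have "inner \<xi> (C \<eta>) = inner \<xi> (B \<eta>)" for \<xi>
      using B C by (metis inner_ell2_def)
    then have "inner (C \<eta> - B \<eta>) (C \<eta> - B \<eta>) = 0"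
      by (simp add: inner_diff_right)
    then show "C \<eta> = B \<eta>"
      by simp
  qed
qed

lemma bij_left_translation: "bij (\<lambda>h::'g::group_add. - g + h)"
  by (rule bij_betw_byWitness [where f' = "\<lambda>h. g + h"]) (auto simp: add.assoc [symmetric])

lemma lambda_op_summable:
  fixes \<xi> :: "'g::group_add ell2"
  assumes "\<And>h. cmod (\<sigma> g h) = 1"
  shows "(\<lambda>h. (cmod (\<sigma> g (- g + h) * Rep_ell2 \<xi> (- g + h)))\<^sup>2) summable_on UNIV"
  using summable_on_reindex_bij_betw [OF bij_left_translation [of g], of "\<lambda>h. (cmod (Rep_ell2 \<xi> h))\<^sup>2"]
    Rep_ell2 [of \<xi>]
  by (simp add: norm_mult assms)

lemma lambda_op_apply:
  assumes "normalized_2_cocycle \<sigma>"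
  shows "Rep_ell2 (lambda_op \<sigma> g \<xi>) h = \<sigma> g (- g + h) * Rep_ell2 \<xi> (- g + h)"
proof -
  have 1: "cmod (\<sigma> g h) = 1" for g h
    using assms by (simp add: normalized_2_cocycle_def)
  define F where "F \<xi> = Abs_ell2 (\<lambda>h. \<sigma> g (- g + h) * Rep_ell2 \<xi> (- g + h))" for \<xi>
  have F: "Rep_ell2 (F \<xi>) h = \<sigma> g (- g + h) * Rep_ell2 \<xi> (- g + h)" for \<xi> h
    unfolding F_def using lambda_op_summable [of \<sigma> g \<xi>] 1 by (simp add: Abs_ell2_inverse)
  have "bounded_linear F"
  proof (rule bounded_linear_intro)
    fix \<xi> \<eta> :: "'a ell2" and r :: real
    show "F (\<xi> + \<eta>) = F \<xi> + F \<eta>"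
      by (simp add: Rep_ell2_inject [symmetric] fun_eq_iff F plus_ell2.rep_eq algebra_simps)
    show "F (r *\<^sub>R \<xi>) = r *\<^sub>R F \<xi>"
      by (simp add: Rep_ell2_inject [symmetric] fun_eq_iff F scaleR_ell2_def scaleC.rep_eq algebra_simps)
    show "norm (F \<xi>) \<le> norm \<xi> * 1"
      using infsum_reindex_bij_betw [OF bij_left_translation [of g], of "\<lambda>h. (cmod (Rep_ell2 \<xi> h))\<^sup>2"]
      by (simp add: norm_ell2_eq F norm_mult 1)
  qed
  then have "blinfun_apply (lambda_op \<sigma> g) = F"
    unfolding lambda_op_def F_def by (rule bounded_linear_Blinfun_apply)
  then show ?thesis
    by (simp add: F)
qed

lemma lambda_op_0:
  assumes "normalized_2_cocycle \<sigma>"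
  shows "lambda_op \<sigma> 0 = id_blinfun"
proof (rule blinfun_eqI)
  fix \<xi>
  show "lambda_op \<sigma> 0 \<xi> = id_blinfun \<xi>"
    using assms
    by (simp add: Rep_ell2_inject [symmetric] fun_eq_iff lambda_op_apply normalized_2_cocycle_def)
qed

lemma lambda_op_compose:
  assumes "normalized_2_cocycle \<sigma>"
  shows "lambda_op \<sigma> g o\<^sub>L lambda_op \<sigma> h = scalar_op (\<sigma> g h) o\<^sub>L lambda_op \<sigma> (g + h)"
proof (rule blinfun_eqI)
  fix \<xi>
  have "\<sigma> g (h + (- h + (- g + k))) * \<sigma> h (- h + (- g + k)) =
      \<sigma> g h * \<sigma> (g + h) (- h + (- g + k))" for k
    using assms unfolding normalized_2_cocycle_def by (metis mult.commute)
  then have "\<sigma> g (- g + k) * \<sigma> h (- h + (- g + k)) = \<sigma> g h * \<sigma> (g + h) (- h + (- g + k))" for k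
    by (simp only: add_minus_cancel)
  moreover have "- (g + h) + k = - h + (- g + k)" for k
    by (simp only: minus_add add.assoc)
  ultimately show "(lambda_op \<sigma> g o\<^sub>L lambda_op \<sigma> h) \<xi> = (scalar_op (\<sigma> g h) o\<^sub>L lambda_op \<sigma> (g + h)) \<xi>"
    by (simp add: Rep_ell2_inject [symmetric] fun_eq_iff lambda_op_apply [OF assms]
        scalar_op.rep_eq scaleC.rep_eq mult.assoc [symmetric])
qed

end

theory Submission
  imports Defs
begin

text \<open>
  Write \<open>H\<close> for the base group, \<open>L g\<close> for the unitaries \<^const>\<open>lambda_op\<close> and \<open>\<tau>\<close> for the canonical
  trace, the vector state of the point mass at the identity.  Since \<open>H\<close> is abelian, its conjugacy
  classes are points, so Kleppner's condition for \<open>H\<close> says that the bicharacter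
  \<open>\<sigma>(y, x) / \<sigma>(x, y)\<close> is nondegenerate.  If it is, then uniqueness of the trace, simplicity and
  minimality all hold; if it is not, then all three fail.

  \<^emph>\<open>Nondegenerate case.\<close>  Averaging over conjugation by unitaries of \<open>H\<close> moves every element \<open>A\<close> of
  the algebra arbitrarily close, in norm, to the scalar \<open>\<tau>(A)\<close> (lemma \<open>dixmier_reduced\<close>).  On \<open>L x\<close> with
  \<open>x \<noteq> 0\<close> in \<open>H\<close>, some conjugation acts as a scalar \<open>c \<noteq> 1\<close>, and the mean of it and the identity shrinks
  \<open>L x\<close> by the factor \<open>|1 + c| / 2 < 1\<close>.  An element \<open>g\<close> outside \<open>H\<close> has infinitely many conjugates under
  \<open>H\<close>, so \<open>L g\<close> has averages \<open>b\<close> with \<open>\<tau>(b\<^sup>* b)\<close> small; moreover \<open>b\<^sup>* b\<close> lies in the algebra of \<open>H\<close>, where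
  averages of it come close to \<open>\<tau>(b\<^sup>* b)\<close>, and the Kadison-Schwarz inequality bounds the norm of the
  corresponding averages of \<open>b\<close>.  Averages of \<open>A\<close> have the same value as \<open>A\<close> under every trace, so
  the trace is unique; they stay in every closed ideal containing \<open>A\<close>, so a closed ideal containing
  \<open>A \<noteq> 0\<close> contains the scalar \<open>\<tau>(A\<^sup>* A) \<noteq> 0\<close> and is everything.  The same argument inside the algebra
  of \<open>H\<close> shows that this algebra is simple, and minimality follows.

  \<^emph>\<open>Degenerate case.\<close>  Let \<open>x0 \<noteq> 0\<close> be regular in \<open>H\<close> and let \<open>R\<close> be the group generated by its
  translates.  For \<open>z\<close> in \<open>R\<close> the unitary \<open>L z\<close> is central in the algebra of \<open>H\<close>, and the
  quotient \<open>W z\<close> of its translate by \<open>L z\<close> itself is a scalar multiple of \<open>L (shift 1 z - z)\<close>.  Passing to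
  this quotient cancels the cocycle: \<open>W\<close> is a homomorphism on \<open>R\<close>, commutes with \<open>H\<close> and is
  permuted by translations.  Abelian groups have Folner sets, so there are unit vectors in the
  span of the \<open>W\<close>-orbit of the point mass which \<open>W z\<close> moves less and less for each \<open>z\<close> in \<open>R\<close>.
  The limit of their vector states is a trace \<open>\<omega>\<close> with \<open>\<omega>(A W z) = \<omega>(A)\<close>.  As \<open>\<tau>(W x0) = 0\<close>,
  this is a second trace, and the kernel of the form \<open>(B, A) \<mapsto> \<omega>(B A)\<close> is a proper closed ideal
  containing \<open>W x0 - 1 \<noteq> 0\<close>; its intersection with the algebra of \<open>H\<close> is invariant.  So uniqueness, simplicity and minimality
  fail together (lemmas \<open>not_unique_trace\<close>, \<open>not_simple\<close>, \<open>not_minimal\<close>).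

  In both cases linear and continuous statements need only be checked on the unitaries, because the
  closed linear span of the unitaries is already a C*-algebra (lemma \<open>cstar_generated_induct\<close>).  Uniqueness
  of the trace also uses that tracial states are bounded (lemma \<open>tracial_state_bounded\<close>), which holds
  because \<open>1 - A\<close> is a square for self-adjoint \<open>A\<close> of norm less than 1.
\<close>

section \<open>Completeness of the Hilbert space\<close>

lemma summable_ell2: "(\<lambda>x. (cmod (Rep_ell2 \<xi> x))\<^sup>2) summable_on UNIV"
  using Rep_ell2 [of \<xi>] by simp

lemma ell2_eqI: "(\<And>g. Rep_ell2 \<xi> g = Rep_ell2 \<eta> g) \<Longrightarrow> \<xi> = \<eta>"
  by (simp add: Rep_ell2_inject [symmetric] fun_eq_iff)

lemma scaleC_simps [simp]:
  "c *\<^sub>C (\<xi> + \<eta>) = c *\<^sub>C \<xi> + c *\<^sub>C \<eta>"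
  "c *\<^sub>C (\<xi> - \<eta>) = c *\<^sub>C \<xi> - c *\<^sub>C \<eta>"
  "c *\<^sub>C d *\<^sub>C \<xi> = (c * d) *\<^sub>C \<xi>"
  "1 *\<^sub>C \<xi> = \<xi>"
  "0 *\<^sub>C \<xi> = 0"
  "c *\<^sub>C 0 = 0"
  "(- c) *\<^sub>C \<xi> = - (c *\<^sub>C \<xi>)"
  "c *\<^sub>C (- \<xi>) = - (c *\<^sub>C \<xi>)"
  by (transfer; simp add: algebra_simps)+

lemma scaleR_eq_scaleC: "r *\<^sub>R \<xi> = complex_of_real r *\<^sub>C (\<xi> :: 'g ell2)"
  by (rule scaleR_ell2_def)

lemma cinner_add_left: "cinner (\<xi> + \<zeta>) \<eta> = cinner \<xi> \<eta> + cinner \<zeta> \<eta>"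
  by transfer (simp add: distrib_right infsum_add ell2_product_summable)

lemma cinner_add_right: "cinner \<xi> (\<eta> + \<zeta>) = cinner \<xi> \<eta> + cinner \<xi> \<zeta>"
  by transfer (simp add: distrib_left infsum_add ell2_product_summable)

lemma cinner_scaleC_left [simp]: "cinner (c *\<^sub>C \<xi>) \<eta> = cnj c * cinner \<xi> \<eta>"
  by transfer (simp add: mult.assoc infsum_cmult_right')

lemma cinner_scaleC_right [simp]: "cinner \<xi> (c *\<^sub>C \<eta>) = c * cinner \<xi> \<eta>"
proof -
  have "cnj x * (c * y) = c * (cnj x * y)" for x y by simp
  then show ?thesis by transfer (simp only: infsum_cmult_right')
qed

lemma cinner_commute: "cinner \<xi> \<eta> = cnj (cinner \<eta> \<xi>)"
  by transfer (simp flip: infsum_cnj add: mult.commute)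

lemma cinner_self: "cinner \<xi> \<xi> = complex_of_real ((norm \<xi>)\<^sup>2)"
proof (rule complex_eqI)
  show "Re (cinner \<xi> \<xi>) = Re (complex_of_real ((norm \<xi>)\<^sup>2))"
    by (metis Re_complex_of_real inner_ell2_def power2_norm_eq_inner)
  show "Im (cinner \<xi> \<xi>) = Im (complex_of_real ((norm \<xi>)\<^sup>2))"
    using cinner_commute [of \<xi> \<xi>] by (metis Im_complex_of_real Reals_cnj_iff complex_is_Real_iff)
qed

text \<open>
  Rotating by a unimodular scalar reduces this to the inequality for the real inner product.
\<close>
lemma cinner_cauchy_schwarz: "cmod (cinner \<xi> \<eta>) \<le> norm \<xi> * norm \<eta>"
proof -
  obtain c where c: "cmod c = 1" "c * cinner \<xi> \<eta> = complex_of_real (cmod (cinner \<xi> \<eta>))"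
  proof (cases "cinner \<xi> \<eta> = 0")
    case True
    then show ?thesis by (intro that [of 1]) auto
  next
    case False
    then show ?thesis
      by (intro that [of "cnj (cinner \<xi> \<eta>) / cmod (cinner \<xi> \<eta>)"])
         (auto simp: norm_divide complex_norm_square [symmetric] mult.commute power2_eq_square
           simp flip: complex_norm_square)
  qed
  then have "cmod (cinner \<xi> \<eta>) = inner \<xi> (c *\<^sub>C \<eta>)"
    by (simp add: inner_ell2_def)
  also have "\<dots> \<le> norm \<xi> * norm (c *\<^sub>C \<eta>)"
    by (rule norm_cauchy_schwarz)
  finally show ?thesis
    using c by (simp add: norm_scaleC)
qed

lemma bounded_bilinear_cinner: "bounded_bilinear cinner"
proof
  fix a b c :: "'a ell2" and r :: real
  show "cinner (a + b) c = cinner a c + cinner b c" by (rule cinner_add_left)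
  show "cinner a (b + c) = cinner a b + cinner a c" by (rule cinner_add_right)
  show "cinner (r *\<^sub>R a) b = r *\<^sub>R cinner a b"
    by (simp add: scaleR_eq_scaleC scaleR_conv_of_real)
  show "cinner a (r *\<^sub>R b) = r *\<^sub>R cinner a b"
    by (simp add: scaleR_eq_scaleC scaleR_conv_of_real)
  show "\<exists>K. \<forall>(a :: 'a ell2) b. cmod (cinner a b) \<le> norm a * norm b * K"
    by (rule exI [of _ 1]) (simp add: cinner_cauchy_schwarz)
qed

interpretation cinner: bounded_bilinear cinner
  by (rule bounded_bilinear_cinner)

lemma cinner_ext: "(\<And>\<xi>. cinner \<xi> \<eta> = cinner \<xi> \<zeta>) \<Longrightarrow> \<eta> = \<zeta>"
proof -
  assume *: "\<And>\<xi>. cinner \<xi> \<eta> = cinner \<xi> \<zeta>"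
  have "cinner (\<eta> - \<zeta>) (\<eta> - \<zeta>) = 0"
    using * [of "\<eta> - \<zeta>"] by (simp add: cinner.diff_right)
  then show "\<eta> = \<zeta>"
    by (simp add: cinner_self)
qed

lemma finite_sum_le_norm_ell2:
  assumes "finite F"
  shows "(\<Sum>x\<in>F. (cmod (Rep_ell2 \<xi> x))\<^sup>2) \<le> (norm \<xi>)\<^sup>2"
proof -
  have "(\<Sum>x\<in>F. (cmod (Rep_ell2 \<xi> x))\<^sup>2) \<le> (\<Sum>\<^sub>\<infinity>x. (cmod (Rep_ell2 \<xi> x))\<^sup>2)"
    using assms by (intro finite_sum_le_infsum summable_ell2) auto
  then show ?thesis
    by (simp add: norm_ell2_eq infsum_nonneg)
qed

lemma cmod_Rep_ell2_le: "cmod (Rep_ell2 \<xi> x) \<le> norm \<xi>"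
  using finite_sum_le_norm_ell2 [of "{x}" \<xi>] by (simp add: abs_le_square_iff [symmetric])

lemma Rep_ell2_diff: "Rep_ell2 (\<xi> - \<eta>) x = Rep_ell2 \<xi> x - Rep_ell2 \<eta> x"
  by (simp add: minus_ell2.rep_eq)

text \<open>
  A Cauchy sequence converges pointwise; its estimates hold on every finite set of coordinates and
  pass from there to the pointwise limit.
\<close>
instance ell2 :: (type) banach
proof
  fix X :: "nat \<Rightarrow> 'a ell2"
  assume X: "Cauchy X"
  have "Cauchy (\<lambda>n. Rep_ell2 (X n) x)" for x
  proof (rule CauchyI)
    fix e :: real assume "0 < e"
    then obtain M where "\<forall>m\<ge>M. \<forall>n\<ge>M. norm (X m - X n) < e"
      using CauchyD [OF X] by blast
    then show "\<exists>M. \<forall>m\<ge>M. \<forall>n\<ge>M. norm (Rep_ell2 (X m) x - Rep_ell2 (X n) x) < e"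
      using cmod_Rep_ell2_le by (metis Rep_ell2_diff order_le_less_trans)
  qed
  then have "\<exists>l. (\<lambda>n. Rep_ell2 (X n) x) \<longlonglongrightarrow> l" for x
    by (meson Cauchy_convergent_iff convergent_def)
  then obtain f where f: "\<And>x. (\<lambda>n. Rep_ell2 (X n) x) \<longlonglongrightarrow> f x"
    by metis
  have bound: "(\<Sum>x\<in>F. (cmod (Rep_ell2 (X n) x - f x))\<^sup>2) \<le> e\<^sup>2"
    if "\<forall>m\<ge>M. \<forall>n\<ge>M. norm (X m - X n) < e" "n \<ge> M" "finite F" for e M n F
  proof (rule LIMSEQ_le_const2)
    show "(\<lambda>m. \<Sum>x\<in>F. (cmod (Rep_ell2 (X n) x - Rep_ell2 (X m) x))\<^sup>2)
        \<longlonglongrightarrow> (\<Sum>x\<in>F. (cmod (Rep_ell2 (X n) x - f x))\<^sup>2)"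
      by (intro tendsto_intros f)
    have "(\<Sum>x\<in>F. (cmod (Rep_ell2 (X n) x - Rep_ell2 (X m) x))\<^sup>2) \<le> e\<^sup>2" if "m \<ge> M" for m
    proof -
      have "(\<Sum>x\<in>F. (cmod (Rep_ell2 (X n) x - Rep_ell2 (X m) x))\<^sup>2) \<le> (norm (X n - X m))\<^sup>2"
        using finite_sum_le_norm_ell2 [OF \<open>finite F\<close>, of "X n - X m"] by (simp add: Rep_ell2_diff)
      also have "\<dots> \<le> e\<^sup>2"
        using that \<open>n \<ge> M\<close> \<open>\<forall>m\<ge>M. \<forall>n\<ge>M. norm (X m - X n) < e\<close>
        by (intro power_mono) (auto intro: less_imp_le)
      finally show ?thesis .
    qed
    then show "\<exists>N. \<forall>m\<ge>N. (\<Sum>x\<in>F. (cmod (Rep_ell2 (X n) x - Rep_ell2 (X m) x))\<^sup>2) \<le> e\<^sup>2"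
      by blast
  qed
  have summ: "(\<lambda>x. (cmod (Rep_ell2 (X n) x - f x))\<^sup>2) summable_on UNIV"
    if "\<forall>m\<ge>M. \<forall>n\<ge>M. norm (X m - X n) < e" "n \<ge> M" for e M n
    using bound [OF that]
    by (intro nonneg_bdd_above_summable_on) (auto intro!: bdd_aboveI [of _ "e\<^sup>2"])
  obtain M1 where M1: "\<forall>m\<ge>M1. \<forall>n\<ge>M1. norm (X m - X n) < 1"
    using CauchyD [OF X, of 1] by auto
  have "(\<lambda>x. (cmod (f x))\<^sup>2) summable_on UNIV"
    using ell2_add_summable [OF summable_ell2 [of "X M1"] ell2_scale_summable [OF summ [OF M1 order_refl], of "-1"]]
    by (simp add: algebra_simps)
  then have Rf: "Rep_ell2 (Abs_ell2 f) = f"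
    by (simp add: Abs_ell2_inverse)
  have "X \<longlonglongrightarrow> Abs_ell2 f"
  proof (rule LIMSEQ_I)
    fix e :: real assume "0 < e"
    then obtain M where M: "\<forall>m\<ge>M. \<forall>n\<ge>M. norm (X m - X n) < e / 2"
      using CauchyD [OF X, of "e / 2"] by auto
    have "norm (X n - Abs_ell2 f) < e" if "n \<ge> M" for n
    proof -
      have "(\<Sum>\<^sub>\<infinity>x. (cmod (Rep_ell2 (X n) x - f x))\<^sup>2) \<le> (e / 2)\<^sup>2"
        using bound [OF M that] summ [OF M that] by (intro infsum_le_finite_sums) auto
      then have "norm (X n - Abs_ell2 f) \<le> e / 2"
        unfolding norm_ell2_eq Rep_ell2_diff Rf using \<open>0 < e\<close> by (intro real_le_lsqrt) auto
      then show ?thesis using \<open>0 < e\<close> by simp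
    qed
    then show "\<exists>M. \<forall>n\<ge>M. norm (X n - Abs_ell2 f) < e" by blast
  qed
  then show "convergent X" by (rule convergentI)
qed

definition delta :: "'g \<Rightarrow> 'g ell2"
  where "delta g = Abs_ell2 (\<lambda>h. if h = g then 1 else 0)"

lemma Rep_delta: "Rep_ell2 (delta g) h = (if h = g then 1 else 0)"
proof -
  have "(\<lambda>h. (cmod (if h = g then 1 else 0))\<^sup>2) summable_on UNIV"
    by (rule summable_on_cong_neutral [THEN iffD1, OF _ _ _ summable_on_finite [of "{g}" "\<lambda>_. 1"]])
       auto
  then show ?thesis
    by (simp add: delta_def Abs_ell2_inverse)
qed

lemma cinner_delta: "cinner (delta g) \<xi> = Rep_ell2 \<xi> g"
proof -
  have "cinner (delta g) \<xi> = (\<Sum>\<^sub>\<infinity>h\<in>{g}. Rep_ell2 \<xi> h)"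
    unfolding cinner.rep_eq by (rule infsum_cong_neutral) (auto simp: Rep_delta)
  then show ?thesis by simp
qed

lemma norm_delta [simp]: "norm (delta g) = 1"
proof -
  have "complex_of_real ((norm (delta g))\<^sup>2) = 1"
    unfolding cinner_self [symmetric] by (simp add: cinner_delta Rep_delta)
  then show ?thesis
    by (metis norm_ge_zero of_real_eq_1_iff power2_eq_1_iff abs_norm_cancel abs_one one_power2 power2_eq_iff_nonneg zero_le_one)
qed

section \<open>Adjointable operators\<close>

text \<open>
  The constant \<^const>\<open>adj\<close> is a definite description and carries information only for operators that
  have an adjoint; everything below is stated for those.
\<close>
definition is_adjoint :: "'g operator \<Rightarrow> 'g operator \<Rightarrow> bool"
  where "is_adjoint A B \<longleftrightarrow> (\<forall>\<xi> \<eta>. cinner (A \<xi>) \<eta> = cinner \<xi> (B \<eta>))"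

definition adjointable :: "'g operator \<Rightarrow> bool"
  where "adjointable A \<longleftrightarrow> complex_linear A \<and> (\<exists>B. is_adjoint A B)"

lemma adj_unique: "is_adjoint A B \<Longrightarrow> adj A = B"
  by (rule adj_eqI) (simp add: is_adjoint_def)

lemma is_adjoint_adj: "adjointable A \<Longrightarrow> is_adjoint A (adj A)"
  using adj_unique unfolding adjointable_def by metis

lemma cinner_adj:
  "adjointable A \<Longrightarrow> cinner (A \<xi>) \<eta> = cinner \<xi> (adj A \<eta>)"
  using is_adjoint_adj by (auto simp: is_adjoint_def)

lemma complex_linearD: "complex_linear A \<Longrightarrow> A (c *\<^sub>C \<xi>) = c *\<^sub>C A \<xi>"
  by (simp add: complex_linear_def)

lemma adjointable_linear: "adjointable A \<Longrightarrow> A (c *\<^sub>C \<xi>) = c *\<^sub>C A \<xi>"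
  by (simp add: complex_linear_def adjointable_def)

lemma scalar_op_apply [simp]: "scalar_op c \<xi> = c *\<^sub>C \<xi>"
  by (simp add: scalar_op.rep_eq)

lemma scalar_op_one [simp]: "scalar_op 1 = id_blinfun"
  by (rule blinfun_eqI) simp

lemma scalar_op_zero [simp]: "scalar_op 0 = 0"
  by (rule blinfun_eqI) simp

lemma id_compose [simp]: "id_blinfun o\<^sub>L A = A" "A o\<^sub>L id_blinfun = A"
  by (rule blinfun_eqI, simp)+

lemma scalar_op_scalar_op: "scalar_op c o\<^sub>L (scalar_op d o\<^sub>L A) = scalar_op (c * d) o\<^sub>L A"
  by (rule blinfun_eqI) simp

lemma compose_scalar_op:
  "adjointable A \<Longrightarrow> A o\<^sub>L (scalar_op c o\<^sub>L B) = scalar_op c o\<^sub>L (A o\<^sub>L B)"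
  by (rule blinfun_eqI) (simp add: adjointable_linear)

lemma scalar_op_compose: "(scalar_op c o\<^sub>L A) o\<^sub>L B = scalar_op c o\<^sub>L (A o\<^sub>L B)"
  by (rule blinfun_eqI) simp

lemma blinfun_compose_assoc: "(A o\<^sub>L B) o\<^sub>L C = A o\<^sub>L (B o\<^sub>L C)"
  by (rule blinfun_eqI) simp

lemma scaleR_eq_scalar_op: "r *\<^sub>R A = scalar_op (complex_of_real r) o\<^sub>L (A :: 'g operator)"
  by (rule blinfun_eqI) (simp add: blinfun.scaleR_left scaleR_eq_scaleC)

lemma minus_eq_scalar_op: "- A = scalar_op (- 1) o\<^sub>L (A :: 'g operator)"
  using scaleR_eq_scalar_op [of "-1" A] by simp

lemma is_adjoint_sym: "is_adjoint A B \<Longrightarrow> is_adjoint B A"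
  unfolding is_adjoint_def by (metis cinner_commute)

lemma is_adjoint_linear:
  assumes "is_adjoint A B"
  shows "complex_linear B"
  unfolding complex_linear_def
proof (intro allI)
  fix c \<xi>
  show "B (c *\<^sub>C \<xi>) = c *\<^sub>C B \<xi>"
    by (rule cinner_ext) (metis assms cinner_scaleC_right is_adjoint_def)
qed

lemma is_adjoint_adjointable: "is_adjoint A B \<Longrightarrow> adjointable A"
  using is_adjoint_linear is_adjoint_sym adjointable_def by blast

lemma adjointable_adj: "adjointable A \<Longrightarrow> adjointable (adj A)"
  using is_adjoint_adj is_adjoint_adjointable is_adjoint_sym by blast

lemma adj_adj: "adjointable A \<Longrightarrow> adj (adj A) = A"
  using is_adjoint_adj is_adjoint_sym adj_unique by blast

lemma is_adjoint_compose:
  "is_adjoint A A' \<Longrightarrow> is_adjoint B B' \<Longrightarrow> is_adjoint (A o\<^sub>L B) (B' o\<^sub>L A')"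
  by (simp add: is_adjoint_def)

lemma is_adjoint_add:
  "is_adjoint A A' \<Longrightarrow> is_adjoint B B' \<Longrightarrow> is_adjoint (A + B) (A' + B')"
  by (simp add: is_adjoint_def blinfun.add_left cinner_add_left cinner_add_right)

lemma is_adjoint_scalar: "is_adjoint (scalar_op c) (scalar_op (cnj c))"
  by (simp add: is_adjoint_def)

lemma is_adjoint_id: "is_adjoint id_blinfun id_blinfun"
  by (simp add: is_adjoint_def)

lemma is_adjoint_zero: "is_adjoint 0 0"
  by (simp add: is_adjoint_def cinner.zero_left cinner.zero_right)

lemma adjointable_simps [simp, intro]:
  shows "adjointable A \<Longrightarrow> adjointable B \<Longrightarrow> adjointable (A o\<^sub>L B)"
    and "adjointable A \<Longrightarrow> adjointable B \<Longrightarrow> adjointable (A + B)"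
    and "adjointable (scalar_op c)" and "adjointable id_blinfun" and "adjointable 0"
      apply (meson is_adjoint_adj is_adjoint_adjointable is_adjoint_compose)
     apply (meson is_adjoint_adj is_adjoint_adjointable is_adjoint_add)
    apply (rule is_adjoint_adjointable [OF is_adjoint_scalar])
   apply (rule is_adjoint_adjointable [OF is_adjoint_id])
  apply (rule is_adjoint_adjointable [OF is_adjoint_zero])
  done

lemma adjointable_uminus [simp, intro]: "adjointable A \<Longrightarrow> adjointable (- A)"
  by (simp add: minus_eq_scalar_op)

lemma adjointable_diff [simp, intro]: "adjointable A \<Longrightarrow> adjointable B \<Longrightarrow> adjointable (A - B)"
  using adjointable_simps(2) [of A "- B"] by simp

lemma adjointable_scaleR [simp, intro]: "adjointable A \<Longrightarrow> adjointable (r *\<^sub>R A)"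
  by (simp add: scaleR_eq_scalar_op)

lemma adj_compose: "adjointable A \<Longrightarrow> adjointable B \<Longrightarrow> adj (A o\<^sub>L B) = adj B o\<^sub>L adj A"
  by (intro adj_unique is_adjoint_compose is_adjoint_adj)

lemma adj_add: "adjointable A \<Longrightarrow> adjointable B \<Longrightarrow> adj (A + B) = adj A + adj B"
  by (intro adj_unique is_adjoint_add is_adjoint_adj)

lemma adj_scalar_op [simp]: "adj (scalar_op c) = scalar_op (cnj c)"
  by (intro adj_unique is_adjoint_scalar)

lemma adj_id [simp]: "adj id_blinfun = id_blinfun"
  by (intro adj_unique is_adjoint_id)

lemma adj_zero [simp]: "adj 0 = 0"
  by (intro adj_unique is_adjoint_zero)

lemma adj_scalar_op_compose:
  assumes "adjointable A"
  shows "adj (scalar_op c o\<^sub>L A) = scalar_op (cnj c) o\<^sub>L adj A"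
  using assms compose_scalar_op [OF adjointable_adj [OF assms], of "cnj c" id_blinfun]
  by (simp add: adj_compose)

lemma adj_scaleR: "adjointable A \<Longrightarrow> adj (r *\<^sub>R A) = r *\<^sub>R adj A"
  by (simp add: scaleR_eq_scalar_op adj_scalar_op_compose)

lemma adj_uminus: "adjointable A \<Longrightarrow> adj (- A) = - adj A"
  using adj_scaleR [of A "-1"] by simp

lemma adj_diff: "adjointable A \<Longrightarrow> adjointable B \<Longrightarrow> adj (A - B) = adj A - adj B"
  using adj_add [of A "- B"] by (simp add: adj_uminus)

lemma norm_apply_sq:
  "adjointable A \<Longrightarrow> cinner \<xi> ((adj A o\<^sub>L A) \<xi>) = complex_of_real ((norm (A \<xi>))\<^sup>2)"
  by (simp add: cinner_adj [symmetric] cinner_self del: of_real_power)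

lemma norm_adj_le:
  assumes "adjointable A"
  shows "norm (adj A) \<le> norm A"
proof (rule norm_blinfun_bound)
  fix \<xi>
  have "complex_of_real ((norm (adj A \<xi>))\<^sup>2) = cinner (A (adj A \<xi>)) \<xi>"
    by (simp add: cinner_adj assms cinner_self)
  then have "(norm (adj A \<xi>))\<^sup>2 = cmod (cinner (A (adj A \<xi>)) \<xi>)"
    by (metis abs_of_nonneg norm_of_real zero_le_power2)
  also have "\<dots> \<le> norm A * norm (adj A \<xi>) * norm \<xi>"
    by (rule order_trans [OF cinner_cauchy_schwarz]) (intro mult_right_mono norm_blinfun norm_ge_zero)
  finally have "norm (adj A \<xi>) * norm (adj A \<xi>) \<le> norm (adj A \<xi>) * (norm A * norm \<xi>)"
    by (simp add: power2_eq_square mult_ac)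
  then show "norm (adj A \<xi>) \<le> norm A * norm \<xi>"
    by (cases "norm (adj A \<xi>) = 0") (auto simp: mult_le_cancel_left)
qed simp

lemma norm_adj: "adjointable A \<Longrightarrow> norm (adj A) = norm A"
  using norm_adj_le [of A] norm_adj_le [of "adj A"] by (simp add: adjointable_adj adj_adj)

text \<open>
  Taking adjoints is isometric, so the adjoints of a convergent sequence are Cauchy and their limit is
  the adjoint of the limit.
\<close>
lemma closed_adjointable: "closed {A. adjointable A}"
  unfolding closed_sequential_limits
proof (intro allI impI, elim conjE, simp)
  fix X :: "nat \<Rightarrow> 'g operator" and A
  assume X: "\<forall>n. adjointable (X n)" and lim: "X \<longlonglongrightarrow> A"
  have "Cauchy (\<lambda>n. adj (X n))"
  proof (rule CauchyI)
    fix e :: real assume "0 < e"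
    then obtain M where "\<forall>m\<ge>M. \<forall>n\<ge>M. norm (X m - X n) < e"
      using CauchyD [OF LIMSEQ_imp_Cauchy [OF lim]] by blast
    moreover have "norm (adj (X m) - adj (X n)) = norm (X m - X n)" for m n
      using X norm_adj [of "X m - X n"] by (simp add: adj_diff)
    ultimately show "\<exists>M. \<forall>m\<ge>M. \<forall>n\<ge>M. norm (adj (X m) - adj (X n)) < e"
      by auto
  qed
  then obtain B where B: "(\<lambda>n. adj (X n)) \<longlonglongrightarrow> B"
    by (auto simp: Cauchy_convergent_iff convergent_def)
  have "cinner (A \<xi>) \<eta> = cinner \<xi> (B \<eta>)" for \<xi> \<eta>
  proof (rule LIMSEQ_unique)
    show "(\<lambda>n. cinner (X n \<xi>) \<eta>) \<longlonglongrightarrow> cinner (A \<xi>) \<eta>"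
      by (intro cinner.tendsto blinfun.tendsto tendsto_const lim)
    have "(\<lambda>n. cinner \<xi> (adj (X n) \<eta>)) \<longlonglongrightarrow> cinner \<xi> (B \<eta>)"
      by (intro cinner.tendsto blinfun.tendsto tendsto_const B)
    then show "(\<lambda>n. cinner (X n \<xi>) \<eta>) \<longlonglongrightarrow> cinner \<xi> (B \<eta>)"
      using X by (simp add: cinner_adj)
  qed
  then show "adjointable A"
    using is_adjoint_adjointable is_adjoint_def by metis
qed

interpretation blinfun_compose: bounded_bilinear "(o\<^sub>L)"
  by (rule bounded_bilinear_blinfun_compose)

section \<open>Generated algebras\<close>

lemma cstar_subalgebra_adjointable: "cstar_subalgebra {A :: 'g operator. adjointable A}"
  using closed_adjointable
  by (auto simp: cstar_subalgebra_def csubspace_def adjointable_adj)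
     (simp add: adjointable_def)

lemma csubspaceD:
  assumes "csubspace V"
  shows "0 \<in> V" and "A \<in> V \<Longrightarrow> B \<in> V \<Longrightarrow> A + B \<in> V" and "A \<in> V \<Longrightarrow> scalar_op c o\<^sub>L A \<in> V"
    and "A \<in> V \<Longrightarrow> r *\<^sub>R A \<in> V" and "A \<in> V \<Longrightarrow> - A \<in> V" and "A \<in> V \<Longrightarrow> B \<in> V \<Longrightarrow> A - B \<in> V"
proof -
  show 1: "0 \<in> V" "A \<in> V \<Longrightarrow> B \<in> V \<Longrightarrow> A + B \<in> V" "A \<in> V \<Longrightarrow> scalar_op c o\<^sub>L A \<in> V" for A B c
    using assms by (auto simp: csubspace_def)
  show "A \<in> V \<Longrightarrow> r *\<^sub>R A \<in> V" and 2: "A \<in> V \<Longrightarrow> - A \<in> V" for A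
    using 1 by (auto simp: scaleR_eq_scalar_op minus_eq_scalar_op)
  show "A \<in> V \<Longrightarrow> B \<in> V \<Longrightarrow> A - B \<in> V"
    using 1(2) [of A "- B"] 2 by simp
qed

lemma csubspace_Inter: "(\<And>V. V \<in> \<V> \<Longrightarrow> csubspace V) \<Longrightarrow> csubspace (\<Inter> \<V>)"
  by (auto simp: csubspace_def)

lemma csubspace_Int: "csubspace V \<Longrightarrow> csubspace W \<Longrightarrow> csubspace (V \<inter> W)"
  by (auto simp: csubspace_def)

text \<open>
  The adjointable operators form a C*-subalgebra, so the intersection defining the generated algebra
  is not over the empty family and consists of adjointable operators.
\<close>
lemma cstar_generated_subalgebra:
  assumes "\<And>A. A \<in> X \<Longrightarrow> adjointable A"
  shows "cstar_subalgebra (cstar_generated X)"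
    and "X \<subseteq> cstar_generated X"
    and "cstar_generated X \<subseteq> {A. adjointable A}"
proof -
  let ?F = "{\<A>. cstar_subalgebra \<A> \<and> X \<subseteq> \<A>}"
  have mem: "{A. adjointable A} \<in> ?F"
    using assms cstar_subalgebra_adjointable by auto
  show 1: "cstar_generated X \<subseteq> {A. adjointable A}"
    unfolding cstar_generated_def using mem by blast
  show "X \<subseteq> cstar_generated X"
    by (auto simp: cstar_generated_def)
  have "csubspace (\<Inter> ?F)"
    by (rule csubspace_Inter) (auto simp: cstar_subalgebra_def)
  moreover have "closed (\<Inter> ?F)"
    by (rule closed_Inter) (auto simp: cstar_subalgebra_def)
  ultimately show "cstar_subalgebra (cstar_generated X)"
    using 1 unfolding cstar_generated_def cstar_subalgebra_def
    by (auto simp: adjointable_def)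
qed

lemma closed_vimage_compose:
  fixes V :: "'g operator set"
  assumes "closed V"
  shows "closed {A. B o\<^sub>L A \<in> V}" and "closed {A. A o\<^sub>L B \<in> V}"
proof -
  have "closed ((\<lambda>A. B o\<^sub>L A) -` V)" "closed ((\<lambda>A. A o\<^sub>L B) -` V)"
    using assms by (intro closed_vimage continuous_intros; simp)+
  then show "closed {A. B o\<^sub>L A \<in> V}" and "closed {A. A o\<^sub>L B \<in> V}"
    by (simp_all add: vimage_def)
qed

text \<open>
  If a set of generators is closed under products and adjoints up to scalars, its closed linear span
  is already closed under products and adjoints.  Hence properties that define a closed subspace need
  only be checked on the generators.
\<close>
lemma cstar_generated_induct:
  assumes adjointable: "\<And>A. A \<in> X \<Longrightarrow> adjointable A"
    and prod: "\<And>A B. A \<in> X \<Longrightarrow> B \<in> X \<Longrightarrow> \<exists>c. \<exists>C\<in>X. A o\<^sub>L B = scalar_op c o\<^sub>L C"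
    and star: "\<And>A. A \<in> X \<Longrightarrow> \<exists>c. \<exists>C\<in>X. adj A = scalar_op c o\<^sub>L C"
    and V: "csubspace V" "closed V" "X \<subseteq> V"
  shows "cstar_generated X \<subseteq> V"
proof -
  \<comment> \<open>\<open>S\<close> is the closed span of \<open>X\<close>; closure under products is obtained in one factor at a time.\<close>
  define S where "S = \<Inter> {V. csubspace V \<and> closed V \<and> X \<subseteq> V}"
  have sub: "csubspace S" and closed: "closed S" and XS: "X \<subseteq> S"
    unfolding S_def by (auto intro!: csubspace_Inter closed_Inter)
  have min: "S \<subseteq> W" if "csubspace W" "closed W" "X \<subseteq> W" for W
    using that by (auto simp: S_def)
  have "csubspace {A :: 'a operator. adjointable A}"
    using cstar_subalgebra_adjointable unfolding cstar_subalgebra_def by blast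
  then have adjS: "adjointable A" if "A \<in> S" for A
    using min [of "{A. adjointable A}"] closed_adjointable adjointable that by auto
  have X_S: "A o\<^sub>L B \<in> S" if "A \<in> X" "B \<in> S" for A B
  proof -
    have "csubspace {B. A o\<^sub>L B \<in> S}"
      using sub adjointable [OF \<open>A \<in> X\<close>] unfolding csubspace_def
      by (auto simp: blinfun_compose.add_right blinfun_compose.zero_right compose_scalar_op)
    moreover have "X \<subseteq> {B. A o\<^sub>L B \<in> S}"
      using prod [OF \<open>A \<in> X\<close>] XS csubspaceD(3) [OF sub] by fastforce
    ultimately have "S \<subseteq> {B. A o\<^sub>L B \<in> S}"
      using closed_vimage_compose [OF closed] by (intro min)
    then show ?thesis using that by auto
  qed
  have S_S: "A o\<^sub>L B \<in> S" if "A \<in> S" "B \<in> S" for A B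
  proof -
    have "csubspace {A. A o\<^sub>L B \<in> S}"
      using sub unfolding csubspace_def
      by (auto simp: blinfun_compose.add_left blinfun_compose.zero_left scalar_op_compose)
    moreover have "X \<subseteq> {A. A o\<^sub>L B \<in> S}"
      using X_S \<open>B \<in> S\<close> by auto
    ultimately have "S \<subseteq> {A. A o\<^sub>L B \<in> S}"
      using closed_vimage_compose [OF closed] by (intro min)
    then show ?thesis using that by auto
  qed
  have adj_S: "adj A \<in> S" if "A \<in> S" for A
  proof -
    let ?W = "{A. adjointable A \<and> adj A \<in> S}"
    have "csubspace ?W"
      using sub unfolding csubspace_def by (auto simp: adj_add adj_scalar_op_compose)
    moreover have "X \<subseteq> ?W"
      using adjointable star XS csubspaceD(3) [OF sub] by fastforce
    moreover have "closed ?W"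
      unfolding closed_sequential_limits
    proof (intro allI impI, elim conjE)
      fix Y A assume Y: "\<forall>n. Y n \<in> ?W" and lim: "Y \<longlonglongrightarrow> A"
      have A: "adjointable A"
        using closed_adjointable [unfolded closed_sequential_limits, rule_format, of Y A] Y lim by simp
      have "norm (adj (Y n) - adj A) = norm (Y n - A)" for n
        using Y A norm_adj [of "Y n - A"] by (simp add: adj_diff)
      then have "(\<lambda>n. adj (Y n)) \<longlonglongrightarrow> adj A"
        using lim by (simp add: tendsto_iff dist_norm)
      then have "adj A \<in> S"
        using closed_sequentially [OF closed, of "\<lambda>n. adj (Y n)"] Y by auto
      then show "A \<in> ?W" using A by simp
    qed
    ultimately show ?thesis using min [of ?W] that by auto
  qed
  have "cstar_subalgebra S"
    using sub closed S_S adj_S adjS by (auto simp: cstar_subalgebra_def adjointable_def)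
  then have "cstar_generated X \<subseteq> S"
    using XS by (auto simp: cstar_generated_def)
  with min [OF V] show ?thesis by blast
qed

section \<open>Boundedness of tracial states\<close>

lemma cstar_subalgebraD:
  assumes "cstar_subalgebra \<A>"
  shows "csubspace \<A>" and "A \<in> \<A> \<Longrightarrow> B \<in> \<A> \<Longrightarrow> A o\<^sub>L B \<in> \<A>" and "A \<in> \<A> \<Longrightarrow> adj A \<in> \<A>" and "closed \<A>"
  using assms by (auto simp: cstar_subalgebra_def)

lemma closed_self_adjoint: "closed {X :: 'g operator. is_adjoint X X}"
  unfolding is_adjoint_def
  by (intro closed_Collect_all closed_Collect_eq cinner.continuous_on blinfun.continuous_on
      continuous_intros)

text \<open>
  The equation \<open>(1 - B)\<^sup>2 = 1 - A\<close> reads \<open>B = (A + B\<^sup>2) / 2\<close>, and the right-hand side is a contraction, with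
  constant \<open>norm A\<close>, of the self-adjoint elements of norm at most \<open>norm A\<close>.
\<close>
lemma square_root_exists:
  assumes \<A>: "cstar_subalgebra \<A>" and A: "A \<in> \<A>" "is_adjoint A A" "norm A < 1"
  shows "\<exists>B\<in>\<A>. is_adjoint B B \<and> (id_blinfun - B) o\<^sub>L (id_blinfun - B) = id_blinfun - A"
proof -
  define r where "r = norm A"
  have r: "0 \<le> r" "r < 1" using A by (auto simp: r_def)
  define s where "s = \<A> \<inter> {X. is_adjoint X X} \<inter> cball 0 r"
  define f where "f X = (1/2) *\<^sub>R (A + (X o\<^sub>L X))" for X
  note \<A>' = cstar_subalgebraD [OF \<A>] csubspaceD [OF cstar_subalgebraD(1) [OF \<A>]]
  have "closed s"
    unfolding s_def by (intro closed_Int \<A>' closed_self_adjoint closed_cball)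
  then have "complete s" by (simp add: complete_eq_closed)
  moreover have "s \<noteq> {}"
    using A by (auto simp: s_def r_def)
  moreover have "f ` s \<subseteq> s"
  proof (rule image_subsetI)
    fix X assume X: "X \<in> s"
    then have nX: "norm X \<le> r" by (simp add: s_def)
    have "norm (A + (X o\<^sub>L X)) \<le> r + r * r"
      using norm_triangle_ineq [of A "X o\<^sub>L X"] norm_blinfun_compose [of X X]
        mult_mono [OF nX nX r(1) norm_ge_zero] by (simp add: r_def)
    also have "\<dots> \<le> 2 * r"
      using mult_left_mono [of r 1 r] r by simp
    finally have "norm (f X) \<le> r"
      by (simp add: f_def)
    moreover have "is_adjoint (f X) (f X)"
      using X A
      by (simp add: s_def f_def is_adjoint_def blinfun.add_left blinfun.scaleR_left
          cinner_add_left cinner_add_right cinner.scaleR_left cinner.scaleR_right)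
    ultimately show "f X \<in> s"
      using X A by (auto simp: s_def f_def intro!: \<A>')
  qed
  moreover have "dist (f X) (f Y) \<le> r * dist X Y" if "X \<in> s" "Y \<in> s" for X Y
  proof -
    have "f X - f Y = (1/2) *\<^sub>R ((X o\<^sub>L (X - Y)) + ((X - Y) o\<^sub>L Y))"
      by (simp add: f_def blinfun_compose.diff_left blinfun_compose.diff_right
          scaleR_diff_right scaleR_add_right)
    then have "norm (f X - f Y) = norm ((X o\<^sub>L (X - Y)) + ((X - Y) o\<^sub>L Y)) / 2"
      by simp
    also have "\<dots> \<le> (norm X * norm (X - Y) + norm (X - Y) * norm Y) / 2"
      using norm_triangle_ineq [of "X o\<^sub>L (X - Y)" "(X - Y) o\<^sub>L Y"]
        norm_blinfun_compose [of X "X - Y"] norm_blinfun_compose [of "X - Y" Y] by (intro divide_right_mono) linarith+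
    also have "\<dots> \<le> (r * norm (X - Y) + norm (X - Y) * r) / 2"
      using that by (intro divide_right_mono add_mono mult_right_mono mult_left_mono) (auto simp: s_def)
    finally show ?thesis by (simp add: dist_norm)
  qed
  ultimately obtain B where B: "B \<in> s" "f B = B"
    using Banach_fix [of s r f] r by metis
  have "2 *\<^sub>R f B = A + (B o\<^sub>L B)" by (simp add: f_def)
  then have "B + B = A + (B o\<^sub>L B)" using B(2) by (simp add: scaleR_2)
  then have "(id_blinfun - B) o\<^sub>L (id_blinfun - B) = id_blinfun - A"
    by (simp add: blinfun_compose.diff_left blinfun_compose.diff_right algebra_simps)
  with B show ?thesis by (auto simp: s_def)
qed

lemma tracial_stateD:
  assumes "tracial_state \<A> \<tau>"
  shows "A \<in> \<A> \<Longrightarrow> B \<in> \<A> \<Longrightarrow> \<tau> (A + B) = \<tau> A + \<tau> B"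
    and "A \<in> \<A> \<Longrightarrow> \<tau> (scalar_op c o\<^sub>L A) = c * \<tau> A"
    and "A \<in> \<A> \<Longrightarrow> \<tau> (adj A o\<^sub>L A) \<in> \<real>\<^sub>\<ge>\<^sub>0"
    and "\<tau> id_blinfun = 1"
    and "A \<in> \<A> \<Longrightarrow> B \<in> \<A> \<Longrightarrow> \<tau> (A o\<^sub>L B) = \<tau> (B o\<^sub>L A)"
    and "A \<in> \<A> \<Longrightarrow> \<tau> (- A) = - \<tau> A"
    and "A \<in> \<A> \<Longrightarrow> \<tau> (r *\<^sub>R A) = complex_of_real r * \<tau> A"
  using assms by (auto simp: tracial_state_def minus_eq_scalar_op scaleR_eq_scalar_op)

text \<open>
  For self-adjoint \<open>A\<close> of norm less than 1 both \<open>1 + A\<close> and \<open>1 - A\<close> are squares of self-adjoint elements, so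
  \<open>\<tau> A\<close> lies in \<open>[-1, 1]\<close>.  Splitting a general element into two self-adjoint parts costs the factor 2.
\<close>
lemma tracial_state_bounded:
  assumes \<A>: "cstar_subalgebra \<A>" "\<A> \<subseteq> {A. adjointable A}" "id_blinfun \<in> \<A>"
    and \<tau>: "tracial_state \<A> \<tau>" and A: "A \<in> \<A>"
  shows "cmod (\<tau> A) \<le> 2 * norm A"
proof -
  note \<A>' = cstar_subalgebraD [OF \<A>(1)] csubspaceD [OF cstar_subalgebraD(1) [OF \<A>(1)]]
  note \<tau>' = tracial_stateD [OF \<tau>]
  have pos: "1 + \<tau> A \<in> \<real>\<^sub>\<ge>\<^sub>0" if "A \<in> \<A>" "is_adjoint A A" "norm A < 1" for A
  proof -
    have "is_adjoint (- A) (- A)"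
      using that(2) by (simp add: is_adjoint_def blinfun.minus_left cinner.minus_left cinner.minus_right)
    moreover have "- A \<in> \<A>" "norm (- A) < 1"
      using that by (auto intro: \<A>')
    ultimately obtain B where B: "B \<in> \<A>" "is_adjoint B B"
        "(id_blinfun - B) o\<^sub>L (id_blinfun - B) = id_blinfun - (- A)"
      using square_root_exists [OF \<A>(1), of "- A"] by blast
    have "adj (id_blinfun - B) = id_blinfun - B"
      using B \<A>(2) by (auto simp: adj_diff adj_unique)
    then have "\<tau> (id_blinfun + A) \<in> \<real>\<^sub>\<ge>\<^sub>0"
      using \<tau>'(3) [of "id_blinfun - B"] B \<A>'(10) [OF \<A>(3) B(1)] by simp
    then show ?thesis
      using that by (simp add: \<tau>' \<A>)
  qed
  have unit: "cmod (\<tau> A) \<le> 1" if "A \<in> \<A>" "is_adjoint A A" "norm A < 1" for A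
  proof -
    have "is_adjoint (- A) (- A)"
      using that(2) by (simp add: is_adjoint_def blinfun.minus_left cinner.minus_left cinner.minus_right)
    then have "1 + \<tau> (- A) \<in> \<real>\<^sub>\<ge>\<^sub>0" "1 + \<tau> A \<in> \<real>\<^sub>\<ge>\<^sub>0"
      using that by (auto intro!: pos \<A>')
    then have "1 - \<tau> A \<in> \<real>\<^sub>\<ge>\<^sub>0" "1 + \<tau> A \<in> \<real>\<^sub>\<ge>\<^sub>0"
      using that \<tau>'(6) by auto
    then have "Im (\<tau> A) = 0" "\<bar>Re (\<tau> A)\<bar> \<le> 1"
      by (auto simp: complex_nonneg_Reals_iff)
    then show ?thesis
      by (simp add: cmod_eq_Re)
  qed
  have self: "cmod (\<tau> A) \<le> norm A" if "A \<in> \<A>" "is_adjoint A A" for A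
  proof (rule field_le_epsilon)
    fix e :: real assume "0 < e"
    define t where "t = norm A + e"
    have t: "0 < t" unfolding t_def using \<open>0 < e\<close> by (intro add_nonneg_pos norm_ge_zero)
    have "cmod (\<tau> ((1 / t) *\<^sub>R A)) \<le> 1"
    proof (rule unit)
      show "is_adjoint ((1 / t) *\<^sub>R A) ((1 / t) *\<^sub>R A)"
        using that(2) by (simp add: is_adjoint_def blinfun.scaleR_left cinner.scaleR_left cinner.scaleR_right)
      show "norm ((1 / t) *\<^sub>R A) < 1"
        using t \<open>0 < e\<close> by (simp add: t_def)
    qed (use that in \<open>auto intro: \<A>'\<close>)
    then show "cmod (\<tau> A) \<le> norm A + e"
      using t that by (simp add: \<tau>' norm_divide t_def [symmetric] divide_le_eq)
  qed
  have adjA: "adjointable A" using A \<A>(2) by auto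
  define S T where "S = A + adj A" and "T = scalar_op \<i> o\<^sub>L (A - adj A)"
  have "is_adjoint S S"
    using is_adjoint_adj [of S] adjA by (simp add: S_def adj_add adj_adj adjointable_adj add.commute)
  moreover have "is_adjoint T T"
  proof -
    have "adj T = scalar_op (- \<i>) o\<^sub>L (adj A - A)"
      using adjA by (simp add: T_def adj_scalar_op_compose adj_diff adj_adj adjointable_adj)
    also have "\<dots> = T"
      by (rule blinfun_eqI) (simp add: T_def blinfun.diff_left algebra_simps minus_eq_scalar_op)
    finally show ?thesis
      using is_adjoint_adj [of T] adjA by (simp add: T_def adjointable_adj)
  qed
  moreover have mem: "S \<in> \<A>" "T \<in> \<A>"
    using A by (auto simp: S_def T_def intro!: \<A>')
  ultimately have "cmod (\<tau> S) \<le> norm S" "cmod (\<tau> T) \<le> norm T"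
    by (auto intro: self)
  moreover have "norm S \<le> 2 * norm A"
    using norm_triangle_ineq [of A "adj A"] adjA by (simp add: S_def norm_adj)
  moreover have "norm (scalar_op \<i> :: 'a operator) \<le> 1"
    by (rule norm_blinfun_bound) (auto simp: norm_scaleC)
  then have "norm T \<le> norm (A - adj A)"
    using norm_blinfun_compose [of "scalar_op \<i>" "A - adj A"]
      mult_right_mono [of "norm (scalar_op \<i> :: 'a operator)" 1 "norm (A - adj A)"] by (simp add: T_def)
  then have "norm T \<le> 2 * norm A"
    using norm_triangle_ineq4 [of A "adj A"] adjA by (simp add: norm_adj)
  moreover have "2 * \<tau> A = \<tau> S + (- \<i>) * \<tau> T"
  proof -
    have "\<tau> S = \<tau> A + \<tau> (adj A)" "\<tau> (A - adj A) = \<tau> A - \<tau> (adj A)"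
      using A \<tau>'(1) [of A "- adj A"] by (auto simp: S_def \<tau>' \<A>')
    moreover have "\<tau> T = \<i> * \<tau> (A - adj A)"
      using A by (simp add: T_def \<tau>' \<A>')
    ultimately show ?thesis by (simp add: algebra_simps)
  qed
  then have "2 * cmod (\<tau> A) \<le> cmod (\<tau> S) + cmod (\<tau> T)"
    using norm_triangle_ineq [of "\<tau> S" "(- \<i>) * \<tau> T"] norm_mult [of 2 "\<tau> A"] by (simp add: norm_mult)
  ultimately show ?thesis by linarith
qed

section \<open>Vector states and twisted group algebras\<close>

definition vector_state :: "'g ell2 \<Rightarrow> 'g operator \<Rightarrow> complex"
  where "vector_state \<xi> A = cinner \<xi> (A \<xi>)"

lemma vector_state_simps:
  "vector_state \<xi> (A + B) = vector_state \<xi> A + vector_state \<xi> B"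
  "vector_state \<xi> (scalar_op c o\<^sub>L A) = c * vector_state \<xi> A"
  "vector_state \<xi> 0 = 0"
  by (simp_all add: vector_state_def blinfun.add_left cinner_add_right cinner.zero_right)

lemma vector_state_diff: "vector_state \<xi> (A - B) = vector_state \<xi> A - vector_state \<xi> B"
  by (simp add: vector_state_def blinfun.diff_left cinner.diff_right)

lemma vector_state_bound: "cmod (vector_state \<xi> A) \<le> norm A * (norm \<xi>)\<^sup>2"
proof -
  have "cmod (vector_state \<xi> A) \<le> norm \<xi> * norm (A \<xi>)"
    unfolding vector_state_def by (rule cinner_cauchy_schwarz)
  also have "\<dots> \<le> norm \<xi> * (norm A * norm \<xi>)"
    by (intro mult_left_mono norm_blinfun norm_ge_zero)
  finally show ?thesis by (simp add: power2_eq_square mult_ac)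
qed

lemma continuous_vector_state [continuous_intros]:
  "continuous_on S f \<Longrightarrow> continuous_on S (\<lambda>x. vector_state \<xi> (f x))"
  unfolding vector_state_def
  by (intro cinner.continuous_on blinfun.continuous_on continuous_intros)

lemma vector_state_adj:
  "adjointable A \<Longrightarrow> vector_state \<xi> (adj A o\<^sub>L A) = complex_of_real ((norm (A \<xi>))\<^sup>2)"
  unfolding vector_state_def by (rule norm_apply_sq)

definition additive_subgroup :: "'g::group_add set \<Rightarrow> bool"
  where "additive_subgroup K \<longleftrightarrow> 0 \<in> K \<and> (\<forall>g\<in>K. \<forall>h\<in>K. g + h \<in> K) \<and> (\<forall>g\<in>K. - g \<in> K)"

locale cocycle =
  fixes \<sigma> :: "'g::group_add \<Rightarrow> 'g \<Rightarrow> complex"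
  assumes cocycle: "normalized_2_cocycle \<sigma>"
begin

abbreviation L :: "'g \<Rightarrow> 'g operator"
  where "L \<equiv> lambda_op \<sigma>"

definition subgroup_algebra :: "'g set \<Rightarrow> 'g operator set"
  where "subgroup_algebra K = cstar_generated (L ` K)"

lemma cmod_cocycle [simp]: "cmod (\<sigma> g h) = 1"
  using cocycle by (simp add: normalized_2_cocycle_def)

lemma cocycle_zero [simp]: "\<sigma> g 0 = 1" "\<sigma> 0 g = 1"
  using cocycle by (auto simp: normalized_2_cocycle_def)

lemma cocycle_eq: "\<sigma> g h * \<sigma> (g + h) k = \<sigma> h k * \<sigma> g (h + k)"
  using cocycle by (auto simp: normalized_2_cocycle_def)

lemma cocycle_minus: "\<sigma> g (- g) = \<sigma> (- g) g"
  using cocycle_eq [of g "- g" g] by simp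

lemma cocycle_cnj [simp]: "cnj (\<sigma> g h) * \<sigma> g h = 1"
  using complex_norm_square [of "\<sigma> g h"] by (simp add: mult.commute)

lemma Rep_L: "Rep_ell2 (L g \<xi>) h = \<sigma> g (- g + h) * Rep_ell2 \<xi> (- g + h)"
  by (rule lambda_op_apply [OF cocycle])

lemma L_zero: "L 0 = id_blinfun"
  by (rule lambda_op_0 [OF cocycle])

lemma L_L: "L g o\<^sub>L L h = scalar_op (\<sigma> g h) o\<^sub>L L (g + h)"
  by (rule lambda_op_compose [OF cocycle])

lemma L_delta: "L g (delta h) = \<sigma> g h *\<^sub>C delta (g + h)"
proof (rule ell2_eqI)
  fix k
  have "- g + k = h \<longleftrightarrow> k = g + h"
    by (metis add_minus_cancel minus_add_cancel)
  then show "Rep_ell2 (L g (delta h)) k = Rep_ell2 (\<sigma> g h *\<^sub>C delta (g + h)) k"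
    by (auto simp: Rep_L Rep_delta scaleC.rep_eq)
qed

lemma L_linear: "complex_linear (L g)"
  unfolding complex_linear_def
  by (intro allI ell2_eqI) (simp add: Rep_L scaleC.rep_eq)

lemma cinner_L_L: "cinner (L g \<xi>) (L g \<eta>) = cinner \<xi> \<eta>"
proof -
  have "cinner (L g \<xi>) (L g \<eta>) = (\<Sum>\<^sub>\<infinity>h. cnj (Rep_ell2 \<xi> (- g + h)) * Rep_ell2 \<eta> (- g + h))"
    unfolding cinner.rep_eq
  proof (rule infsum_cong)
    fix h
    have "cnj (\<sigma> g (- g + h)) * \<sigma> g (- g + h) = 1" by simp
    then show "cnj (Rep_ell2 (L g \<xi>) h) * Rep_ell2 (L g \<eta>) h =
        cnj (Rep_ell2 \<xi> (- g + h)) * Rep_ell2 \<eta> (- g + h)"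
      by (simp add: Rep_L algebra_simps flip: mult.assoc)
  qed
  also have "\<dots> = cinner \<xi> \<eta>"
    unfolding cinner.rep_eq
    using infsum_reindex_bij_betw [OF bij_left_translation [of g],
        of "\<lambda>h. cnj (Rep_ell2 \<xi> h) * Rep_ell2 \<eta> h"] by simp
  finally show ?thesis .
qed

lemma is_adjoint_L: "is_adjoint (L g) (scalar_op (cnj (\<sigma> g (- g))) o\<^sub>L L (- g))"
  unfolding is_adjoint_def
proof (intro allI)
  fix \<xi> \<eta>
  have "L g (L (- g) \<eta>) = \<sigma> g (- g) *\<^sub>C \<eta>"
    using arg_cong [OF L_L [of g "- g"], of "\<lambda>A. A \<eta>"] by (simp add: L_zero)
  then have "\<eta> = L g ((scalar_op (cnj (\<sigma> g (- g))) o\<^sub>L L (- g)) \<eta>)"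
    by (simp add: complex_linearD [OF L_linear])
  then show "cinner (L g \<xi>) \<eta> = cinner \<xi> ((scalar_op (cnj (\<sigma> g (- g))) o\<^sub>L L (- g)) \<eta>)"
    using cinner_L_L by metis
qed

lemma adjointable_L [simp]: "adjointable (L g)"
  using is_adjoint_L is_adjoint_adjointable by blast

lemma adj_L: "adj (L g) = scalar_op (cnj (\<sigma> g (- g))) o\<^sub>L L (- g)"
  by (rule adj_unique [OF is_adjoint_L])

lemma L_unitary [simp]: "adj (L g) o\<^sub>L L g = id_blinfun" "L g o\<^sub>L adj (L g) = id_blinfun"
proof -
  show "adj (L g) o\<^sub>L L g = id_blinfun"
    by (rule blinfun_eqI, rule cinner_ext) (simp add: cinner_adj [symmetric] cinner_L_L)
  show "L g o\<^sub>L adj (L g) = id_blinfun"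
    by (simp add: adj_L compose_scalar_op L_L L_zero scalar_op_scalar_op scalar_op_compose [symmetric])
       (rule blinfun_eqI, simp)
qed

lemma norm_L_apply [simp]: "norm (L g \<xi>) = norm \<xi>"
proof -
  have "complex_of_real ((norm (L g \<xi>))\<^sup>2) = complex_of_real ((norm \<xi>)\<^sup>2)"
    unfolding cinner_self [symmetric] by (rule cinner_L_L)
  then show ?thesis
    by (simp only: of_real_eq_iff) simp
qed

lemma reduced_eq: "reduced_cstar \<sigma> = subgroup_algebra UNIV"
  by (simp add: reduced_cstar_def subgroup_algebra_def)

lemma subgroup_algebra_facts:
  shows subgroup_algebra_cstar: "cstar_subalgebra (subgroup_algebra K)"
    and L_mem: "g \<in> K \<Longrightarrow> L g \<in> subgroup_algebra K"
    and subgroup_algebra_adjointable: "A \<in> subgroup_algebra K \<Longrightarrow> adjointable A"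
proof -
  have X: "A \<in> L ` K \<Longrightarrow> adjointable A" for A by auto
  have *: "cstar_subalgebra (subgroup_algebra K)" "L ` K \<subseteq> subgroup_algebra K"
      "subgroup_algebra K \<subseteq> {A. adjointable A}"
    unfolding subgroup_algebra_def by (intro cstar_generated_subalgebra X; assumption)+
  show "cstar_subalgebra (subgroup_algebra K)" by (rule *)
  show "g \<in> K \<Longrightarrow> L g \<in> subgroup_algebra K" "A \<in> subgroup_algebra K \<Longrightarrow> adjointable A"
    using * by auto
qed

lemma subgroup_algebra_mono: "K \<subseteq> K' \<Longrightarrow> subgroup_algebra K \<subseteq> subgroup_algebra K'"
  unfolding subgroup_algebra_def cstar_generated_def by blast

lemma id_mem: "additive_subgroup K \<Longrightarrow> id_blinfun \<in> subgroup_algebra K"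
  using L_mem [of 0 K] by (simp add: additive_subgroup_def L_zero)

text \<open>
  Products and adjoints of the unitaries are again unitaries up to scalars, so the induction principle
  for generated algebras applies.
\<close>
lemma subgroup_algebra_induct:
  assumes "additive_subgroup K" and V: "csubspace V" "closed V" and gen: "\<And>g. g \<in> K \<Longrightarrow> L g \<in> V"
    and A: "A \<in> subgroup_algebra K"
  shows "A \<in> V"
proof -
  have "cstar_generated (L ` K) \<subseteq> V"
  proof (rule cstar_generated_induct)
    fix A B assume "A \<in> L ` K" "B \<in> L ` K"
    then show "\<exists>c. \<exists>C\<in>L ` K. A o\<^sub>L B = scalar_op c o\<^sub>L C"
      using assms(1) by (force simp: L_L additive_subgroup_def)
  next
    fix A assume "A \<in> L ` K"
    then show "\<exists>c. \<exists>C\<in>L ` K. adj A = scalar_op c o\<^sub>L C"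
      using assms(1) by (force simp: adj_L additive_subgroup_def)
  qed (use V gen in auto)
  with A show ?thesis by (auto simp: subgroup_algebra_def)
qed

lemma additive_subgroup_UNIV: "additive_subgroup (UNIV :: 'g set)"
  by (simp add: additive_subgroup_def)

abbreviation canonical_trace :: "'g operator \<Rightarrow> complex"
  where "canonical_trace \<equiv> vector_state (delta 0)"

lemma canonical_trace_L: "canonical_trace (L g) = (if g = 0 then 1 else 0)"
  by (simp add: vector_state_def L_delta cinner_delta Rep_delta)

text \<open>
  The trace identity is linear and continuous in each of the two operators separately, so it follows
  from its instances for unitaries by fixing first one operator and then the other.
\<close>
lemma vector_state_commute:
  assumes "additive_subgroup K"
    and "\<And>g h. g \<in> K \<Longrightarrow> h \<in> K \<Longrightarrow> vector_state \<xi> (L g o\<^sub>L L h) = vector_state \<xi> (L h o\<^sub>L L g)"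
    and A: "A \<in> subgroup_algebra K" and B: "B \<in> subgroup_algebra K"
  shows "vector_state \<xi> (A o\<^sub>L B) = vector_state \<xi> (B o\<^sub>L A)"
proof -
  have sub: "csubspace ({A. adjointable A} \<inter> {A. vector_state \<xi> (B o\<^sub>L A) = vector_state \<xi> (A o\<^sub>L B)})"
    if "adjointable B" for B
    using that unfolding csubspace_def
    by (auto simp: vector_state_simps blinfun_compose.add_left blinfun_compose.add_right
        compose_scalar_op scalar_op_compose blinfun_compose.zero_left blinfun_compose.zero_right)
  have cl: "closed ({A. adjointable A} \<inter> {A. vector_state \<xi> (B o\<^sub>L A) = vector_state \<xi> (A o\<^sub>L B)})" for B
    by (intro closed_Int closed_adjointable closed_Collect_eq continuous_intros)
  have 1: "vector_state \<xi> (L g o\<^sub>L B) = vector_state \<xi> (B o\<^sub>L L g)" if "g \<in> K" "B \<in> subgroup_algebra K" for g B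
    using subgroup_algebra_induct [OF assms(1) sub [of "L g"] cl _ that(2)] assms(2) [OF that(1)] by auto
  show ?thesis
    using subgroup_algebra_induct [OF assms(1) sub [of B] cl _ A] 1 B subgroup_algebra_adjointable
    by auto
qed

lemma canonical_trace_commute:
  assumes "A \<in> reduced_cstar \<sigma>" "B \<in> reduced_cstar \<sigma>"
  shows "canonical_trace (A o\<^sub>L B) = canonical_trace (B o\<^sub>L A)"
proof (rule vector_state_commute [OF additive_subgroup_UNIV])
  fix g h :: 'g
  show "canonical_trace (L g o\<^sub>L L h) = canonical_trace (L h o\<^sub>L L g)"
  proof (cases "g + h = 0")
    case True
    then have "h = - g"
      by (metis add_minus_cancel add.right_neutral minus_add_cancel)
    then show ?thesis by (simp add: L_L vector_state_simps cocycle_minus)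
  next
    case False
    have "h + g \<noteq> 0"
    proof
      assume "h + g = 0"
      then have "h = - g" by (simp only: eq_neg_iff_add_eq_0)
      then show False using False by simp
    qed
    with False show ?thesis by (simp add: L_L vector_state_simps canonical_trace_L)
  qed
qed (use assms in \<open>auto simp: reduced_eq\<close>)

lemma canonical_trace_tracial: "tracial_state (reduced_cstar \<sigma>) (restrict canonical_trace (reduced_cstar \<sigma>))"
proof -
  note r = subgroup_algebra_cstar [of UNIV, folded reduced_eq]
  note r' = cstar_subalgebraD [OF r] csubspaceD [OF cstar_subalgebraD(1) [OF r]]
  show ?thesis
    unfolding tracial_state_def
    using subgroup_algebra_adjointable [of _ UNIV, folded reduced_eq] canonical_trace_commute
      id_mem [OF additive_subgroup_UNIV, folded reduced_eq]
    by (auto simp: r' vector_state_simps vector_state_adj)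
       (simp add: vector_state_def cinner_self)
qed

text \<open>
  By the trace identity \<open>A (L g \<delta>)\<close> has the same norm for all \<open>g\<close>, where \<open>\<delta>\<close> is the point mass at the
  identity, so \<open>A\<close> annihilates every point mass; then the adjoint of \<open>A\<close> has only zero coefficients.
\<close>
lemma canonical_trace_faithful:
  assumes A: "A \<in> reduced_cstar \<sigma>" and 0: "canonical_trace (adj A o\<^sub>L A) = 0"
  shows "A = 0"
proof -
  note r = subgroup_algebra_cstar [of UNIV, folded reduced_eq]
  note r' = cstar_subalgebraD [OF r] csubspaceD [OF cstar_subalgebraD(1) [OF r]]
  have adj: "adjointable A"
    using A subgroup_algebra_adjointable by (simp add: reduced_eq)
  have Ad: "A (delta g) = 0" for g
  proof -
    have Lg: "L g \<in> reduced_cstar \<sigma>"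
      by (simp add: reduced_eq L_mem)
    have "complex_of_real ((norm (A (L g (delta 0))))\<^sup>2) = canonical_trace (adj (A o\<^sub>L L g) o\<^sub>L (A o\<^sub>L L g))"
      using adj by (subst vector_state_adj) auto
    also have "\<dots> = canonical_trace (adj (L g) o\<^sub>L (adj A o\<^sub>L A o\<^sub>L L g))"
      using adj by (simp add: adj_compose blinfun_compose_assoc)
    also have "\<dots> = canonical_trace (adj A o\<^sub>L A o\<^sub>L L g o\<^sub>L adj (L g))"
      using A Lg by (intro canonical_trace_commute) (auto intro: r')
    also have "\<dots> = 0"
      using 0 by (simp add: blinfun_compose_assoc)
    finally show ?thesis by (simp add: L_delta)
  qed
  have "adj A \<eta> = 0" for \<eta>
  proof (rule ell2_eqI)
    fix g
    have "Rep_ell2 (adj A \<eta>) g = cinner (A (delta g)) \<eta>"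
      by (simp add: cinner_adj adj cinner_delta)
    then show "Rep_ell2 (adj A \<eta>) g = Rep_ell2 0 g"
      by (simp add: Ad cinner.zero_left zero_ell2.rep_eq)
  qed
  then have "adj A = 0" by (intro blinfun_eqI) simp
  then show ?thesis using adj_adj [OF adj] by simp
qed

end

section \<open>Averaging over conjugates\<close>

context cocycle
begin

definition Ad :: "'g \<Rightarrow> 'g operator \<Rightarrow> 'g operator"
  where "Ad g A = L g o\<^sub>L A o\<^sub>L adj (L g)"

lemma adjointable_adj_L [simp]: "adjointable (adj (L g))"
  by (simp add: adjointable_adj)

lemma L_unitary_apply [simp]: "L g (adj (L g) \<xi>) = \<xi>" "adj (L g) (L g \<xi>) = \<xi>"
  by (simp_all flip: blinfun_apply_blinfun_compose)

lemma cocycle_cnj' [simp]: "\<sigma> g h * cnj (\<sigma> g h) = 1"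
  by (subst mult.commute) (rule cocycle_cnj)

lemma L_unitary_assoc [simp]: "L g o\<^sub>L (adj (L g) o\<^sub>L A) = A" "adj (L g) o\<^sub>L (L g o\<^sub>L A) = A"
  by (rule blinfun_eqI, simp)+

lemma norm_adj_L_apply [simp]: "norm (adj (L g) \<xi>) = norm \<xi>"
  by (metis L_unitary_apply(1) norm_L_apply)

lemma Ad_add: "Ad g (A + B) = Ad g A + Ad g B"
  by (simp add: Ad_def blinfun_compose.add_left blinfun_compose.add_right)

lemma Ad_zero [simp]: "Ad g 0 = 0"
  by (simp add: Ad_def blinfun_compose.zero_left blinfun_compose.zero_right)

lemma Ad_scalar: "Ad g (scalar_op c o\<^sub>L A) = scalar_op c o\<^sub>L Ad g A"
  by (simp add: Ad_def compose_scalar_op scalar_op_compose)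

lemma Ad_scaleR: "Ad g (r *\<^sub>R A) = r *\<^sub>R Ad g A"
  by (simp add: scaleR_eq_scalar_op Ad_scalar)

lemma Ad_id [simp]: "Ad g id_blinfun = id_blinfun"
  by (simp add: Ad_def)

lemma Ad_0 [simp]: "Ad 0 A = A"
  by (simp add: Ad_def L_zero)

lemma Ad_compose: "Ad g A o\<^sub>L Ad g B = Ad g (A o\<^sub>L B)"
  by (simp add: Ad_def blinfun_compose_assoc)

lemma adjointable_Ad [simp]: "adjointable A \<Longrightarrow> adjointable (Ad g A)"
  by (simp add: Ad_def)

lemma adj_Ad: "adjointable A \<Longrightarrow> adj (Ad g A) = Ad g (adj A)"
  by (simp add: Ad_def adj_compose adj_adj blinfun_compose_assoc)

text \<open>
  The cocycle enters once with each sign, so conjugation is a genuine action of the group.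
\<close>
lemma Ad_Ad: "adjointable A \<Longrightarrow> Ad g (Ad h A) = Ad (g + h) A"
proof -
  assume A: "adjointable A"
  have "Ad g (Ad h A) = (L g o\<^sub>L L h) o\<^sub>L A o\<^sub>L adj (L g o\<^sub>L L h)"
    by (simp add: Ad_def adj_compose blinfun_compose_assoc)
  also have "\<dots> = scalar_op (\<sigma> g h * cnj (\<sigma> g h)) o\<^sub>L Ad (g + h) A"
    using A by (simp add: L_L Ad_def adj_scalar_op_compose compose_scalar_op scalar_op_compose
        scalar_op_scalar_op)
  finally show ?thesis
    by simp
qed

lemma norm_Ad: "norm (Ad g A) \<le> norm A"
proof (rule norm_blinfun_bound)
  show "norm (Ad g A \<xi>) \<le> norm A * norm \<xi>" for \<xi>
    using norm_blinfun [of A "adj (L g) \<xi>"] by (simp add: Ad_def)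
qed simp

lemma Ad_L: "\<exists>c. cmod c = 1 \<and> Ad g (L h) = scalar_op c o\<^sub>L L (g + h - g)"
  by (rule exI [of _ "\<sigma> g h * (cnj (\<sigma> g (- g)) * \<sigma> (g + h) (- g))"])
     (simp add: Ad_def L_L adj_L scalar_op_compose compose_scalar_op scalar_op_scalar_op norm_mult mult_ac)

lemma Ad_L_commuting:
  assumes "g + h = h + g"
  shows "Ad g (L h) = scalar_op (\<sigma> g h * cnj (\<sigma> h g)) o\<^sub>L L h"
proof -
  have "L g o\<^sub>L L h = scalar_op (\<sigma> g h * cnj (\<sigma> h g)) o\<^sub>L (L h o\<^sub>L L g)"
    by (simp add: L_L scalar_op_scalar_op assms mult.assoc)
  then show ?thesis
    by (simp add: Ad_def blinfun_compose_assoc)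
qed

lemma continuous_Ad [continuous_intros]:
  "continuous_on S f \<Longrightarrow> continuous_on S (\<lambda>x. Ad g (f x))"
  unfolding Ad_def by (intro continuous_intros)

lemma Ad_mem:
  assumes K: "additive_subgroup K" and normal: "\<And>h. h \<in> K \<Longrightarrow> g + h - g \<in> K"
    and A: "A \<in> subgroup_algebra K"
  shows "Ad g A \<in> subgroup_algebra K"
proof -
  note s = subgroup_algebra_cstar [of K]
  note s' = csubspaceD [OF cstar_subalgebraD(1) [OF s]]
  let ?V = "Ad g -` subgroup_algebra K"
  have "A \<in> ?V"
  proof (rule subgroup_algebra_induct [OF K _ _ _ A])
    show "csubspace ?V"
      unfolding csubspace_def by (auto simp: Ad_add Ad_scalar intro: s')
    show "closed ?V"
      by (intro closed_vimage continuous_Ad continuous_intros cstar_subalgebraD [OF s])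
    show "L h \<in> ?V" if "h \<in> K" for h
      using Ad_L [of g h] s'(3) L_mem [OF normal [OF that]] by auto
  qed
  then show ?thesis by simp
qed

lemma canonical_trace_Ad:
  assumes "A \<in> reduced_cstar \<sigma>"
  shows "canonical_trace (Ad g A) = canonical_trace A"
proof -
  note r = cstar_subalgebraD [OF subgroup_algebra_cstar [of UNIV, folded reduced_eq]]
  have "L g \<in> reduced_cstar \<sigma>" by (simp add: reduced_eq L_mem)
  then have "canonical_trace ((L g o\<^sub>L A) o\<^sub>L adj (L g)) = canonical_trace (adj (L g) o\<^sub>L (L g o\<^sub>L A))"
    using assms by (intro canonical_trace_commute r)
  then show ?thesis by (simp add: Ad_def)
qed

text \<open>
  Each step takes the mean of an operator and a single conjugate of it; a list stands for the composition
  of its steps.  Composition of averages is then concatenation of lists.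
\<close>
primrec avg :: "'g list \<Rightarrow> 'g operator \<Rightarrow> 'g operator"
  where "avg [] A = A"
  | "avg (y # ys) A = (1/2) *\<^sub>R (avg ys A + Ad y (avg ys A))"

lemma avg_append: "avg (xs @ ys) A = avg xs (avg ys A)"
  by (induction xs) simp_all

lemma avg_add: "avg ys (A + B) = avg ys A + avg ys B"
  by (induction ys) (simp_all add: Ad_add algebra_simps)

lemma avg_scalar: "avg ys (scalar_op c o\<^sub>L A) = scalar_op c o\<^sub>L avg ys A"
proof (induction ys)
  case (Cons y ys)
  then show ?case
    by (simp add: Ad_scalar flip: blinfun_compose.add_right blinfun_compose.scaleR_right)
qed simp

lemma avg_uminus: "avg ys (- A) = - avg ys A"
  by (simp add: minus_eq_scalar_op avg_scalar)

lemma avg_diff: "avg ys (A - B) = avg ys A - avg ys B"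
  using avg_add [of ys A "- B"] by (simp add: avg_uminus)

lemma avg_id [simp]: "avg ys id_blinfun = id_blinfun"
  by (induction ys) (simp_all flip: scaleR_2)

lemma avg_scalar_op [simp]: "avg ys (scalar_op c) = scalar_op c"
  using avg_scalar [of ys c id_blinfun] by simp

lemma adjointable_avg [simp]: "adjointable A \<Longrightarrow> adjointable (avg ys A)"
  by (induction ys) auto

lemma norm_avg: "norm (avg ys A) \<le> norm A"
proof (induction ys)
  case (Cons y ys)
  have "norm (avg ys A + Ad y (avg ys A)) \<le> norm A + norm A"
    using norm_triangle_ineq [of "avg ys A" "Ad y (avg ys A)"] norm_Ad [of y "avg ys A"] Cons by linarith
  then show ?case by simp
qed simp

lemma avg_mem:
  assumes "csubspace V" "A \<in> V" "\<And>B y. y \<in> set ys \<Longrightarrow> B \<in> V \<Longrightarrow> Ad y B \<in> V"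
  shows "avg ys A \<in> V"
  using assms(3) by (induction ys) (auto intro!: csubspaceD [OF assms(1)] assms(2))

lemma Ad_avg_commute:
  assumes "adjointable A" "\<And>y. y \<in> set ys \<Longrightarrow> x + y = y + x"
  shows "Ad x (avg ys A) = avg ys (Ad x A)"
  using assms(2)
  by (induction ys) (simp_all add: Ad_scaleR Ad_add Ad_Ad assms(1), metis Ad_Ad adjointable_avg assms(1))

text \<open>
  Conjugations by commuting group elements commute, whatever the cocycle does.
\<close>
lemma avg_commute:
  assumes "adjointable A" "\<And>x y. x \<in> set xs \<Longrightarrow> y \<in> set ys \<Longrightarrow> x + y = y + x"
  shows "avg xs (avg ys A) = avg ys (avg xs A)"
  using assms(2)
proof (induction xs)
  case (Cons x xs)
  have "avg ys (avg (x # xs) A) = (1/2) *\<^sub>R (avg ys (avg xs A) + avg ys (Ad x (avg xs A)))"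
    by (simp add: scaleR_eq_scalar_op avg_scalar avg_add)
  also have "avg ys (Ad x (avg xs A)) = Ad x (avg ys (avg xs A))"
    using Cons.prems assms(1) by (intro Ad_avg_commute [symmetric]) auto
  moreover have "avg xs (avg ys A) = avg ys (avg xs A)"
    using Cons by auto
  ultimately show ?case by simp
qed simp

text \<open>
  One step is the convexity of the squared norm; the induction passes to the vector \<open>adj (L y) \<xi>\<close>, which
  turns the bound for an average into the bound for its conjugate.
\<close>
lemma avg_kadison_schwarz:
  assumes A: "adjointable A"
  shows "(norm (avg ys A \<xi>))\<^sup>2 \<le> inner \<xi> (avg ys (adj A o\<^sub>L A) \<xi>)"
proof (induction ys arbitrary: \<xi>)
  case Nil
  then show ?case
    by (simp add: inner_ell2_def norm_apply_sq [OF A, simplified] del: of_real_power)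
next
  case (Cons y ys)
  define B C where "B = avg ys A" and "C = avg ys (adj A o\<^sub>L A)"
  define \<eta> where "\<eta> = adj (L y) \<xi>"
  have C: "adjointable C" using A by (simp add: C_def adjointable_adj)
  have "(norm (Ad y B \<xi>))\<^sup>2 = (norm (B \<eta>))\<^sup>2"
    by (simp add: Ad_def \<eta>_def)
  also have "\<dots> \<le> inner \<eta> (C \<eta>)"
    unfolding B_def C_def by (rule Cons)
  also have "\<dots> = inner \<xi> (Ad y C \<xi>)"
    using cinner_L_L [of y \<eta> "C \<eta>"] by (simp add: inner_ell2_def \<eta>_def Ad_def)
  finally have 1: "(norm (Ad y B \<xi>))\<^sup>2 \<le> inner \<xi> (Ad y C \<xi>)" .
  have 2: "(norm (B \<xi>))\<^sup>2 \<le> inner \<xi> (C \<xi>)"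
    unfolding B_def C_def by (rule Cons)
  have "(norm (B \<xi> + Ad y B \<xi>))\<^sup>2 \<le> (norm (B \<xi>) + norm (Ad y B \<xi>))\<^sup>2"
    by (intro power_mono norm_triangle_ineq) simp
  also have "\<dots> \<le> 2 * (norm (B \<xi>))\<^sup>2 + 2 * (norm (Ad y B \<xi>))\<^sup>2"
    using zero_le_power2 [of "norm (B \<xi>) - norm (Ad y B \<xi>)"] by (simp add: power2_sum power2_diff)
  finally have "(norm (B \<xi> + Ad y B \<xi>))\<^sup>2 \<le> 2 * inner \<xi> (C \<xi>) + 2 * inner \<xi> (Ad y C \<xi>)"
    using 1 2 by linarith
  moreover have "(norm ((1/2) *\<^sub>R (B \<xi> + Ad y B \<xi>)))\<^sup>2 = (norm (B \<xi> + Ad y B \<xi>))\<^sup>2 / 4"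
    by (simp add: power_divide)
  ultimately show ?case
    by (simp add: B_def [symmetric] C_def [symmetric] blinfun.add_left blinfun.scaleR_left inner_add_right)
qed

lemma norm_avg_sq_le:
  assumes A: "adjointable A"
  shows "(norm (avg ys A))\<^sup>2 \<le> norm (avg ys (adj A o\<^sub>L A))"
proof -
  let ?n = "norm (avg ys (adj A o\<^sub>L A))"
  have "norm (avg ys A) \<le> sqrt ?n"
  proof (rule norm_blinfun_bound)
    fix \<xi>
    have "(norm (avg ys A \<xi>))\<^sup>2 \<le> norm \<xi> * norm (avg ys (adj A o\<^sub>L A) \<xi>)"
      using avg_kadison_schwarz [OF A] norm_cauchy_schwarz order_trans by blast
    also have "\<dots> \<le> norm \<xi> * (?n * norm \<xi>)"
      by (intro mult_left_mono norm_blinfun norm_ge_zero)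
    also have "\<dots> = (sqrt ?n * norm \<xi>)\<^sup>2"
      by (simp add: power_mult_distrib) (simp add: power2_eq_square)
    finally show "norm (avg ys A \<xi>) \<le> sqrt ?n * norm \<xi>"
      by (rule power2_le_imp_le) simp
  qed simp
  then have "(norm (avg ys A))\<^sup>2 \<le> (sqrt ?n)\<^sup>2"
    by (intro power_mono) auto
  then show ?thesis by simp
qed

subsection \<open>The Dixmier property\<close>

text \<open>
  The averages of \<open>A\<close> over conjugates by \<open>K\<close> come close to a scalar; it has to be the canonical trace of \<open>A\<close>,
  which averaging preserves on the twisted group algebra.
\<close>
definition dixmier :: "'g set \<Rightarrow> 'g operator \<Rightarrow> bool"
  where "dixmier K A \<longleftrightarrow> adjointable A \<and>
    (\<forall>e>0. \<exists>ys. set ys \<subseteq> K \<and> norm (avg ys A - scalar_op (canonical_trace A)) \<le> e)"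

lemma norm_scalar_op: "norm (scalar_op c :: 'h operator) \<le> cmod c"
  by (rule norm_blinfun_bound) (auto simp: norm_scaleC)

lemma norm_scalar_op_compose: "norm (scalar_op c o\<^sub>L (A :: 'h operator)) \<le> cmod c * norm A"
  by (rule order_trans [OF norm_blinfun_compose]) (intro mult_right_mono norm_scalar_op norm_ge_zero)

lemma scalar_op_diff: "scalar_op (c - d) = scalar_op c - scalar_op d"
  and scalar_op_add: "scalar_op (c + d) = scalar_op c + scalar_op d"
  and scalar_op_mult: "scalar_op (c * d) = scalar_op c o\<^sub>L scalar_op d"
  by (rule blinfun_eqI, rule ell2_eqI,
      simp add: blinfun.diff_left blinfun.add_left scaleC.rep_eq minus_ell2.rep_eq plus_ell2.rep_eq algebra_simps)+

lemma dixmierD: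
  "dixmier K A \<Longrightarrow> 0 < e \<Longrightarrow> \<exists>ys. set ys \<subseteq> K \<and> norm (avg ys A - scalar_op (canonical_trace A)) \<le> e"
  by (simp add: dixmier_def)

text \<open>
  An average that is good for \<open>A\<close> remains good after further averaging.  Because averages over a
  commutative \<open>K\<close> commute, the composition of one for \<open>A\<close> and one for \<open>B\<close> is therefore good for both.
\<close>
lemma csubspace_dixmier:
  assumes comm: "\<And>x y. x \<in> K \<Longrightarrow> y \<in> K \<Longrightarrow> x + y = y + x"
  shows "csubspace {A. dixmier K A}"
  unfolding csubspace_def
proof (intro conjI ballI allI)
  show "0 \<in> {A. dixmier K A}"
    by (auto simp: dixmier_def vector_state_simps intro!: exI [of _ "[]"])
next
  fix A B assume AB: "A \<in> {A. dixmier K A}" "B \<in> {A. dixmier K A}"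
  have "\<exists>ys. set ys \<subseteq> K \<and> norm (avg ys (A + B) - scalar_op (canonical_trace (A + B))) \<le> e"
    if "0 < e" for e
  proof -
    obtain xs ys where xs: "set xs \<subseteq> K" "norm (avg xs A - scalar_op (canonical_trace A)) \<le> e / 2"
      and ys: "set ys \<subseteq> K" "norm (avg ys B - scalar_op (canonical_trace B)) \<le> e / 2"
      using AB dixmierD [of K A "e/2"] dixmierD [of K B "e/2"] \<open>0 < e\<close> by auto
    have "avg (xs @ ys) A = avg ys (avg xs A)"
      unfolding avg_append using AB comm xs ys by (intro avg_commute) (auto simp: dixmier_def)
    then have "avg (xs @ ys) A - scalar_op (canonical_trace A) = avg ys (avg xs A - scalar_op (canonical_trace A))"
      by (simp add: avg_diff)
    then have 1: "norm (avg (xs @ ys) A - scalar_op (canonical_trace A)) \<le> e / 2"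
      using norm_avg order_trans xs(2) by metis
    have "avg (xs @ ys) B - scalar_op (canonical_trace B) = avg xs (avg ys B - scalar_op (canonical_trace B))"
      by (simp add: avg_diff avg_append)
    then have 2: "norm (avg (xs @ ys) B - scalar_op (canonical_trace B)) \<le> e / 2"
      using norm_avg order_trans ys(2) by metis
    have "avg (xs @ ys) (A + B) - scalar_op (canonical_trace (A + B)) =
        (avg (xs @ ys) A - scalar_op (canonical_trace A)) + (avg (xs @ ys) B - scalar_op (canonical_trace B))"
      by (simp add: avg_add vector_state_simps scalar_op_add)
    then have "norm (avg (xs @ ys) (A + B) - scalar_op (canonical_trace (A + B))) \<le> e"
      using norm_triangle_ineq 1 2 by (smt (verit) field_sum_of_halves)
    then show ?thesis using xs ys by (intro exI [of _ "xs @ ys"]) auto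
  qed
  then show "A + B \<in> {A. dixmier K A}"
    using AB by (auto simp: dixmier_def)
next
  fix c A assume A: "A \<in> {A. dixmier K A}"
  have "\<exists>ys. set ys \<subseteq> K \<and> norm (avg ys (scalar_op c o\<^sub>L A) - scalar_op (canonical_trace (scalar_op c o\<^sub>L A))) \<le> e"
    if "0 < e" for e
  proof -
    \<comment> \<open>The summand 1 provides for \<open>c = 0\<close>.\<close>
    have pos: "0 < cmod c + 1" by (simp add: add_nonneg_pos)
    then obtain ys where ys: "set ys \<subseteq> K" "norm (avg ys A - scalar_op (canonical_trace A)) \<le> e / (cmod c + 1)"
      using A dixmierD [of K A "e / (cmod c + 1)"] \<open>0 < e\<close> by auto
    have "avg ys (scalar_op c o\<^sub>L A) - scalar_op (canonical_trace (scalar_op c o\<^sub>L A)) =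
        scalar_op c o\<^sub>L (avg ys A - scalar_op (canonical_trace A))"
      by (simp add: avg_scalar vector_state_simps scalar_op_mult blinfun_compose.diff_right)
    then have "norm (avg ys (scalar_op c o\<^sub>L A) - scalar_op (canonical_trace (scalar_op c o\<^sub>L A)))
        \<le> cmod c * norm (avg ys A - scalar_op (canonical_trace A))"
      by (simp add: norm_scalar_op_compose)
    also have "\<dots> \<le> (cmod c + 1) * (e / (cmod c + 1))"
      using ys(2) by (intro mult_mono) auto
    also have "\<dots> = e" using pos by simp
    finally show ?thesis using ys by auto
  qed
  then show "scalar_op c o\<^sub>L A \<in> {A. dixmier K A}"
    using A by (auto simp: dixmier_def)
qed

lemma closed_dixmier: "closed {A. dixmier K A}"
  unfolding closed_sequential_limits
proof (intro allI impI, elim conjE)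
  fix X A assume X: "\<forall>n. X n \<in> {A. dixmier K A}" and lim: "X \<longlonglongrightarrow> A"
  have "adjointable A"
    using closed_adjointable [unfolded closed_sequential_limits, rule_format, of X A] X lim
    by (simp add: dixmier_def)
  moreover have "\<exists>ys. set ys \<subseteq> K \<and> norm (avg ys A - scalar_op (canonical_trace A)) \<le> e" if "0 < e" for e
  proof -
    obtain n where n: "norm (X n - A) < e / 3"
      using LIMSEQ_D [OF lim, of "e / 3"] \<open>0 < e\<close> by auto
    obtain ys where ys: "set ys \<subseteq> K" "norm (avg ys (X n) - scalar_op (canonical_trace (X n))) \<le> e / 3"
      using X dixmierD [of K "X n" "e / 3"] \<open>0 < e\<close> by auto
    let ?c = "canonical_trace (X n - A)"
    have "avg ys A - scalar_op (canonical_trace A) =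
        (avg ys (X n) - scalar_op (canonical_trace (X n))) - avg ys (X n - A) + scalar_op ?c"
      by (simp add: avg_diff vector_state_diff scalar_op_diff)
    moreover have "norm (avg ys (X n - A)) \<le> e / 3"
      using norm_avg [of ys "X n - A"] n by linarith
    moreover have "norm (scalar_op ?c :: 'g operator) \<le> e / 3"
      using vector_state_bound [of "delta 0" "X n - A"] n
      by (intro order_trans [OF norm_scalar_op]) simp
    ultimately have "norm (avg ys A - scalar_op (canonical_trace A)) \<le> e"
      using ys(2) norm_triangle_ineq [of "(avg ys (X n) - scalar_op (canonical_trace (X n))) - avg ys (X n - A)" "scalar_op ?c"]
        norm_triangle_ineq4 [of "avg ys (X n) - scalar_op (canonical_trace (X n))" "avg ys (X n - A)"]
      by simp
    then show ?thesis using ys by blast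
  qed
  ultimately show "A \<in> {A. dixmier K A}"
    by (auto simp: dixmier_def)
qed

lemma cmod_half_less_one:
  assumes "cmod c = 1" "c \<noteq> 1"
  shows "cmod ((1 + c) / 2) < 1"
proof -
  have c: "(Re c)\<^sup>2 + (Im c)\<^sup>2 = 1"
    using assms(1) by (metis cmod_power2 one_power2)
  have "Re c < 1"
  proof (rule ccontr)
    assume "\<not> Re c < 1"
    moreover have "Re c \<le> 1" using complex_Re_le_cmod [of c] assms(1) by simp
    ultimately have "Re c = 1" by simp
    with c have "c = 1" by (simp add: complex_eq_iff)
    with assms show False by simp
  qed
  then have "(cmod (1 + c))\<^sup>2 < 2\<^sup>2"
    using c unfolding cmod_power2 by (simp add: power2_eq_square algebra_simps)
  then have "cmod (1 + c) < 2"
    by (rule power2_less_imp_less) simp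
  then show ?thesis by (simp add: norm_divide)
qed

text \<open>
  Conjugation by \<open>y\<close> multiplies \<open>L g\<close> by a unimodular \<open>c \<noteq> 1\<close>, so each averaging step with \<open>y\<close>
  multiplies it by \<open>(1 + c) / 2\<close>, which has modulus less than 1.
\<close>
lemma dixmier_noncentral:
  assumes "y \<in> K" "y + g = g + y" "\<sigma> y g \<noteq> \<sigma> g y"
  shows "dixmier K (L g)"
proof -
  define c where "c = \<sigma> y g * cnj (\<sigma> g y)"
  define q where "q = (1 + c) / 2"
  have "c \<noteq> 1"
  proof
    assume "c = 1"
    moreover have "\<sigma> y g = c * \<sigma> g y"
      by (simp only: c_def mult.assoc cocycle_cnj mult_1_right)
    ultimately show False using assms by simp
  qed
  then have q: "cmod q < 1"
    unfolding q_def by (intro cmod_half_less_one) (simp_all add: c_def norm_mult)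
  have Ad: "Ad y (L g) = scalar_op c o\<^sub>L L g"
    unfolding c_def by (rule Ad_L_commuting) fact
  have avg: "avg (replicate n y) (L g) = scalar_op (q ^ n) o\<^sub>L L g" for n
  proof (induction n)
    case (Suc n)
    have "avg (replicate (Suc n) y) (L g) = (1/2) *\<^sub>R (scalar_op (q ^ n) o\<^sub>L (L g + Ad y (L g)))"
      by (simp add: Suc Ad_scalar blinfun_compose.add_right)
    also have "L g + Ad y (L g) = scalar_op (1 + c) o\<^sub>L L g"
      by (simp add: Ad scalar_op_add blinfun_compose.add_left)
    finally show ?case
      by (simp add: scaleR_eq_scalar_op scalar_op_scalar_op q_def mult_ac)
  qed simp
  have "g \<noteq> 0" using assms by auto
  have "\<exists>ys. set ys \<subseteq> K \<and> norm (avg ys (L g) - scalar_op (canonical_trace (L g))) \<le> e" if "0 < e" for e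
  proof -
    obtain n where n: "cmod q ^ n < e"
      using real_arch_pow_inv [OF \<open>0 < e\<close> q] by auto
    have "norm (L g) \<le> 1" by (rule norm_blinfun_bound) auto
    then have "norm (scalar_op (q ^ n) o\<^sub>L L g) \<le> cmod (q ^ n) * 1"
      using norm_scalar_op_compose [of "q ^ n" "L g"] mult_left_mono [of "norm (L g)" 1 "cmod (q ^ n)"] by simp
    then have "norm (avg (replicate n y) (L g)) \<le> e"
      using n by (simp add: avg norm_power)
    then show ?thesis
      using assms(1) \<open>g \<noteq> 0\<close> by (intro exI [of _ "replicate n y"]) (auto simp: canonical_trace_L)
  qed
  then show ?thesis by (simp add: dixmier_def)
qed

lemma dixmier_zero: "dixmier K (L 0)"
  unfolding dixmier_def
  by (auto simp: canonical_trace_L L_zero intro!: exI [of _ "[]"])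
     (simp add: vector_state_def cinner_delta Rep_delta)

subsection \<open>Averages of small 2-norm\<close>

text \<open>
  Linear combinations of the \<open>L p\<close> with \<open>p\<close> in \<open>P\<close> are of this kind.  Testing all point
  masses, not only the one at the identity, makes the condition stable under conjugation.
\<close>
definition band :: "'g set \<Rightarrow> 'g operator \<Rightarrow> bool"
  where "band P A \<longleftrightarrow> (\<forall>h k. Rep_ell2 (A (delta h)) k \<noteq> 0 \<longrightarrow> k - h \<in> P)"

lemma band_L: "band {g} (L g)"
  by (auto simp: band_def L_delta scaleC.rep_eq Rep_delta)

lemma band_Ad:
  assumes "band P A" "adjointable A"
  shows "band ((\<lambda>p. g + p - g) ` P) (Ad g A)"
  unfolding band_def
proof (intro allI impI)
  fix h k assume *: "Rep_ell2 (Ad g A (delta h)) k \<noteq> 0"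
  let ?c = "cnj (\<sigma> g (- g)) * \<sigma> (- g) h"
  have "Ad g A (delta h) = ?c *\<^sub>C L g (A (delta (- g + h)))"
    using assms(2) by (simp add: Ad_def adj_L L_delta adjointable_linear complex_linearD [OF L_linear])
  with * have "Rep_ell2 (A (delta (- g + h))) (- g + k) \<noteq> 0"
    by (auto simp: scaleC.rep_eq Rep_L)
  then have "(- g + k) - (- g + h) \<in> P"
    using assms(1) by (auto simp: band_def)
  moreover have "k - h = g + ((- g + k) - (- g + h)) - g"
    by (simp add: diff_conv_add_uminus minus_add add.assoc del: add_uminus_conv_diff)
  ultimately show "k - h \<in> (\<lambda>p. g + p - g) ` P" by blast
qed

lemma band_mid:
  assumes "band P A" "adjointable A"
  shows "band (P \<union> (\<lambda>p. g + p - g) ` P) ((1/2) *\<^sub>R (A + Ad g A))"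
  unfolding band_def
proof (intro allI impI)
  fix h k assume "Rep_ell2 (((1/2) *\<^sub>R (A + Ad g A)) (delta h)) k \<noteq> 0"
  then have "Rep_ell2 (A (delta h)) k \<noteq> 0 \<or> Rep_ell2 (Ad g A (delta h)) k \<noteq> 0"
    by (auto simp: blinfun.scaleR_left blinfun.add_left scaleR_eq_scaleC scaleC.rep_eq plus_ell2.rep_eq)
  then have "k - h \<in> P \<or> k - h \<in> (\<lambda>p. g + p - g) ` P"
    using assms(1) band_Ad [OF assms, of g] unfolding band_def by meson
  then show "k - h \<in> P \<union> (\<lambda>p. g + p - g) ` P" by simp
qed

lemma norm_add_orthogonal:
  assumes "cinner \<xi> \<eta> = 0"
  shows "(norm (\<xi> + \<eta>))\<^sup>2 = (norm \<xi>)\<^sup>2 + (norm \<eta>)\<^sup>2"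
proof -
  have "inner \<xi> \<eta> = 0" by (simp add: inner_ell2_def assms)
  then show ?thesis
    by (simp add: power2_norm_eq_inner inner_add_left inner_add_right inner_commute)
qed

lemma norm_Ad_delta:
  assumes "A \<in> reduced_cstar \<sigma>"
  shows "norm (Ad g A (delta 0)) = norm (A (delta 0))"
proof -
  note r = cstar_subalgebraD [OF subgroup_algebra_cstar [of UNIV, folded reduced_eq]]
  have adj: "adjointable A"
    using assms subgroup_algebra_adjointable by (simp add: reduced_eq)
  have "complex_of_real ((norm (Ad g A (delta 0)))\<^sup>2) = canonical_trace (Ad g (adj A o\<^sub>L A))"
    by (simp only: vector_state_adj [OF adjointable_Ad [OF adj], symmetric] adj_Ad [OF adj] Ad_compose)
  also have "\<dots> = complex_of_real ((norm (A (delta 0)))\<^sup>2)"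
    using assms by (simp only: canonical_trace_Ad r vector_state_adj [OF adj])
  finally show ?thesis by (simp only: of_real_eq_iff) simp
qed

text \<open>
  The operator and its conjugate have disjoint supports and hence orthogonal images of the point mass,
  of equal norm.
\<close>
lemma norm_mid_delta:
  assumes A: "A \<in> reduced_cstar \<sigma>" and band: "band P A" and disj: "P \<inter> (\<lambda>p. g + p - g) ` P = {}"
  shows "(norm (((1/2) *\<^sub>R (A + Ad g A)) (delta 0)))\<^sup>2 = (norm (A (delta 0)))\<^sup>2 / 2"
proof -
  have adj: "adjointable A"
    using A subgroup_algebra_adjointable by (simp add: reduced_eq)
  have "cnj (Rep_ell2 (A (delta 0)) k) * Rep_ell2 (Ad g A (delta 0)) k = 0" for k
  proof (rule ccontr)
    assume "\<not> ?thesis"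
    then have "Rep_ell2 (A (delta 0)) k \<noteq> 0" "Rep_ell2 (Ad g A (delta 0)) k \<noteq> 0"
      by auto
    then have "k - 0 \<in> P" "k - 0 \<in> (\<lambda>p. g + p - g) ` P"
      using band band_Ad [OF band adj, of g] unfolding band_def by blast+
    with disj show False by blast
  qed
  then have "cinner (A (delta 0)) (Ad g A (delta 0)) = 0"
    unfolding cinner.rep_eq by (simp add: infsum_0)
  then have "(norm (A (delta 0) + Ad g A (delta 0)))\<^sup>2 = 2 * (norm (A (delta 0)))\<^sup>2"
    by (simp add: norm_add_orthogonal norm_Ad_delta A)
  then show ?thesis
    by (simp add: blinfun.scaleR_left blinfun.add_left power_divide)
qed

text \<open>
  Repeatedly averaging \<open>L g\<close> with an element that moves the support off itself halves the squared
  2-norm each time.  All conjugates of \<open>L g\<close> by \<open>K\<close> lie in \<open>L g\<close> times the algebra of \<open>K\<close>; this is kept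
  track of so that \<open>b\<^sup>* b\<close> is in the algebra of \<open>K\<close> for every average \<open>b\<close>.
\<close>
lemma spread_average:
  assumes K: "additive_subgroup K" and normal: "\<And>g x. x \<in> K \<Longrightarrow> g + x - g \<in> K"
    and escape: "\<And>P. finite P \<Longrightarrow> P \<subseteq> (\<lambda>x. x + g) ` K \<Longrightarrow> \<exists>z\<in>K. P \<inter> (\<lambda>p. z + p - z) ` P = {}"
  shows "\<exists>ys P. set ys \<subseteq> K \<and> finite P \<and> P \<subseteq> (\<lambda>x. x + g) ` K \<and> band P (avg ys (L g)) \<and>
    adj (L g) o\<^sub>L avg ys (L g) \<in> subgroup_algebra K \<and>
    (norm (avg ys (L g) (delta 0)))\<^sup>2 = (1/2) ^ n"
proof (induction n)
  case 0
  have "g \<in> (\<lambda>x. x + g) ` K"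
    using K by (force simp: additive_subgroup_def)
  then show ?case
    using band_L [of g] id_mem [OF K]
    by (intro exI [of _ "[]"] exI [of _ "{g}"]) (auto simp: norm_L_apply)
next
  case (Suc n)
  then obtain ys P where ys: "set ys \<subseteq> K" "finite P" "P \<subseteq> (\<lambda>x. x + g) ` K" "band P (avg ys (L g))"
    "adj (L g) o\<^sub>L avg ys (L g) \<in> subgroup_algebra K" "(norm (avg ys (L g) (delta 0)))\<^sup>2 = (1/2) ^ n"
    by blast
  obtain z where z: "z \<in> K" "P \<inter> (\<lambda>p. z + p - z) ` P = {}"
    using escape [OF ys(2,3)] by blast
  define b where "b = avg ys (L g)"
  note s = subgroup_algebra_cstar [of K]
  note s' = cstar_subalgebraD [OF s] csubspaceD [OF cstar_subalgebraD(1) [OF s]]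
  have "b \<in> reduced_cstar \<sigma>"
    unfolding b_def reduced_eq
    by (intro avg_mem csubspaceD L_mem Ad_mem additive_subgroup_UNIV
        cstar_subalgebraD(1) [OF subgroup_algebra_cstar]) auto
  then have "(norm (avg (z # ys) (L g) (delta 0)))\<^sup>2 = (1/2) ^ Suc n"
    using norm_mid_delta [of b P z] ys z by (simp add: b_def)
  moreover have "P \<union> (\<lambda>p. z + p - z) ` P \<subseteq> (\<lambda>x. x + g) ` K"
  proof -
    have "z + (x + g) - z \<in> (\<lambda>x. x + g) ` K" if "x \<in> K" for x
    proof
      show "z + (x + g) - z = (z + x + (g + - z - g)) + g"
        by (simp only: diff_conv_add_uminus add.assoc minus_add_cancel left_minus add_0_right)
      have "z + x \<in> K" "g + - z - g \<in> K"
        using normal [of "- z" g] z(1) K that unfolding additive_subgroup_def by blast+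
      then show "z + x + (g + - z - g) \<in> K"
        using K unfolding additive_subgroup_def by blast
    qed
    then show ?thesis using ys by blast
  qed
  moreover have "band (P \<union> (\<lambda>p. z + p - z) ` P) (avg (z # ys) (L g))"
    using band_mid [OF ys(4)] by simp
  moreover have "adj (L g) o\<^sub>L avg (z # ys) (L g) \<in> subgroup_algebra K"
  proof -
    define W where "W = Ad (- g) (L z)"
    have W: "W \<in> subgroup_algebra K"
      unfolding W_def by (intro Ad_mem K normal L_mem z)
    have "L z = Ad g W"
      by (simp add: W_def Ad_Ad)
    then have "adj (L g) o\<^sub>L L z = W o\<^sub>L adj (L g)"
      by (simp add: Ad_def blinfun_compose_assoc)
    then have "adj (L g) o\<^sub>L Ad z b = W o\<^sub>L (adj (L g) o\<^sub>L b) o\<^sub>L adj (L z)"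
      by (simp add: Ad_def flip: blinfun_compose_assoc)
    also have "\<dots> \<in> subgroup_algebra K"
      using W ys(5) L_mem [OF z(1)] by (auto simp: b_def intro: s')
    finally show ?thesis
      using ys(5) by (auto simp: b_def [symmetric] blinfun_compose.scaleR_right
          blinfun_compose.add_right intro!: s')
  qed
  ultimately show ?case
    using ys z by (intro exI [of _ "z # ys"] exI [of _ "P \<union> (\<lambda>p. z + p - z) ` P"]) auto
qed

end

context cocycle
begin

lemma dixmier_subgroup_algebra:
  assumes K: "additive_subgroup K" and comm: "\<And>x y. x \<in> K \<Longrightarrow> y \<in> K \<Longrightarrow> x + y = y + x"
    and nondeg: "\<And>g. g \<in> K \<Longrightarrow> g \<noteq> 0 \<Longrightarrow> \<exists>y\<in>K. \<sigma> y g \<noteq> \<sigma> g y"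
    and A: "A \<in> subgroup_algebra K"
  shows "dixmier K A"
proof -
  have "dixmier K (L g)" if "g \<in> K" for g
  proof (cases "g = 0")
    case True
    then show ?thesis by (simp add: dixmier_zero)
  next
    case False
    then show ?thesis
      using nondeg [OF that] comm that dixmier_noncentral by metis
  qed
  then have "A \<in> {A. dixmier K A}"
    using subgroup_algebra_induct [OF K csubspace_dixmier [OF comm] closed_dixmier _ A] by simp
  then show ?thesis by simp
qed

text \<open>
  An average \<open>b\<close> of \<open>L g\<close> with small \<open>\<tau>(b\<^sup>* b)\<close> has \<open>b\<^sup>* b\<close> in the algebra of \<open>K\<close>, so further averages of \<open>b\<^sup>* b\<close>
  have small norm; by Kadison-Schwarz so have the same averages of \<open>b\<close>.
\<close>
lemma dixmier_outside:
  assumes K: "additive_subgroup K" and normal: "\<And>g x. x \<in> K \<Longrightarrow> g + x - g \<in> K"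
    and escape: "\<And>P. finite P \<Longrightarrow> P \<subseteq> (\<lambda>x. x + g) ` K \<Longrightarrow> \<exists>z\<in>K. P \<inter> (\<lambda>p. z + p - z) ` P = {}"
    and dix: "\<And>A. A \<in> subgroup_algebra K \<Longrightarrow> dixmier K A" and g: "g \<notin> K"
  shows "dixmier K (L g)"
proof -
  have "g \<noteq> 0" using g K by (auto simp: additive_subgroup_def)
  note s = cstar_subalgebraD [OF subgroup_algebra_cstar [of K]]
  have "\<exists>ys. set ys \<subseteq> K \<and> norm (avg ys (L g)) \<le> e" if "0 < e" for e
  proof -
    have e2: "0 < e\<^sup>2 / 2" using \<open>0 < e\<close> by simp
    then obtain n where n: "(1/2 :: real) ^ n < e\<^sup>2 / 2"
      using real_arch_pow_inv [of "e\<^sup>2 / 2" "1/2"] by auto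
    obtain ys where ys: "set ys \<subseteq> K" "adj (L g) o\<^sub>L avg ys (L g) \<in> subgroup_algebra K"
        "(norm (avg ys (L g) (delta 0)))\<^sup>2 = (1/2) ^ n"
      using spread_average [OF K normal escape, where n = n] by blast
    define b where "b = avg ys (L g)"
    define c where "c = adj (L g) o\<^sub>L b"
    have b: "adjointable b" by (simp add: b_def)
    \<comment> \<open>\<open>c\<close> lies in the algebra of \<open>K\<close>, unlike \<open>b\<close> itself.\<close>
    have cc: "adj c o\<^sub>L c = adj b o\<^sub>L b"
      using b by (simp add: c_def adj_compose adj_adj blinfun_compose_assoc)
    then have "adj b o\<^sub>L b \<in> subgroup_algebra K"
      using ys(2) by (metis b_def c_def s(2,3))
    then obtain zs where zs: "set zs \<subseteq> K"
        "norm (avg zs (adj b o\<^sub>L b) - scalar_op (canonical_trace (adj b o\<^sub>L b))) \<le> e\<^sup>2 / 2"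
      using dixmierD [OF dix e2] by blast
    have "norm (scalar_op (canonical_trace (adj b o\<^sub>L b)) :: 'g operator) \<le> (1/2) ^ n"
      using ys(3) by (intro order_trans [OF norm_scalar_op])
        (simp add: vector_state_adj b b_def [symmetric] del: of_real_power)
    then have "norm (avg zs (adj b o\<^sub>L b)) \<le> e\<^sup>2"
      using zs(2) n norm_triangle_sub [of "avg zs (adj b o\<^sub>L b)"
          "scalar_op (canonical_trace (adj b o\<^sub>L b))"] by linarith
    then have "(norm (avg zs b))\<^sup>2 \<le> e\<^sup>2"
      using norm_avg_sq_le [OF b, of zs] by linarith
    then have "norm (avg zs b) \<le> e"
      by (rule power2_le_imp_le) (use \<open>0 < e\<close> in simp)
    then show ?thesis
      using ys zs by (intro exI [of _ "zs @ ys"]) (simp add: avg_append b_def)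
  qed
  then show ?thesis
    using \<open>g \<noteq> 0\<close> by (simp add: dixmier_def canonical_trace_L)
qed

lemma dixmier_reduced:
  assumes K: "additive_subgroup K" and comm: "\<And>x y. x \<in> K \<Longrightarrow> y \<in> K \<Longrightarrow> x + y = y + x"
    and normal: "\<And>g x. x \<in> K \<Longrightarrow> g + x - g \<in> K"
    and nondeg: "\<And>g. g \<in> K \<Longrightarrow> g \<noteq> 0 \<Longrightarrow> \<exists>y\<in>K. \<sigma> y g \<noteq> \<sigma> g y"
    and escape: "\<And>g P. g \<notin> K \<Longrightarrow> finite P \<Longrightarrow> P \<subseteq> (\<lambda>x. x + g) ` K \<Longrightarrow>
      \<exists>z\<in>K. P \<inter> (\<lambda>p. z + p - z) ` P = {}"
    and A: "A \<in> reduced_cstar \<sigma>"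
  shows "dixmier K A"
proof -
  have dix: "dixmier K B" if "B \<in> subgroup_algebra K" for B
    using K comm nondeg that by (rule dixmier_subgroup_algebra)
  have "dixmier K (L g)" for g
  proof (cases "g \<in> K")
    case True
    then show ?thesis by (intro dix L_mem)
  next
    case False
    then show ?thesis by (intro dixmier_outside K normal escape dix)
  qed
  then have "A \<in> {A. dixmier K A}"
    using subgroup_algebra_induct [OF additive_subgroup_UNIV csubspace_dixmier [OF comm] closed_dixmier]
      A by (simp add: reduced_eq)
  then show ?thesis by simp
qed

subsection \<open>Simplicity and uniqueness of the trace\<close>

text \<open>
  A closed ideal contains, with \<open>A \<noteq> 0\<close>, all averages of \<open>A\<^sup>* A\<close> and hence the nonzero scalar
  \<open>\<tau>(A\<^sup>* A)\<close> which they approach.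
\<close>
lemma dixmier_simple:
  assumes K': "additive_subgroup K'" "K \<subseteq> K'" and dix: "\<And>A. A \<in> subgroup_algebra K' \<Longrightarrow> dixmier K A"
  shows "simple_cstar (subgroup_algebra K')"
  unfolding simple_cstar_def
proof (intro conjI allI impI)
  let ?\<A> = "subgroup_algebra K'"
  note s = cstar_subalgebraD [OF subgroup_algebra_cstar [of K']]
  have id: "id_blinfun \<in> ?\<A>" by (rule id_mem [OF K'(1)])
  have "id_blinfun \<noteq> (0 :: 'g operator)"
    by (metis blinfun.zero_left id_blinfun.rep_eq id_apply norm_delta norm_zero zero_neq_one)
  with id show "?\<A> \<noteq> {0}" by auto
  fix J assume "closed_ideal ?\<A> J"
  then have J: "J \<subseteq> ?\<A>" "csubspace J" "closed J"
    and left: "\<And>A B. A \<in> ?\<A> \<Longrightarrow> B \<in> J \<Longrightarrow> A o\<^sub>L B \<in> J"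
    and right: "\<And>A B. A \<in> ?\<A> \<Longrightarrow> B \<in> J \<Longrightarrow> B o\<^sub>L A \<in> J"
    by (auto simp: closed_ideal_def)
  show "J = {0} \<or> J = ?\<A>"
  proof (cases "J = {0}")
    case False
    then obtain A where A: "A \<in> J" "A \<noteq> 0"
      using csubspaceD(1) [OF J(2)] by auto
    define t where "t = canonical_trace (adj A o\<^sub>L A)"
    have "A \<in> reduced_cstar \<sigma>"
      using A J subgroup_algebra_mono [of K' UNIV] by (auto simp: reduced_eq)
    then have "t \<noteq> 0"
      using canonical_trace_faithful A by (auto simp: t_def)
    have AA: "adj A o\<^sub>L A \<in> J"
      using A J by (auto intro: left s)
    have mem: "avg ys (adj A o\<^sub>L A) \<in> J" if "set ys \<subseteq> K" for ys
    proof (rule avg_mem [OF J(2) AA])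
      fix B y assume "y \<in> set ys" "B \<in> J"
      then show "Ad y B \<in> J"
        unfolding Ad_def using that K' by (intro left right s L_mem) auto
    qed
    have "scalar_op t \<in> closure J"
      unfolding closure_approachable
    proof (intro allI impI)
      fix e :: real assume "0 < e"
      then obtain ys where ys: "set ys \<subseteq> K" "norm (avg ys (adj A o\<^sub>L A) - scalar_op t) \<le> e / 2"
        using dixmierD [OF dix, of "adj A o\<^sub>L A" "e / 2"] AA J by (auto simp: t_def)
      then show "\<exists>B\<in>J. dist B (scalar_op t) < e"
        using \<open>0 < e\<close> mem by (intro bexI [of _ "avg ys (adj A o\<^sub>L A)"]) (auto simp: dist_norm)
    qed
    then have "scalar_op t \<in> J" using J by simp
    then have "scalar_op (1 / t) o\<^sub>L scalar_op t \<in> J"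
      by (intro csubspaceD [OF J(2)])
    then have "id_blinfun \<in> J"
      using \<open>t \<noteq> 0\<close> by (simp flip: scalar_op_mult)
    then have "?\<A> \<subseteq> J"
      using left by force
    with J show ?thesis by auto
  qed simp
qed

text \<open>
  A trace does not change under averaging and is bounded, so it takes the same value on \<open>A\<close> as on the
  scalar which the averages of \<open>A\<close> approach.
\<close>
lemma dixmier_unique_trace:
  assumes dix: "\<And>A. A \<in> reduced_cstar \<sigma> \<Longrightarrow> dixmier K A"
  shows "unique_trace_property \<sigma>"
  unfolding unique_trace_property_def
proof (rule ex1I)
  let ?\<A> = "reduced_cstar \<sigma>"
  show "tracial_state ?\<A> (restrict canonical_trace ?\<A>)"
    by (rule canonical_trace_tracial)
  fix \<tau> assume \<tau>: "tracial_state ?\<A> \<tau>"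
  have r: "cstar_subalgebra ?\<A>" by (simp add: reduced_eq subgroup_algebra_cstar)
  have id: "id_blinfun \<in> ?\<A>" by (simp add: reduced_eq id_mem additive_subgroup_UNIV)
  have adj: "?\<A> \<subseteq> {A. adjointable A}"
    using subgroup_algebra_adjointable by (auto simp: reduced_eq)
  note r' = cstar_subalgebraD [OF r] csubspaceD [OF cstar_subalgebraD(1) [OF r]]
  note \<tau>' = tracial_stateD [OF \<tau>]
  have Ly: "L y \<in> ?\<A>" for y by (simp add: reduced_eq L_mem)
  have Ad: "\<tau> (Ad y B) = \<tau> B" "Ad y B \<in> ?\<A>" if "B \<in> ?\<A>" for y B
  proof -
    have "\<tau> ((L y o\<^sub>L B) o\<^sub>L adj (L y)) = \<tau> (adj (L y) o\<^sub>L (L y o\<^sub>L B))"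
      using that Ly by (intro \<tau>' r')
    then show "\<tau> (Ad y B) = \<tau> B" by (simp add: Ad_def)
    show "Ad y B \<in> ?\<A>" using that Ly by (auto simp: Ad_def intro!: r')
  qed
  have avg: "\<tau> (avg ys A) = \<tau> A \<and> avg ys A \<in> ?\<A>" if "A \<in> ?\<A>" for ys A
  proof (induction ys)
    case (Cons y ys)
    then show ?case by (simp add: Ad \<tau>' r')
  qed (use that in simp)
  have "\<tau> A = canonical_trace A" if A: "A \<in> ?\<A>" for A
  proof -
    have "cmod (\<tau> A - canonical_trace A) \<le> e" if "0 < e" for e
    proof -
      obtain ys where ys: "norm (avg ys A - scalar_op (canonical_trace A)) \<le> e / 2"
        using dixmierD [OF dix [OF A], of "e / 2"] \<open>0 < e\<close> by auto
      let ?B = "avg ys A - scalar_op (canonical_trace A)"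
      have "scalar_op c \<in> ?\<A>" "\<tau> (scalar_op c) = c" for c
        using r'(7) [OF id, of c] \<tau>'(2) [OF id, of c] \<tau>'(4) by auto
      then have "\<tau> ?B = \<tau> A - canonical_trace A" "?B \<in> ?\<A>"
        using avg [OF A, of ys] \<tau>'(1) [of "avg ys A" "- scalar_op (canonical_trace A)"]
        by (auto simp: \<tau>' r')
      then show ?thesis
        using tracial_state_bounded [OF r adj id \<tau>, of ?B] ys by simp
    qed
    then have "cmod (\<tau> A - canonical_trace A) \<le> 0"
      by (rule field_le_epsilon [of _ 0, simplified])
    then show ?thesis by simp
  qed
  moreover have "\<tau> A = undefined" if "A \<notin> ?\<A>" for A
    using \<tau> that by (auto simp: tracial_state_def extensional_def)
  ultimately show "\<tau> = restrict canonical_trace ?\<A>"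
    by (auto simp: restrict_def)
qed

end

section \<open>The wreath product with a nondegenerate base cocycle\<close>

lemma wreath_simps:
  "Wr x k + Wr y l = Wr (x + shift k y) (k + l)"
  "- Wr x k = Wr (- shift (- k) x) (- k)"
  "(0 :: 'n::ab_group_add wreath_int) = Wr 0 0"
  by (simp_all add: plus_wreath_int_def uminus_wreath_int_def zero_wreath_int_def)

lemma wreath_diff: "g - h = g + - (h :: 'n::ab_group_add wreath_int)"
  by (rule minus_wreath_int_def)

definition base_group :: "'n::ab_group_add wreath_int set"
  where "base_group = range (\<lambda>x. Wr x 0)"

lemma base_group_iff: "g \<in> base_group \<longleftrightarrow> wr_int g = 0"
  by (cases g) (auto simp: base_group_def)

lemma base_group_subgroup: "additive_subgroup base_group"
  unfolding additive_subgroup_def base_group_def by (auto simp: wreath_simps)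

lemma base_group_normal: "h \<in> base_group \<Longrightarrow> g + h - g \<in> base_group"
  unfolding base_group_iff by (cases g; cases h) (simp add: wreath_simps wreath_diff)

lemma base_group_commute: "g \<in> base_group \<Longrightarrow> h \<in> base_group \<Longrightarrow> g + h = h + g"
  by (auto simp: base_group_def wreath_simps add.commute)

lemma base_conjugate:
  "Wr z 0 + Wr x k - Wr z 0 = Wr (x + (z - shift k z)) k"
  by (simp add: wreath_simps wreath_diff shift_uminus algebra_simps)

text \<open>
  If two different positions gave the same value, comparing coordinates at both would put each of them
  at distance \<open>k\<close> to the right of the other.
\<close>
lemma inj_single_diff:
  fixes a :: "'n::ab_group_add"
  assumes "a \<noteq> 0" "k \<noteq> 0"
  shows "inj (\<lambda>j::int. Poly_Mapping.single j a - shift k (Poly_Mapping.single j a))"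
proof (rule injI)
  fix i j :: int
  assume eq: "Poly_Mapping.single i a - shift k (Poly_Mapping.single i a) =
    Poly_Mapping.single j a - shift k (Poly_Mapping.single j a)"
  have ev: "(a when i = n) - (a when i = n - k) = (a when j = n) - (a when j = n - k)" for n
    using arg_cong [OF eq, of "\<lambda>x. Poly_Mapping.lookup x n"]
    by (simp add: lookup_minus lookup_shift lookup_single)
  show "i = j"
  proof (rule ccontr)
    assume "i \<noteq> j"
    with ev [of i] ev [of j] assms show False
      by (auto simp: when_def split: if_splits)
  qed
qed

text \<open>
  Conjugation by a point mass at \<open>j\<close> translates the base part of every element with integer part \<open>k\<close> by
  the same amount \<open>f j\<close>.  As \<open>f\<close> is injective, some \<open>f j\<close> is not among the finitely many differences of
  base parts in \<open>P\<close>.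
\<close>
lemma base_escape:
  fixes P :: "'n::ab_group_add wreath_int set" and a :: 'n
  assumes a: "a \<noteq> 0" and g: "g \<notin> base_group" and P: "finite P" "P \<subseteq> (\<lambda>x. x + g) ` base_group"
  shows "\<exists>z\<in>base_group. P \<inter> (\<lambda>p. z + p - z) ` P = {}"
proof -
  define k where "k = wr_int g"
  have k: "k \<noteq> 0" using g by (simp add: base_group_iff k_def)
  have Pk: "wr_int p = k" if "p \<in> P" for p
    using that P(2) by (cases g) (auto simp: k_def base_group_def wreath_simps)
  define f where "f = (\<lambda>j::int. Poly_Mapping.single j a - shift k (Poly_Mapping.single j a))"
  have "inj f" unfolding f_def by (rule inj_single_diff [OF a k])
  let ?D = "(\<lambda>(p, q). wr_base q - wr_base p) ` (P \<times> P)"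
  have "finite (f -` ?D)"
    using P(1) \<open>inj f\<close> by (intro finite_vimageI) auto
  then obtain j where j: "f j \<notin> ?D"
    using infinite_UNIV_int by (metis finite_subset subsetI vimageI)
  let ?z = "Wr (Poly_Mapping.single j a) 0"
  have "?z + p - ?z \<notin> P" if "p \<in> P" for p
  proof
    assume *: "?z + p - ?z \<in> P"
    have "?z + p - ?z = Wr (wr_base p + f j) k"
      using Pk [OF that] by (cases p) (simp add: base_conjugate f_def)
    then have "wr_base (?z + p - ?z) - wr_base p = f j" by simp
    with j * that show False by force
  qed
  then show ?thesis
    by (intro bexI [of _ ?z]) (auto simp: base_group_iff)
qed

locale wreath_cocycle = cocycle \<sigma>
  for \<sigma> :: "'n::ab_group_add wreath_int \<Rightarrow> 'n wreath_int \<Rightarrow> complex"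
begin

lemma base_eq: "base_cstar \<sigma> = subgroup_algebra base_group"
  unfolding base_cstar_def subgroup_algebra_def base_group_def by (simp add: image_image)

lemma int_action_eq: "int_action \<sigma> k = Ad (Wr 0 k)"
  by (rule ext) (simp add: int_action_def Ad_def)

lemma kleppner_base_iff:
  "kleppner (base_cocycle \<sigma>) \<longleftrightarrow> (\<forall>g\<in>base_group. g \<noteq> 0 \<longrightarrow> (\<exists>h\<in>base_group. \<sigma> h g \<noteq> \<sigma> g h))"
proof -
  have "conjugacy_class x = {x}" for x :: "int \<Rightarrow>\<^sub>0 'n"
    by (auto simp: conjugacy_class_def)
  moreover have "h + g = g + h" for g h :: "int \<Rightarrow>\<^sub>0 'n"
    by (rule add.commute)
  ultimately show ?thesis
    unfolding kleppner_def sigma_regular_def base_cocycle_def base_group_def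
    by (force simp: wreath_simps)
qed

lemma nondegenerate_consequences:
  assumes N: "\<exists>x::'n. x \<noteq> 0" and kl: "kleppner (base_cocycle \<sigma>)"
  shows "unique_trace_property \<sigma>" and "cstar_simple \<sigma>" and "minimal_int_action \<sigma>"
proof -
  obtain a :: 'n where a: "a \<noteq> 0" using N by blast
  have nondeg: "\<exists>y\<in>base_group. \<sigma> y g \<noteq> \<sigma> g y" if "g \<in> base_group" "g \<noteq> 0" for g
    using kl that by (simp add: kleppner_base_iff)
  have dix: "dixmier base_group A" if "A \<in> reduced_cstar \<sigma>" for A
    using base_group_subgroup base_group_commute base_group_normal nondeg base_escape [OF a] that
    by (rule dixmier_reduced)
  show "unique_trace_property \<sigma>"
    using dix by (rule dixmier_unique_trace)
  show "cstar_simple \<sigma>"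
    unfolding cstar_simple_def reduced_eq
    using dix by (intro dixmier_simple [of _ base_group] additive_subgroup_UNIV) (auto simp: reduced_eq)
  have simple: "simple_cstar (base_cstar \<sigma>)"
    unfolding base_eq
    using dix subgroup_algebra_mono [of base_group UNIV]
    by (intro dixmier_simple [of _ base_group] base_group_subgroup) (auto simp: reduced_eq)
  have "closed_ideal (base_cstar \<sigma>) {0}"
    using csubspaceD(1) [OF cstar_subalgebraD(1) [OF subgroup_algebra_cstar [of base_group]]]
    by (auto simp: closed_ideal_def csubspace_def base_eq blinfun_compose.zero_left blinfun_compose.zero_right)
  then show "minimal_int_action \<sigma>"
    using simple unfolding minimal_int_action_def simple_cstar_def int_action_eq by auto
qed

end

section \<open>Folner sets in abelian groups\<close>

definition multiple :: "nat \<Rightarrow> 'a::ab_group_add \<Rightarrow> 'a"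
  where "multiple n x = (\<Sum>i<n. x)"

text \<open>
  Relations in the group may identify different choices of exponents; only an upper bound for the
  cardinality is needed.
\<close>
definition word_box :: "'a::ab_group_add set \<Rightarrow> nat \<Rightarrow> 'a set"
  where "word_box E n = (\<lambda>f. \<Sum>e\<in>E. multiple (f e) e) ` (E \<rightarrow>\<^sub>E {..n})"

lemma word_box_finite: "finite E \<Longrightarrow> finite (word_box E n)"
  by (simp add: word_box_def finite_PiE)

lemma card_word_box_le: "finite E \<Longrightarrow> card (word_box E n) \<le> (n + 1) ^ card E"
  unfolding word_box_def
  by (rule order_trans [OF card_image_le]) (auto simp: finite_PiE card_PiE)

lemma word_box_mono: "word_box E n \<subseteq> word_box E (Suc n)"
  unfolding word_box_def by (intro image_mono PiE_mono) auto

lemma word_box_nonempty: "word_box E n \<noteq> {}"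
  by (simp add: word_box_def PiE_eq_empty_iff)

lemma word_box_translate:
  assumes "finite E" "e \<in> E"
  shows "(\<lambda>y. e + y) ` word_box E n \<subseteq> word_box E (Suc n)"
proof
  fix x assume "x \<in> (\<lambda>y. e + y) ` word_box E n"
  then obtain f where f: "f \<in> E \<rightarrow>\<^sub>E {..n}" and x: "x = e + (\<Sum>e\<in>E. multiple (f e) e)"
    by (auto simp: word_box_def)
  define f' where "f' = f(e := Suc (f e))"
  have f': "f' \<in> E \<rightarrow>\<^sub>E {..Suc n}"
    using f assms(2) by (auto simp: f'_def PiE_iff extensional_def le_SucI)
  have "(\<Sum>e\<in>E. multiple (f' e) e) = multiple (f' e) e + (\<Sum>e\<in>E - {e}. multiple (f' e) e)"
    by (rule sum.remove [OF assms])
  also have "\<dots> = (e + multiple (f e) e) + (\<Sum>e\<in>E - {e}. multiple (f e) e)"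
    by (intro arg_cong2 [where f = "(+)"] sum.cong)
       (auto simp: f'_def multiple_def add.commute)
  also have "\<dots> = x"
    unfolding x using sum.remove [OF assms, of "\<lambda>e. multiple (f e) e"] by (simp add: add.assoc)
  finally have "x = (\<Sum>e\<in>E. multiple (f' e) e)" ..
  with f' show "x \<in> word_box E (Suc n)"
    unfolding word_box_def by (intro image_eqI [of _ _ f'])
qed

lemma polynomial_less_exponential:
  fixes \<epsilon> :: real
  assumes "0 < \<epsilon>"
  shows "\<exists>n. real (n + 1) ^ k < (1 + \<epsilon>) ^ n"
proof -
  define c where "c = ln (1 + \<epsilon>)"
  have c: "0 < c" using assms by (simp add: c_def ln_gt_zero)
  have "filterlim (\<lambda>n::nat. c * real (n + 1)) at_top sequentially"
    by (rule filterlim_tendsto_pos_mult_at_top [OF tendsto_const c])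
       (rule filterlim_compose [OF filterlim_real_sequentially filterlim_add_const_nat_at_top])
  then have "((\<lambda>n::nat. (c * real (n + 1)) ^ k / exp (c * real (n + 1))) \<longlongrightarrow> 0) sequentially"
    by (rule filterlim_compose [OF tendsto_power_div_exp_0])
  moreover have "0 < c ^ k / exp c" using c by simp
  ultimately have "\<forall>\<^sub>F n in sequentially. (c * real (n + 1)) ^ k / exp (c * real (n + 1)) < c ^ k / exp c"
    by (rule order_tendstoD)
  then obtain n :: nat where "(c * real (n + 1)) ^ k / exp (c * real (n + 1)) < c ^ k / exp c"
    using eventually_happens' [OF sequentially_bot] by blast
  then have "c ^ k * (real (n + 1) ^ k / exp (c * real (n + 1))) < c ^ k * (1 / exp c)"
    by (simp add: power_mult_distrib)
  then have "real (n + 1) ^ k / exp (c * real (n + 1)) < 1 / exp c"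
    by (rule mult_left_less_imp_less) (use c in simp)
  then have "real (n + 1) ^ k < exp (c * real (n + 1)) / exp c"
    by (simp add: field_simps)
  also have "\<dots> = exp (real n * c)"
    by (simp add: exp_diff [symmetric] algebra_simps)
  also have "\<dots> = (1 + \<epsilon>) ^ n"
    using assms by (simp add: exp_of_nat_mult c_def)
  finally show ?thesis by blast
qed

text \<open>
  If every box were enlarged by a factor \<open>1 + \<epsilon>\<close> by one of the translations, the boxes would grow
  exponentially, but their size is bounded by a polynomial.
\<close>
lemma folner_set_exists:
  fixes E :: "'a::ab_group_add set" and \<epsilon> :: real
  assumes E: "finite E" and \<epsilon>: "0 < \<epsilon>"
  shows "\<exists>n. \<forall>e\<in>E. real (card ((\<lambda>y. e + y) ` word_box E n - word_box E n)) \<le> \<epsilon> * card (word_box E n)"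
proof (rule ccontr)
  assume "\<not> ?thesis"
  then have *: "\<exists>e\<in>E. \<epsilon> * card (word_box E n) < real (card ((\<lambda>y. e + y) ` word_box E n - word_box E n))" for n
    by (auto simp: not_le)
  have grow: "(1 + \<epsilon>) ^ n \<le> card (word_box E n)" for n
  proof (induction n)
    case 0
    have "0 < card (word_box E 0)"
      using word_box_finite [OF E] word_box_nonempty by (simp add: card_gt_0_iff)
    then show ?case by simp
  next
    case (Suc n)
    obtain e where e: "e \<in> E" "\<epsilon> * card (word_box E n) < real (card ((\<lambda>y. e + y) ` word_box E n - word_box E n))"
      using * by blast
    have "card (word_box E n) + card ((\<lambda>y. e + y) ` word_box E n - word_box E n) =
        card (word_box E n \<union> ((\<lambda>y. e + y) ` word_box E n - word_box E n))"
      using word_box_finite [OF E] by (intro card_Un_disjoint [symmetric]) auto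
    also have "\<dots> \<le> card (word_box E (Suc n))"
      using word_box_mono [of E n] word_box_translate [OF E e(1), of n]
      by (intro card_mono word_box_finite E) auto
    finally have "(1 + \<epsilon>) * card (word_box E n) \<le> card (word_box E (Suc n))"
      using e(2) by (simp add: algebra_simps)
    moreover have "(1 + \<epsilon>) ^ Suc n \<le> (1 + \<epsilon>) * card (word_box E n)"
      using Suc \<epsilon> by simp
    ultimately show ?case by linarith
  qed
  obtain n where "real (n + 1) ^ card E < (1 + \<epsilon>) ^ n"
    using polynomial_less_exponential [OF \<epsilon>] by blast
  also have "\<dots> \<le> card (word_box E n)" by (rule grow)
  also have "\<dots> \<le> real ((n + 1) ^ card E)"
    using card_word_box_le [OF E] by (simp only: of_nat_le_iff)
  finally show False by simp
qed

section \<open>Pointwise limits of bounded functionals\<close>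

text \<open>
  Uniform boundedness lets convergence to zero pass from the generators of an algebra to their closed
  span.
\<close>
lemma null_sequence_space:
  fixes f :: "nat \<Rightarrow> 'g operator \<Rightarrow> complex"
  assumes add: "\<And>m A B. f m (A + B) = f m A + f m B"
    and scalar: "\<And>m c A. adjointable A \<Longrightarrow> f m (scalar_op c o\<^sub>L A) = c * f m A"
    and bound: "\<And>m A. cmod (f m A) \<le> C * norm A"
  shows "csubspace {A. adjointable A \<and> (\<lambda>m. f m A) \<longlonglongrightarrow> 0}" (is "csubspace ?V")
    and "closed {A. adjointable A \<and> (\<lambda>m. f m A) \<longlonglongrightarrow> 0}"
proof -
  have zero: "f m 0 = 0" for m
    using add [of m 0 0] by simp
  show "csubspace ?V"
    unfolding csubspace_def
  proof (intro conjI ballI allI)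
    show "0 \<in> ?V" by (simp add: zero)
    show "A + B \<in> ?V" if "A \<in> ?V" "B \<in> ?V" for A B
      using that tendsto_add [of "\<lambda>m. f m A" 0 sequentially "\<lambda>m. f m B" 0] by (simp add: add)
    show "scalar_op c o\<^sub>L A \<in> ?V" if "A \<in> ?V" for c A
      using that tendsto_mult_left [of "\<lambda>m. f m A" 0 sequentially c] by (simp add: scalar)
  qed
  show "closed ?V"
    unfolding closed_sequential_limits
  proof (intro allI impI, elim conjE)
    fix X A assume X: "\<forall>n. X n \<in> ?V" and lim: "X \<longlonglongrightarrow> A"
    have adj: "adjointable A"
      using closed_adjointable [unfolded closed_sequential_limits, rule_format, of X A] X lim by simp
    have "(\<lambda>m. f m A) \<longlonglongrightarrow> 0"
    proof (rule LIMSEQ_I)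
      fix e :: real assume e: "0 < e"
      \<comment> \<open>A bound that is positive even if \<open>C\<close> is zero.\<close>
      define D where "D = \<bar>C\<bar> + 1"
      have D: "0 < D" by (simp add: D_def add_nonneg_pos)
      obtain n where n: "norm (X n - A) < e / (2 * D)"
        using LIMSEQ_D [OF lim, of "e / (2 * D)"] e D by auto
      have "(\<lambda>m. f m (X n)) \<longlonglongrightarrow> 0" using X by simp
      then obtain M where M: "\<And>m. m \<ge> M \<Longrightarrow> cmod (f m (X n)) < e / 2"
        using LIMSEQ_D [of "\<lambda>m. f m (X n)" 0 "e / 2"] e by auto
      have "cmod (f m A) < e" if "m \<ge> M" for m
      proof -
        have "f m A = f m (X n) + f m (A - X n)"
          using add [of m "X n" "A - X n"] by simp
        then have "cmod (f m A) \<le> cmod (f m (X n)) + cmod (f m (A - X n))"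
          by (simp add: norm_triangle_ineq)
        moreover have "cmod (f m (A - X n)) \<le> D * norm (X n - A)"
        proof -
          have "C \<le> D" unfolding D_def by linarith
          then have "C * norm (A - X n) \<le> D * norm (A - X n)" by (rule mult_right_mono) simp
          then show ?thesis using bound [of m "A - X n"] by (simp add: norm_minus_commute)
        qed
        moreover have "D * norm (X n - A) < D * (e / (2 * D))"
          using n D by (rule mult_strict_left_mono)
        moreover have "D * (e / (2 * D)) = e / 2" using D by simp
        ultimately show ?thesis using M [OF that] by linarith
      qed
      then show "\<exists>M. \<forall>m\<ge>M. norm (f m A - 0) < e" by auto
    qed
    with adj show "A \<in> ?V" by simp
  qed
qed

lemma convergent_sequence_space:
  fixes f :: "nat \<Rightarrow> 'g operator \<Rightarrow> complex"
  assumes add: "\<And>m A B. f m (A + B) = f m A + f m B"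
    and scalar: "\<And>m c A. f m (scalar_op c o\<^sub>L A) = c * f m A"
    and bound: "\<And>m A. cmod (f m A) \<le> norm A"
  shows "csubspace {A. convergent (\<lambda>m. f m A)}" (is "csubspace ?V")
    and "closed {A. convergent (\<lambda>m. f m A)}"
proof -
  have zero: "f m 0 = 0" for m
    using add [of m 0 0] by simp
  show "csubspace ?V"
    unfolding csubspace_def
  proof (intro conjI ballI allI)
    show "0 \<in> ?V" by (simp add: zero convergent_const)
    show "A + B \<in> ?V" if "A \<in> ?V" "B \<in> ?V" for A B
      using that convergent_add [of "\<lambda>m. f m A" "\<lambda>m. f m B"] by (simp add: add)
    show "scalar_op c o\<^sub>L A \<in> ?V" if "A \<in> ?V" for c A
      using that convergent_mult [of "\<lambda>m. c" "\<lambda>m. f m A"] by (simp add: scalar convergent_const)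
  qed
  show "closed ?V"
    unfolding closed_sequential_limits
  proof (intro allI impI, elim conjE)
    fix X A assume X: "\<forall>n. X n \<in> ?V" and lim: "X \<longlonglongrightarrow> A"
    have "Cauchy (\<lambda>m. f m A)"
    proof (rule CauchyI)
      fix e :: real assume e: "0 < e"
      obtain n where n: "norm (X n - A) < e / 3"
        using LIMSEQ_D [OF lim, of "e / 3"] e by auto
      have "Cauchy (\<lambda>m. f m (X n))"
        using X by (simp add: Cauchy_convergent_iff)
      then obtain M where M: "\<And>m k. m \<ge> M \<Longrightarrow> k \<ge> M \<Longrightarrow> cmod (f m (X n) - f k (X n)) < e / 3"
        using CauchyD [of "\<lambda>m. f m (X n)" "e / 3"] e by auto
      have near: "cmod (f m A - f m (X n)) < e / 3" for m
        using add [of m "X n" "A - X n"] bound [of m "A - X n"] n by (simp add: norm_minus_commute)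
      have "cmod (f m A - f k A) < e" if "m \<ge> M" "k \<ge> M" for m k
        using near [of m] near [of k] M [OF that]
          norm_triangle_ineq [of "f m A - f m (X n)" "f m (X n) - f k A"]
          norm_triangle_ineq [of "f m (X n) - f k (X n)" "f k (X n) - f k A"]
        by (simp add: norm_minus_commute)
      then show "\<exists>M. \<forall>m\<ge>M. \<forall>k\<ge>M. norm (f m A - f k A) < e" by blast
    qed
    then show "A \<in> ?V" by (simp add: Cauchy_convergent_iff)
  qed
qed

section \<open>The group generated by the translates of an element\<close>

text \<open>
  The subgroup generated by the translates of \<open>x\<close>.  It is countable even when the group of all
  regular elements is not, so that a single sequence of Folner sets serves all of it.
\<close>
inductive_set shift_span :: "(int \<Rightarrow>\<^sub>0 'n::ab_group_add) \<Rightarrow> (int \<Rightarrow>\<^sub>0 'n) set"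
  for x :: "int \<Rightarrow>\<^sub>0 'n"
  where gen: "shift i x \<in> shift_span x"
  | diff: "a \<in> shift_span x \<Longrightarrow> b \<in> shift_span x \<Longrightarrow> a - b \<in> shift_span x"

lemma shift_span_zero: "0 \<in> shift_span x"
  using shift_span.diff [OF shift_span.gen shift_span.gen, of 0 x 0] by simp

lemma shift_span_uminus: "a \<in> shift_span x \<Longrightarrow> - a \<in> shift_span x"
  using shift_span.diff [OF shift_span_zero] by fastforce

lemma shift_span_add: "a \<in> shift_span x \<Longrightarrow> b \<in> shift_span x \<Longrightarrow> a + b \<in> shift_span x"
  using shift_span.diff [of a x "- b"] shift_span_uminus by fastforce

lemma shift_span_sum: "(\<And>i. i \<in> I \<Longrightarrow> f i \<in> shift_span x) \<Longrightarrow> sum f I \<in> shift_span x"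
  by (induction I rule: infinite_finite_induct) (auto intro: shift_span_zero shift_span_add)

lemma shift_minus: "shift k (x - y) = shift k x - shift k y"
  by (simp add: shift_add shift_uminus diff_conv_add_uminus del: add_uminus_conv_diff)

lemma shift_span_shift: "a \<in> shift_span x \<Longrightarrow> shift k a \<in> shift_span x"
  by (induction rule: shift_span.induct) (auto simp: shift_shift shift_minus intro: shift_span.intros)

text \<open>
  A nonzero element has a last nonzero coordinate, which the shift moves.
\<close>
lemma shift_fixed_imp_zero:
  assumes "shift 1 w = w"
  shows "w = 0"
proof (rule ccontr)
  assume "w \<noteq> 0"
  define M where "M = Max (Poly_Mapping.keys w)"
  have "M \<in> Poly_Mapping.keys w"
    using \<open>w \<noteq> 0\<close> unfolding M_def by (intro Max_in) auto
  moreover have "Poly_Mapping.lookup w (M + 1) = Poly_Mapping.lookup w M"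
    using arg_cong [OF assms, of "\<lambda>w. Poly_Mapping.lookup w (M + 1)"] by (simp add: lookup_shift)
  ultimately have "M + 1 \<in> Poly_Mapping.keys w"
    by (simp add: in_keys_iff)
  then have "M + 1 \<le> M"
    unfolding M_def by (intro Max_ge) auto
  then show False by simp
qed

text \<open>
  The \<open>m\<close>-th set is almost invariant under the translates of \<open>x\<close> by at most \<open>m\<close>; almost invariance under
  the rest of the generated group is deduced in the limit.
\<close>
lemma folner_sequence:
  fixes x :: "int \<Rightarrow>\<^sub>0 'n::ab_group_add"
  shows "\<exists>Y. \<forall>m::nat. finite (Y m) \<and> Y m \<noteq> {} \<and> Y m \<subseteq> shift_span x \<and>
    (\<forall>i. \<bar>i\<bar> \<le> int m \<longrightarrow> real (card ((\<lambda>y. shift i x + y) ` Y m - Y m)) \<le> 1 / real (m + 1) * card (Y m))"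
proof (rule choice, rule allI)
  fix m :: nat
  define E where "E = (\<lambda>i. shift i x) ` {- int m..int m}"
  have E: "finite E" by (simp add: E_def)
  obtain n where n: "\<forall>e\<in>E. real (card ((\<lambda>y. e + y) ` word_box E n - word_box E n))
      \<le> 1 / real (m + 1) * card (word_box E n)"
    using folner_set_exists [OF E, of "1 / real (m + 1)"] by auto
  have "word_box E n \<subseteq> shift_span x"
    by (auto simp: word_box_def multiple_def E_def intro!: shift_span_sum shift_span.gen)
  then show "\<exists>Y. finite Y \<and> Y \<noteq> {} \<and> Y \<subseteq> shift_span x \<and>
    (\<forall>i. \<bar>i\<bar> \<le> int m \<longrightarrow> real (card ((\<lambda>y. shift i x + y) ` Y - Y)) \<le> 1 / real (m + 1) * card Y)"
    using n word_box_finite [OF E] word_box_nonempty [of E n]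
    by (intro exI [of _ "word_box E n"]) (auto simp: E_def abs_le_iff)
qed

text \<open>
  Translating by \<open>b\<close> turns the left-hand side into the size of the part of \<open>a + Y\<close> outside \<open>b + Y\<close>.  It lies outside
  \<open>Y\<close> or in \<open>Y - (b + Y)\<close>, and the latter has as many elements as \<open>(b + Y) - Y\<close>.
\<close>
lemma card_translate_diff:
  fixes Y :: "'a::ab_group_add set"
  assumes "finite Y"
  shows "card ((\<lambda>y. (a - b) + y) ` Y - Y) \<le> card ((\<lambda>y. a + y) ` Y - Y) + card ((\<lambda>y. b + y) ` Y - Y)"
proof -
  have inj: "inj_on (\<lambda>y. c + y) B" for c :: 'a and B by (auto simp: inj_on_def)
  have eq: "(\<lambda>y. b + y) ` ((\<lambda>y. (a - b) + y) ` Y - Y) = (\<lambda>y. a + y) ` Y - (\<lambda>y. b + y) ` Y"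
    by (subst image_set_diff) (auto simp: inj_def image_image algebra_simps)
  have "card ((\<lambda>y. (a - b) + y) ` Y - Y) = card ((\<lambda>y. a + y) ` Y - (\<lambda>y. b + y) ` Y)"
    unfolding eq [symmetric] by (rule card_image [OF inj, symmetric])
  also have "\<dots> \<le> card (((\<lambda>y. a + y) ` Y - Y) \<union> (Y - (\<lambda>y. b + y) ` Y))"
    using assms by (intro card_mono) auto
  also have "\<dots> \<le> card ((\<lambda>y. a + y) ` Y - Y) + card (Y - (\<lambda>y. b + y) ` Y)"
    by (rule card_Un_le)
  also have "card (Y - (\<lambda>y. b + y) ` Y) = card ((\<lambda>y. b + y) ` Y - Y)"
  proof -
    have "card ((\<lambda>y. b + y) ` Y) = card Y" by (rule card_image [OF inj])
    then show ?thesis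
      using assms by (simp add: card_Diff_subset_Int Int_commute)
  qed
  finally show ?thesis by simp
qed

lemma folner_ratio_tendsto:
  fixes Y :: "nat \<Rightarrow> (int \<Rightarrow>\<^sub>0 'n::ab_group_add) set"
  assumes fin: "\<And>m. finite (Y m)"
    and Y: "\<And>m i. \<bar>i\<bar> \<le> int m \<Longrightarrow> real (card ((\<lambda>y. shift i x + y) ` Y m - Y m)) \<le> 1 / real (m + 1) * card (Y m)"
    and ne: "\<And>m. Y m \<noteq> {}" and z: "z \<in> shift_span x"
  shows "(\<lambda>m. real (card ((\<lambda>y. z + y) ` Y m - Y m)) / card (Y m)) \<longlonglongrightarrow> 0"
  using z
proof (induction rule: shift_span.induct)
  case (gen i)
  show ?case
  proof (rule tendsto_sandwich [of "\<lambda>_. 0"])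
    show "(\<lambda>m. 1 / real (m + 1)) \<longlonglongrightarrow> 0"
      using LIMSEQ_inverse_real_of_nat by (simp add: inverse_eq_divide add.commute)
    show "\<forall>\<^sub>F m in sequentially. real (card ((\<lambda>y. shift i x + y) ` Y m - Y m)) / card (Y m) \<le> 1 / real (m + 1)"
      using eventually_ge_at_top [of "nat \<bar>i\<bar>"]
    proof eventually_elim
      case (elim m)
      have "0 < card (Y m)" using fin ne by (simp add: card_gt_0_iff)
      then show ?case using Y [of i m] elim by (subst pos_divide_le_eq) auto
    qed
  qed (auto intro!: tendsto_const)
next
  case (diff a b)
  show ?case
  proof (rule tendsto_sandwich [of "\<lambda>_. 0"])
    show "(\<lambda>m. real (card ((\<lambda>y. a + y) ` Y m - Y m)) / card (Y m) +
        real (card ((\<lambda>y. b + y) ` Y m - Y m)) / card (Y m)) \<longlonglongrightarrow> 0"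
      using tendsto_add [OF diff.IH] by simp
    show "\<forall>\<^sub>F m in sequentially. real (card ((\<lambda>y. a - b + y) ` Y m - Y m)) / card (Y m) \<le>
        real (card ((\<lambda>y. a + y) ` Y m - Y m)) / card (Y m) +
        real (card ((\<lambda>y. b + y) ` Y m - Y m)) / card (Y m)"
    proof (intro always_eventually allI)
      fix m
      show "real (card ((\<lambda>y. a - b + y) ` Y m - Y m)) / card (Y m) \<le>
        real (card ((\<lambda>y. a + y) ` Y m - Y m)) / card (Y m) +
        real (card ((\<lambda>y. b + y) ` Y m - Y m)) / card (Y m)"
        unfolding add_divide_distrib [symmetric] of_nat_add [symmetric]
        using card_translate_diff [OF fin [of m], of a b] by (intro divide_right_mono) auto
    qed
  qed (auto intro!: tendsto_const)
qed

section \<open>The wreath product with a degenerate base cocycle\<close>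

context wreath_cocycle
begin

abbreviation Lb :: "(int \<Rightarrow>\<^sub>0 'n) \<Rightarrow> 'n wreath_int operator"
  where "Lb x \<equiv> L (Wr x 0)"

text \<open>
  The quotient of the translate of a unitary by the unitary itself.  It is insensitive to scalars, which is
  what removes the cocycle from \<open>W\<close> below.
\<close>
definition twist :: "'n wreath_int operator \<Rightarrow> 'n wreath_int operator"
  where "twist A = Ad (Wr 0 1) A o\<^sub>L adj A"

abbreviation W :: "(int \<Rightarrow>\<^sub>0 'n) \<Rightarrow> 'n wreath_int operator"
  where "W z \<equiv> twist (Lb z)"

abbreviation displacement :: "(int \<Rightarrow>\<^sub>0 'n) \<Rightarrow> 'n wreath_int"
  where "displacement z \<equiv> Wr (shift 1 z - z) 0"

text \<open>
  The operators commuting with the unitaries of the base group.  Invariance under conjugation is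
  easier to propagate than commutation, as conjugation respects products and adjoints and is an action.
\<close>
definition base_fixed :: "'n wreath_int operator \<Rightarrow> bool"
  where "base_fixed A \<longleftrightarrow> adjointable A \<and> (\<forall>y. Ad (Wr y 0) A = A)"

lemma twist_scalar:
  assumes "cmod c = 1" "adjointable A"
  shows "twist (scalar_op c o\<^sub>L A) = twist A"
proof -
  have "c * cnj c = 1"
    using assms(1) complex_norm_square [of c] by simp
  then show ?thesis
    using assms(2)
    by (simp add: twist_def Ad_scalar adj_scalar_op_compose scalar_op_compose
        compose_scalar_op scalar_op_scalar_op adjointable_adj)
qed

lemma W_eq: "\<exists>c. cmod c = 1 \<and> W z = scalar_op c o\<^sub>L L (displacement z)"
proof -
  obtain c where c: "cmod c = 1" "Ad (Wr 0 1) (Lb z) = scalar_op c o\<^sub>L L (Wr 0 1 + Wr z 0 - Wr 0 1)"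
    using Ad_L by blast
  have g: "Wr 0 1 + Wr z 0 - Wr 0 1 = Wr (shift 1 z) 0" "- Wr z 0 = Wr (- z) 0"
    by (simp_all add: wreath_simps wreath_diff)
  let ?d = "c * (cnj (\<sigma> (Wr z 0) (Wr (- z) 0)) * \<sigma> (Wr (shift 1 z) 0) (Wr (- z) 0))"
  have "W z = scalar_op ?d o\<^sub>L L (Wr (shift 1 z) 0 + Wr (- z) 0)"
    by (simp add: twist_def c(2) adj_L g scalar_op_compose compose_scalar_op scalar_op_scalar_op L_L)
  moreover have "Wr (shift 1 z) 0 + Wr (- z) 0 = displacement z"
    by (simp add: wreath_simps)
  ultimately show ?thesis
    using c(1) by (intro exI [of _ ?d]) (simp add: norm_mult)
qed

lemma adjointable_W [simp]: "adjointable (W z)"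
  by (simp add: twist_def)

lemma base_fixed_compose: "base_fixed A \<Longrightarrow> base_fixed B \<Longrightarrow> base_fixed (A o\<^sub>L B)"
  by (simp add: base_fixed_def flip: Ad_compose)

lemma base_fixed_adj: "base_fixed A \<Longrightarrow> base_fixed (adj A)"
  by (simp add: base_fixed_def adjointable_adj flip: adj_Ad)

lemma base_fixed_scalar: "base_fixed A \<Longrightarrow> base_fixed (scalar_op c o\<^sub>L A)"
  by (simp add: base_fixed_def Ad_scalar)

lemma base_fixed_Ad: "base_fixed A \<Longrightarrow> base_fixed (Ad (Wr 0 k) A)"
proof -
  assume A: "base_fixed A"
  have "Ad (Wr y 0) (Ad (Wr 0 k) A) = Ad (Wr 0 k) A" for y
  proof -
    have adj: "adjointable A" using A by (simp add: base_fixed_def)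
    have "Wr y 0 + Wr 0 k = Wr 0 k + Wr (shift (- k) y) 0"
      by (simp add: wreath_simps shift_shift)
    then have "Ad (Wr y 0) (Ad (Wr 0 k) A) = Ad (Wr 0 k) (Ad (Wr (shift (- k) y) 0) A)"
      unfolding Ad_Ad [OF adj] by simp
    then show ?thesis using A by (simp add: base_fixed_def)
  qed
  then show ?thesis using A by (simp add: base_fixed_def)
qed

lemma base_fixed_commute: "base_fixed A \<Longrightarrow> Lb y o\<^sub>L A = A o\<^sub>L Lb y"
proof -
  assume "base_fixed A"
  then have "A o\<^sub>L Lb y = Ad (Wr y 0) A o\<^sub>L Lb y" by (simp add: base_fixed_def)
  then show ?thesis by (simp add: Ad_def blinfun_compose_assoc)
qed

lemma base_fixed_commute_adj: "base_fixed A \<Longrightarrow> adj (Lb y) o\<^sub>L A = A o\<^sub>L adj (Lb y)"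
proof -
  assume A: "base_fixed A"
  have "adj (Lb y) o\<^sub>L A = adj (Lb y) o\<^sub>L (A o\<^sub>L Lb y) o\<^sub>L adj (Lb y)"
    by (simp add: blinfun_compose_assoc)
  also have "\<dots> = A o\<^sub>L adj (Lb y)"
    by (simp add: base_fixed_commute [OF A, symmetric] flip: blinfun_compose_assoc)
  finally show ?thesis .
qed

lemma base_fixed_W: "base_fixed (Lb z) \<Longrightarrow> base_fixed (W z)"
  unfolding twist_def by (intro base_fixed_compose base_fixed_Ad base_fixed_adj)

text \<open>
  The cocycle factor of \<open>L z\<close> and \<open>L w\<close> disappears in the twist; the centrality of \<open>L w\<close> makes its twist
  commute with \<open>L z\<close>.
\<close>
lemma W_W:
  assumes "base_fixed (Lb w)"
  shows "W z o\<^sub>L W w = W (z + w)"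
proof -
  have "W (z + w) = twist (scalar_op (\<sigma> (Wr z 0) (Wr w 0)) o\<^sub>L L (Wr (z + w) 0))"
    by (simp add: twist_scalar)
  also have "\<dots> = twist (Lb z o\<^sub>L Lb w)"
    by (simp add: L_L wreath_simps)
  also have "\<dots> = Ad (Wr 0 1) (Lb z) o\<^sub>L (W w o\<^sub>L adj (Lb z))"
    by (simp add: twist_def adj_compose blinfun_compose_assoc flip: Ad_compose)
  also have "W w o\<^sub>L adj (Lb z) = adj (Lb z) o\<^sub>L W w"
    by (rule base_fixed_commute_adj [symmetric]) (rule base_fixed_W [OF assms])
  also have "Ad (Wr 0 1) (Lb z) o\<^sub>L (adj (Lb z) o\<^sub>L W w) = W z o\<^sub>L W w"
    by (subst (2) twist_def) (simp add: blinfun_compose_assoc)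
  finally show ?thesis ..
qed

lemma Ad_W: "Ad (Wr 0 k) (W z) = W (shift k z)"
proof -
  obtain c where c: "cmod c = 1" "Ad (Wr 0 k) (Lb z) = scalar_op c o\<^sub>L L (Wr 0 k + Wr z 0 - Wr 0 k)"
    using Ad_L by blast
  have g: "Wr 0 k + Wr z 0 - Wr 0 k = Wr (shift k z) 0"
    by (simp add: wreath_simps wreath_diff)
  have "Wr 0 k + Wr 0 1 = Wr 0 1 + Wr (0 :: int \<Rightarrow>\<^sub>0 'n) k"
    by (simp add: wreath_simps add.commute)
  then have "Ad (Wr 0 k) (W z) = twist (Ad (Wr 0 k) (Lb z))"
    by (simp add: twist_def adj_Ad Ad_Ad flip: Ad_compose)
  also have "\<dots> = W (shift k z)"
    by (simp add: c g twist_scalar)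
  finally show ?thesis .
qed

end

text \<open>
  Kleppner's condition fails for the base group exactly if such an \<open>x0\<close> exists.
\<close>
locale degenerate_cocycle = wreath_cocycle \<sigma>
  for \<sigma> :: "'n::ab_group_add wreath_int \<Rightarrow> 'n wreath_int \<Rightarrow> complex" +
  fixes x0 :: "int \<Rightarrow>\<^sub>0 'n"
  assumes x0_nonzero: "x0 \<noteq> 0"
    and x0_regular: "\<And>y. \<sigma> (Wr y 0) (Wr x0 0) = \<sigma> (Wr x0 0) (Wr y 0)"
begin

lemma base_fixed_span:
  assumes "z \<in> shift_span x0"
  shows "base_fixed (Lb z)"
  using assms
proof (induction rule: shift_span.induct)
  case (gen i)
  have "Ad (Wr y 0) (Lb x0) = Lb x0" for y
    by (simp add: Ad_L_commuting wreath_simps add.commute x0_regular)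
  then have "base_fixed (Ad (Wr 0 i) (Lb x0))"
    by (intro base_fixed_Ad) (simp add: base_fixed_def)
  moreover obtain c where c: "cmod c = 1" "Ad (Wr 0 i) (Lb x0) = scalar_op c o\<^sub>L L (Wr 0 i + Wr x0 0 - Wr 0 i)"
    using Ad_L by blast
  moreover have "Wr 0 i + Wr x0 0 - Wr 0 i = Wr (shift i x0) 0"
    by (simp add: wreath_simps wreath_diff)
  ultimately have "base_fixed (scalar_op (cnj c) o\<^sub>L (scalar_op c o\<^sub>L Lb (shift i x0)))"
    by - (rule base_fixed_scalar, simp)
  moreover have "cnj c * c = 1"
    using c(1) complex_norm_square [of c] by (simp add: mult.commute)
  ultimately show ?case by (simp add: scalar_op_scalar_op)
next
  case (diff a b)
  let ?c = "cnj (\<sigma> (Wr b 0) (Wr (- b) 0)) * \<sigma> (Wr a 0) (Wr (- b) 0)"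
  have "- Wr b 0 = Wr (- b) 0" by (simp add: wreath_simps)
  then have "Lb a o\<^sub>L adj (Lb b) = scalar_op ?c o\<^sub>L Lb (a - b)"
    by (simp add: adj_L compose_scalar_op L_L scalar_op_scalar_op) (simp add: wreath_simps)
  then have "base_fixed (scalar_op (1 / ?c) o\<^sub>L (scalar_op ?c o\<^sub>L Lb (a - b)))"
    using diff.IH by (metis base_fixed_scalar base_fixed_compose base_fixed_adj)
  moreover have "?c \<noteq> 0" by (metis cmod_cocycle complex_mod_cnj mult_eq_0_iff norm_zero zero_neq_one)
  ultimately show ?case by (simp add: scalar_op_scalar_op del: mult_eq_0_iff)
qed

definition displacements :: "'n wreath_int set"
  where "displacements = displacement ` shift_span x0"

lemma displacements_normal:
  assumes "c \<in> displacements"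
  shows "g + c - g \<in> displacements"
proof -
  obtain z where z: "z \<in> shift_span x0" "c = displacement z"
    using assms by (auto simp: displacements_def)
  obtain y k where g: "g = Wr y k" by (cases g)
  have "g + c - g = displacement (shift k z)"
    by (simp add: g z wreath_simps wreath_diff shift_minus shift_uminus shift_shift add.commute)
  then show ?thesis
    using shift_span_shift [OF z(1)] by (auto simp: displacements_def)
qed

lemma displacement_inj: "displacement y = displacement y' \<Longrightarrow> y = y'"
proof -
  assume "displacement y = displacement y'"
  then have "shift 1 (y - y') = y - y'" by (simp add: shift_minus algebra_simps)
  then show ?thesis using shift_fixed_imp_zero [of "y - y'"] by simp
qed

text \<open>
  These vectors are orthonormal, since \<open>z \<mapsto> shift 1 z - z\<close> is injective, and those indexed by the generated
  group are permuted by \<open>W\<close> through translation.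
\<close>
definition orbit_vector :: "(int \<Rightarrow>\<^sub>0 'n) \<Rightarrow> 'n wreath_int ell2"
  where "orbit_vector y = W y (delta 0)"

lemma orbit_vector_eq: "\<exists>c. cmod c = 1 \<and> orbit_vector y = c *\<^sub>C delta (displacement y)"
proof -
  obtain c where "cmod c = 1" "W y = scalar_op c o\<^sub>L L (displacement y)"
    using W_eq by blast
  then show ?thesis
    by (intro exI [of _ c]) (simp add: orbit_vector_def L_delta)
qed

lemma orbit_vector_orthogonal: "y \<noteq> y' \<Longrightarrow> cinner (orbit_vector y) (orbit_vector y') = 0"
  using orbit_vector_eq [of y] orbit_vector_eq [of y'] displacement_inj [of y y']
  by (auto simp: cinner_delta Rep_delta)

lemma norm_orbit_vector [simp]: "norm (orbit_vector y) = 1"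
  using orbit_vector_eq [of y] by (auto simp: norm_scaleC)

lemma norm_orbit_sum:
  assumes "finite A"
  shows "norm (\<Sum>y\<in>A. orbit_vector y) = sqrt (card A)"
proof -
  have "(norm (\<Sum>y\<in>A. orbit_vector y))\<^sup>2 = card A"
    using assms
  proof (induction A rule: finite_induct)
    case (insert y A)
    have "cinner (orbit_vector y) (\<Sum>y\<in>A. orbit_vector y) = 0"
      unfolding cinner.sum_right using insert by (intro sum.neutral ballI orbit_vector_orthogonal) auto
    then show ?case
      using insert by (simp add: norm_add_orthogonal)
  qed simp
  then show ?thesis
    by (metis norm_ge_zero real_sqrt_unique)
qed

definition folner :: "nat \<Rightarrow> (int \<Rightarrow>\<^sub>0 'n) set"
  where "folner = (SOME Y. \<forall>m::nat. finite (Y m) \<and> Y m \<noteq> {} \<and> Y m \<subseteq> shift_span x0 \<and>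
    (\<forall>i. \<bar>i\<bar> \<le> int m \<longrightarrow> real (card ((\<lambda>y. shift i x0 + y) ` Y m - Y m)) \<le> 1 / real (m + 1) * card (Y m)))"

lemma folner:
  shows "finite (folner m)" and "folner m \<noteq> {}" and "folner m \<subseteq> shift_span x0"
    and "z \<in> shift_span x0 \<Longrightarrow>
      (\<lambda>m. real (card ((\<lambda>y. z + y) ` folner m - folner m)) / card (folner m)) \<longlonglongrightarrow> 0"
proof -
  note * = someI_ex [OF folner_sequence [of x0], folded folner_def, rule_format]
  show 1: "finite (folner m)" "folner m \<noteq> {}" "folner m \<subseteq> shift_span x0" for m
    using * [of m] by auto
  show "z \<in> shift_span x0 \<Longrightarrow>
      (\<lambda>m. real (card ((\<lambda>y. z + y) ` folner m - folner m)) / card (folner m)) \<longlonglongrightarrow> 0"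
    using * by (intro folner_ratio_tendsto [of folner x0] 1) auto
qed

text \<open>
  On the orbit, \<open>W\<close> acts as translation acts on functions on the group, so the normalised indicator
  functions of almost invariant sets become almost fixed vectors.
\<close>
definition folner_vector :: "nat \<Rightarrow> 'n wreath_int ell2"
  where "folner_vector m = (1 / sqrt (card (folner m))) *\<^sub>R (\<Sum>y\<in>folner m. orbit_vector y)"

lemma card_folner_pos: "0 < card (folner m)"
  using folner(1,2) by (simp add: card_gt_0_iff)

lemma norm_folner_vector [simp]: "norm (folner_vector m) = 1"
  using card_folner_pos [of m] by (simp add: folner_vector_def norm_orbit_sum folner)

lemma W_orbit_vector:
  assumes "y \<in> shift_span x0"
  shows "W z (orbit_vector y) = orbit_vector (z + y)"
  unfolding orbit_vector_def W_W [OF base_fixed_span [OF assms], symmetric] by simp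

text \<open>
  The unitary \<open>W z\<close> translates the Folner set; the squared norm of the difference is the relative size of the
  symmetric difference.
\<close>
lemma W_folner_vector_tendsto:
  assumes z: "z \<in> shift_span x0"
  shows "(\<lambda>m. W z (folner_vector m) - folner_vector m) \<longlonglongrightarrow> 0"
proof (rule Lim_null_comparison)
  define r where "r m = real (card ((\<lambda>y. z + y) ` folner m - folner m)) / card (folner m)" for m
  have "r \<longlonglongrightarrow> 0" unfolding r_def by (rule folner(4) [OF z])
  then have "(\<lambda>m. 2 * sqrt (r m)) \<longlonglongrightarrow> 2 * sqrt 0"
    by (intro tendsto_intros)
  then show "(\<lambda>m. 2 * sqrt (r m)) \<longlonglongrightarrow> 0" by simp
  show "\<forall>\<^sub>F m in sequentially. norm (W z (folner_vector m) - folner_vector m) \<le> 2 * sqrt (r m)"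
  proof (intro always_eventually allI)
    fix m
    let ?Y = "folner m" and ?S = "\<lambda>A. \<Sum>y\<in>A. orbit_vector y"
    let ?Z = "(\<lambda>y. z + y) ` ?Y"
    have fin: "finite ?Y" "finite ?Z" by (simp_all add: folner)
    have "card ?Z = card ?Y" by (intro card_image) (auto simp: inj_on_def)
    then have card: "card (?Y - ?Z) = card (?Z - ?Y)"
      using fin by (simp add: card_Diff_subset_Int Int_commute)
    have "W z (?S ?Y) = (\<Sum>y\<in>?Y. orbit_vector (z + y))"
      unfolding blinfun.sum_right using folner(3) [of m] by (intro sum.cong refl W_orbit_vector) auto
    also have "\<dots> = ?S ?Z"
      by (subst sum.reindex) (auto simp: inj_on_def)
    finally have "W z (?S ?Y) - ?S ?Y = ?S ?Z - ?S ?Y" by simp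
    also have "\<dots> = ?S (?Z - ?Y) - ?S (?Y - ?Z)"
      using fin by (simp add: sum_diff_split sum.Int_Diff [of ?Z orbit_vector ?Y]
          sum.Int_Diff [of ?Y orbit_vector ?Z] Int_commute)
    finally have "norm (W z (?S ?Y) - ?S ?Y) \<le> 2 * sqrt (card (?Z - ?Y))"
      using norm_triangle_ineq4 [of "?S (?Z - ?Y)" "?S (?Y - ?Z)"] fin card
      by (simp add: norm_orbit_sum)
    then have "norm ((1 / sqrt (card ?Y)) *\<^sub>R (W z (?S ?Y) - ?S ?Y)) \<le> 2 * sqrt (card (?Z - ?Y)) / sqrt (card ?Y)"
      using card_folner_pos [of m] by (simp add: divide_right_mono)
    then show "norm (W z (folner_vector m) - folner_vector m) \<le> 2 * sqrt (r m)"
      by (simp add: folner_vector_def r_def blinfun.scaleR_right scaleR_diff_right real_sqrt_divide)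
  qed
qed

abbreviation \<omega> :: "nat \<Rightarrow> 'n wreath_int operator \<Rightarrow> complex"
  where "\<omega> m \<equiv> vector_state (folner_vector m)"

lemma omega_bound: "cmod (\<omega> m A) \<le> norm A"
  using vector_state_bound [of "folner_vector m" A] by simp

lemma omega_id [simp]: "\<omega> m id_blinfun = 1"
  by (simp add: vector_state_def cinner_self)

lemma omega_compose_W:
  assumes "z \<in> shift_span x0"
  shows "(\<lambda>m. \<omega> m (A o\<^sub>L W z) - \<omega> m A) \<longlonglongrightarrow> 0"
proof (rule Lim_null_comparison)
  have "(\<lambda>m. norm A * norm (W z (folner_vector m) - folner_vector m)) \<longlonglongrightarrow> norm A * 0"
    by (intro tendsto_mult tendsto_const tendsto_norm_zero W_folner_vector_tendsto assms)
  then show "(\<lambda>m. norm A * norm (W z (folner_vector m) - folner_vector m)) \<longlonglongrightarrow> 0" by simp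
  have "norm (\<omega> m (A o\<^sub>L W z) - \<omega> m A) \<le> norm A * norm (W z (folner_vector m) - folner_vector m)" for m
  proof -
    have "\<omega> m (A o\<^sub>L W z) - \<omega> m A = cinner (folner_vector m) (A (W z (folner_vector m) - folner_vector m))"
      by (simp add: vector_state_def cinner.diff_right blinfun.diff_right)
    then show ?thesis
      using cinner_cauchy_schwarz [of "folner_vector m" "A (W z (folner_vector m) - folner_vector m)"]
        norm_blinfun [of A "W z (folner_vector m) - folner_vector m"] by simp
  qed
  then show "\<forall>\<^sub>F m in sequentially. norm (\<omega> m (A o\<^sub>L W z) - \<omega> m A) \<le> norm A * norm (W z (folner_vector m) - folner_vector m)"
    by simp
qed

lemma omega_W: "z \<in> shift_span x0 \<Longrightarrow> (\<lambda>m. \<omega> m (W z)) \<longlonglongrightarrow> 1"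
  using omega_compose_W [of z id_blinfun] by (simp add: LIM_zero_iff)

text \<open>
  The vectors live on the displacements, and a translation that maps a displacement to a displacement
  is itself one.
\<close>
lemma omega_outside:
  assumes "c \<notin> displacements"
  shows "\<omega> m (L c) = 0"
proof -
  have "cinner (orbit_vector y) (L c (orbit_vector y')) = 0" if "y \<in> folner m" "y' \<in> folner m" for y y'
  proof -
    have "c + displacement y' \<noteq> displacement y"
    proof
      assume "c + displacement y' = displacement y"
      then have "c = displacement y - displacement y'" by (metis add_diff_cancel)
      also have "\<dots> = displacement (y - y')"
        by (simp add: wreath_simps wreath_diff shift_minus)
      finally show False
        using assms that folner(3) [of m] shift_span.diff [of y x0 y'] by (auto simp: displacements_def)
    qed
    then show ?thesis
      using orbit_vector_eq [of y] orbit_vector_eq [of y']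
      by (auto simp: complex_linearD [OF L_linear] L_delta cinner_delta Rep_delta)
  qed
  then have "cinner (\<Sum>y\<in>folner m. orbit_vector y) (L c (\<Sum>y\<in>folner m. orbit_vector y)) = 0"
    by (simp add: blinfun.sum_right cinner.sum_left cinner.sum_right sum.neutral)
  then show ?thesis
    by (simp add: vector_state_def folner_vector_def blinfun.scaleR_right cinner.scaleR_left cinner.scaleR_right)
qed

lemma L_displacement:
  assumes "c \<in> displacements"
  obtains z d where "z \<in> shift_span x0" "L c = scalar_op d o\<^sub>L W z"
proof -
  obtain z where z: "z \<in> shift_span x0" "c = displacement z"
    using assms by (auto simp: displacements_def)
  obtain d where d: "cmod d = 1" "W z = scalar_op d o\<^sub>L L c"
    using W_eq z by blast
  have "cnj d * d = 1"
    using d(1) complex_norm_square [of d] by (simp add: mult.commute)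
  then have "L c = scalar_op (cnj d) o\<^sub>L W z"
    by (simp add: d scalar_op_scalar_op)
  then show ?thesis using that z by blast
qed

lemma reduced_facts:
  shows "cstar_subalgebra (reduced_cstar \<sigma>)" and "L g \<in> reduced_cstar \<sigma>"
    and "id_blinfun \<in> reduced_cstar \<sigma>" and "A \<in> reduced_cstar \<sigma> \<Longrightarrow> adjointable A"
  by (auto simp: reduced_eq subgroup_algebra_cstar L_mem id_mem additive_subgroup_UNIV
      intro: subgroup_algebra_adjointable)

lemma reduced_null:
  assumes add: "\<And>m A B. f m (A + B) = f m A + f m B"
    and scalar: "\<And>m c A. adjointable A \<Longrightarrow> f m (scalar_op c o\<^sub>L A) = c * f m A"
    and bound: "\<And>m A. cmod (f m A) \<le> C * norm A"
    and gen: "\<And>g. (\<lambda>m. f m (L g)) \<longlonglongrightarrow> (0 :: complex)"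
    and A: "A \<in> reduced_cstar \<sigma>"
  shows "(\<lambda>m. f m A) \<longlonglongrightarrow> 0"
proof -
  have "csubspace {A. adjointable A \<and> (\<lambda>m. f m A) \<longlonglongrightarrow> 0}"
    "closed {A. adjointable A \<and> (\<lambda>m. f m A) \<longlonglongrightarrow> 0}"
    by (rule null_sequence_space [of f C]; fact add scalar bound)+
  then have "A \<in> {A. adjointable A \<and> (\<lambda>m. f m A) \<longlonglongrightarrow> 0}"
    by (rule subgroup_algebra_induct [OF additive_subgroup_UNIV _ _ _ A [unfolded reduced_eq]])
      (simp add: gen)
  then show ?thesis by simp
qed

text \<open>
  On unitaries outside the displacements both terms vanish, as the displacements form a normal subset.
  On the others the operator is a scalar multiple of some \<open>W z\<close>, which the base group fixes and a
  translation turns into \<open>W (shift k z)\<close>; both have limit 1.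
\<close>
lemma omega_Ad_special:
  assumes g: "g \<in> base_group \<or> g = Wr 0 k" and A: "A \<in> reduced_cstar \<sigma>"
  shows "(\<lambda>m. \<omega> m (Ad g A) - \<omega> m A) \<longlonglongrightarrow> 0"
proof (rule reduced_null [of "\<lambda>m A. \<omega> m (Ad g A) - \<omega> m A" 2, OF _ _ _ _ A])
  fix c
  show "(\<lambda>m. \<omega> m (Ad g (L c)) - \<omega> m (L c)) \<longlonglongrightarrow> 0"
  proof (cases "c \<in> displacements")
    case True
    then obtain z d where z: "z \<in> shift_span x0" "L c = scalar_op d o\<^sub>L W z"
      by (rule L_displacement)
    have "(\<lambda>m. \<omega> m (Ad g (W z))) \<longlonglongrightarrow> 1"
    proof (cases "g = Wr 0 k")
      case True
      then show ?thesis
        using omega_W [OF shift_span_shift [OF z(1)]] by (simp add: Ad_W)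
    next
      case False
      then have "Ad g (W z) = W z"
        using g base_fixed_W [OF base_fixed_span [OF z(1)]] by (auto simp: base_fixed_def base_group_def)
      then show ?thesis using omega_W [OF z(1)] by simp
    qed
    then have "(\<lambda>m. d * \<omega> m (Ad g (W z)) - d * \<omega> m (W z)) \<longlonglongrightarrow> d * 1 - d * 1"
      by (intro tendsto_intros omega_W z)
    then show ?thesis by (simp add: z Ad_scalar vector_state_simps)
  next
    case False
    have "g + c - g \<notin> displacements"
    proof
      assume "g + c - g \<in> displacements"
      then have "- g + (g + c - g) - - g \<in> displacements" by (rule displacements_normal)
      then show False using False by (simp add: diff_conv_add_uminus add.assoc del: add_uminus_conv_diff)
    qed
    moreover obtain d where "Ad g (L c) = scalar_op d o\<^sub>L L (g + c - g)"
      using Ad_L by blast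
    ultimately show ?thesis
      using False by (simp add: vector_state_simps omega_outside)
  qed
next
  show "cmod (\<omega> m (Ad g A) - \<omega> m A) \<le> 2 * norm A" for m A
    using norm_triangle_ineq4 [of "\<omega> m (Ad g A)" "\<omega> m A"] omega_bound [of m A]
      omega_bound [of m "Ad g A"] norm_Ad [of g A] by simp
qed (simp_all add: Ad_add Ad_scalar vector_state_simps algebra_simps)

lemma Ad_reduced: "A \<in> reduced_cstar \<sigma> \<Longrightarrow> Ad g A \<in> reduced_cstar \<sigma>"
  unfolding reduced_eq by (intro Ad_mem additive_subgroup_UNIV) auto

lemma omega_Ad:
  assumes A: "A \<in> reduced_cstar \<sigma>"
  shows "(\<lambda>m. \<omega> m (Ad g A) - \<omega> m A) \<longlonglongrightarrow> 0"
proof -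
  obtain y k where g: "g = Wr y k" by (cases g)
  have "g = Wr y 0 + Wr 0 k" by (simp add: g wreath_simps)
  then have "Ad g A = Ad (Wr y 0) (Ad (Wr 0 k) A)"
    using reduced_facts(4) [OF A] by (simp add: Ad_Ad)
  moreover have "(\<lambda>m. (\<omega> m (Ad (Wr y 0) (Ad (Wr 0 k) A)) - \<omega> m (Ad (Wr 0 k) A)) +
      (\<omega> m (Ad (Wr 0 k) A) - \<omega> m A)) \<longlonglongrightarrow> 0 + 0"
    by (intro tendsto_add omega_Ad_special Ad_reduced A) (auto simp: base_group_def)
  ultimately show ?thesis by simp
qed

text \<open>
  Asymptotic invariance under conjugation by \<open>L g\<close>, applied to \<open>B L g\<close>, is the trace identity for \<open>B\<close> and
  \<open>L g\<close>.
\<close>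
lemma omega_commute:
  assumes A: "A \<in> reduced_cstar \<sigma>" and B: "B \<in> reduced_cstar \<sigma>"
  shows "(\<lambda>m. \<omega> m (A o\<^sub>L B) - \<omega> m (B o\<^sub>L A)) \<longlonglongrightarrow> 0"
proof (rule reduced_null [of "\<lambda>m A. \<omega> m (A o\<^sub>L B) - \<omega> m (B o\<^sub>L A)" "2 * norm B", OF _ _ _ _ A])
  fix g
  have "Ad g (B o\<^sub>L L g) = L g o\<^sub>L B"
    by (simp add: Ad_def blinfun_compose_assoc)
  then show "(\<lambda>m. \<omega> m (L g o\<^sub>L B) - \<omega> m (B o\<^sub>L L g)) \<longlonglongrightarrow> 0"
    using omega_Ad [of "B o\<^sub>L L g" g] cstar_subalgebraD(2) [OF reduced_facts(1) B reduced_facts(2)] by simp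
next
  show "cmod (\<omega> m (A o\<^sub>L B) - \<omega> m (B o\<^sub>L A)) \<le> 2 * norm B * norm A" for m A
    using norm_triangle_ineq4 [of "\<omega> m (A o\<^sub>L B)" "\<omega> m (B o\<^sub>L A)"]
      omega_bound [of m "A o\<^sub>L B"] omega_bound [of m "B o\<^sub>L A"]
      norm_blinfun_compose [of A B] norm_blinfun_compose [of B A] by (simp add: mult.commute)
qed (use reduced_facts(4) [OF B] in \<open>simp_all add: vector_state_simps algebra_simps
      blinfun_compose.add_left blinfun_compose.add_right compose_scalar_op scalar_op_compose\<close>)

lemma omega_convergent:
  assumes A: "A \<in> reduced_cstar \<sigma>"
  shows "convergent (\<lambda>m. \<omega> m A)"
proof -
  have gen: "convergent (\<lambda>m. \<omega> m (L c))" for c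
  proof (cases "c \<in> displacements")
    case True
    then obtain z d where z: "z \<in> shift_span x0" "L c = scalar_op d o\<^sub>L W z"
      by (rule L_displacement)
    then have "(\<lambda>m. \<omega> m (L c)) \<longlonglongrightarrow> d * 1"
      by (simp only: vector_state_simps) (intro tendsto_mult tendsto_const omega_W)
    then show ?thesis by (rule convergentI)
  next
    case False
    then show ?thesis by (simp add: omega_outside convergent_const)
  qed
  have "A \<in> {A. convergent (\<lambda>m. \<omega> m A)}"
    using A unfolding reduced_eq
    by (rule subgroup_algebra_induct [OF additive_subgroup_UNIV
          convergent_sequence_space [of \<omega>, OF vector_state_simps(1,2) omega_bound], rotated])
       (simp add: gen)
  then show ?thesis by simp
qed

definition invariant_trace :: "'n wreath_int operator \<Rightarrow> complex"
  where "invariant_trace = restrict (\<lambda>A. lim (\<lambda>m. \<omega> m A)) (reduced_cstar \<sigma>)"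

lemma invariant_trace_lim:
  "A \<in> reduced_cstar \<sigma> \<Longrightarrow> (\<lambda>m. \<omega> m A) \<longlonglongrightarrow> invariant_trace A"
  using omega_convergent by (simp add: invariant_trace_def convergent_LIMSEQ_iff)

lemma invariant_trace_tracial: "tracial_state (reduced_cstar \<sigma>) invariant_trace"
proof -
  let ?\<A> = "reduced_cstar \<sigma>"
  note r = cstar_subalgebraD [OF reduced_facts(1)] csubspaceD [OF cstar_subalgebraD(1) [OF reduced_facts(1)]]
  have 1: "invariant_trace (A + B) = invariant_trace A + invariant_trace B" if "A \<in> ?\<A>" "B \<in> ?\<A>" for A B
    using that invariant_trace_lim [of "A + B"] tendsto_add [OF invariant_trace_lim [of A] invariant_trace_lim [of B]]
    by (simp add: vector_state_simps r LIMSEQ_unique)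
  have 2: "invariant_trace (scalar_op c o\<^sub>L A) = c * invariant_trace A" if "A \<in> ?\<A>" for c A
    using that invariant_trace_lim [of "scalar_op c o\<^sub>L A"] tendsto_mult_left [OF invariant_trace_lim [of A], of c]
    by (simp add: vector_state_simps r LIMSEQ_unique)
  have 3: "invariant_trace (adj A o\<^sub>L A) \<in> \<real>\<^sub>\<ge>\<^sub>0" if "A \<in> ?\<A>" for A
  proof (rule closed_sequentially [OF closed_nonneg_Reals_complex])
    show "(\<lambda>m. \<omega> m (adj A o\<^sub>L A)) \<longlonglongrightarrow> invariant_trace (adj A o\<^sub>L A)"
      using that by (intro invariant_trace_lim r)
    show "\<omega> m (adj A o\<^sub>L A) \<in> \<real>\<^sub>\<ge>\<^sub>0" for m
      using reduced_facts(4) [OF that] by (simp add: vector_state_adj del: of_real_power)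
  qed
  have 4: "invariant_trace id_blinfun = 1"
    using invariant_trace_lim [OF reduced_facts(3)] LIMSEQ_unique [OF _ tendsto_const] by fastforce
  have 5: "invariant_trace (A o\<^sub>L B) = invariant_trace (B o\<^sub>L A)" if "A \<in> ?\<A>" "B \<in> ?\<A>" for A B
  proof -
    have "(\<lambda>m. \<omega> m (A o\<^sub>L B) - \<omega> m (B o\<^sub>L A)) \<longlonglongrightarrow> invariant_trace (A o\<^sub>L B) - invariant_trace (B o\<^sub>L A)"
      using that by (intro tendsto_diff invariant_trace_lim r)
    then show ?thesis
      using LIMSEQ_unique [OF omega_commute [OF that]] by fastforce
  qed
  show ?thesis
    unfolding tracial_state_def using 1 2 3 4 5 by (simp add: invariant_trace_def)
qed

lemma W_mem: "W z \<in> base_cstar \<sigma>"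
proof -
  obtain c where "W z = scalar_op c o\<^sub>L L (displacement z)"
    using W_eq by blast
  then show ?thesis
    using csubspaceD(3) [OF cstar_subalgebraD(1) [OF subgroup_algebra_cstar]] L_mem
    by (auto simp: base_eq base_group_def)
qed

lemma base_subset: "base_cstar \<sigma> \<subseteq> reduced_cstar \<sigma>"
  by (simp add: base_eq reduced_eq subgroup_algebra_mono)

lemma displacement_x0: "displacement x0 \<noteq> 0"
  using x0_nonzero shift_fixed_imp_zero [of x0] by (auto simp: wreath_simps)

lemma x0_span: "x0 \<in> shift_span x0"
  using shift_span.gen [of 0 x0] by simp

lemma not_unique_trace: "\<not> unique_trace_property \<sigma>"
proof
  assume "unique_trace_property \<sigma>"
  then have eq: "invariant_trace = restrict canonical_trace (reduced_cstar \<sigma>)"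
    unfolding unique_trace_property_def
    using invariant_trace_tracial canonical_trace_tracial by blast
  have mem: "W x0 \<in> reduced_cstar \<sigma>" using W_mem base_subset by auto
  have "invariant_trace (W x0) = 1"
    using LIMSEQ_unique [OF invariant_trace_lim [OF mem] omega_W [OF x0_span]] .
  moreover have "canonical_trace (W x0) = 0"
    using W_eq [of x0] displacement_x0 by (auto simp: vector_state_simps canonical_trace_L)
  ultimately show False using mem by (simp add: eq)
qed

text \<open>
  The kernel of the form \<open>(B, A) \<mapsto> \<omega>(B A)\<close>.  It coincides with the left kernel \<open>{A. \<omega>(A\<^sup>* A) = 0}\<close>, but this
  description makes it evident that it is a closed subspace and, by the trace identity, an ideal.
\<close>
definition trace_kernel :: "'n wreath_int operator set"
  where "trace_kernel = {A \<in> reduced_cstar \<sigma>. \<forall>B\<in>reduced_cstar \<sigma>. (\<lambda>m. \<omega> m (B o\<^sub>L A)) \<longlonglongrightarrow> 0}"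

lemma closed_ideal_trace_kernel: "closed_ideal (reduced_cstar \<sigma>) trace_kernel"
proof -
  let ?\<A> = "reduced_cstar \<sigma>"
  note r = cstar_subalgebraD [OF reduced_facts(1)] csubspaceD [OF cstar_subalgebraD(1) [OF reduced_facts(1)]]
  let ?V = "\<lambda>B. {A. adjointable A \<and> (\<lambda>m. \<omega> m (B o\<^sub>L A)) \<longlonglongrightarrow> 0}"
  have V: "csubspace (?V B)" "closed (?V B)" if "B \<in> ?\<A>" for B
  proof -
    have bound: "cmod (\<omega> m (B o\<^sub>L A)) \<le> norm B * norm A" for m A
      using omega_bound [of m "B o\<^sub>L A"] norm_blinfun_compose [of B A] by linarith
    show "csubspace (?V B)" "closed (?V B)"
      using reduced_facts(4) [OF that] bound
      by (intro null_sequence_space [where C = "norm B"];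
          simp add: vector_state_simps blinfun_compose.add_right compose_scalar_op)+
  qed
  have eq: "trace_kernel = ?\<A> \<inter> (\<Inter>B\<in>?\<A>. ?V B)"
    using reduced_facts(4) by (auto simp: trace_kernel_def)
  have "csubspace trace_kernel"
    unfolding eq using V(1) by (intro csubspace_Int csubspace_Inter r) auto
  moreover have "closed trace_kernel"
    unfolding eq using V(2) by (intro closed_Int closed_INT ballI r) auto
  moreover have "A o\<^sub>L B \<in> trace_kernel" "B o\<^sub>L A \<in> trace_kernel" if A: "A \<in> ?\<A>" and B: "B \<in> trace_kernel" for A B
  proof -
    have B': "B \<in> ?\<A>" "\<And>C. C \<in> ?\<A> \<Longrightarrow> (\<lambda>m. \<omega> m (C o\<^sub>L B)) \<longlonglongrightarrow> 0"
      using B by (auto simp: trace_kernel_def)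
    have "(\<lambda>m. \<omega> m (C o\<^sub>L (A o\<^sub>L B))) \<longlonglongrightarrow> 0" if "C \<in> ?\<A>" for C
      using B'(2) [of "C o\<^sub>L A"] that A by (simp add: r blinfun_compose_assoc)
    then show "A o\<^sub>L B \<in> trace_kernel"
      using A B' by (simp add: trace_kernel_def r)
    have "(\<lambda>m. \<omega> m (C o\<^sub>L (B o\<^sub>L A))) \<longlonglongrightarrow> 0" if C: "C \<in> ?\<A>" for C
    proof -
      have "(\<lambda>m. (\<omega> m ((C o\<^sub>L B) o\<^sub>L A) - \<omega> m (A o\<^sub>L (C o\<^sub>L B))) + \<omega> m ((A o\<^sub>L C) o\<^sub>L B)) \<longlonglongrightarrow> 0 + 0"
        using A B' C by (intro tendsto_add omega_commute B'(2) r)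
      then show ?thesis by (simp add: blinfun_compose_assoc)
    qed
    then show "B o\<^sub>L A \<in> trace_kernel"
      using A B' by (simp add: trace_kernel_def r)
  qed
  ultimately show ?thesis
    unfolding closed_ideal_def by (auto simp: trace_kernel_def)
qed

lemma id_notin_kernel: "id_blinfun \<notin> trace_kernel"
proof
  assume "id_blinfun \<in> trace_kernel"
  then have "(\<lambda>m. \<omega> m (id_blinfun o\<^sub>L id_blinfun)) \<longlonglongrightarrow> 0"
    using reduced_facts(3) unfolding trace_kernel_def by blast
  then show False
    using LIMSEQ_unique [OF tendsto_const [of "1 :: complex"], of 0] by simp
qed

lemma kernel_element:
  shows "W x0 - id_blinfun \<in> trace_kernel" and "W x0 - id_blinfun \<noteq> 0"
    and "W x0 - id_blinfun \<in> base_cstar \<sigma>"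
proof -
  show base: "W x0 - id_blinfun \<in> base_cstar \<sigma>"
    using W_mem id_mem [OF base_group_subgroup]
    by (auto simp: base_eq intro!: csubspaceD(6) [OF cstar_subalgebraD(1) [OF subgroup_algebra_cstar]])
  show "W x0 - id_blinfun \<in> trace_kernel"
    using base base_subset omega_compose_W [OF x0_span]
    by (auto simp: trace_kernel_def blinfun_compose.diff_right vector_state_diff)
  show "W x0 - id_blinfun \<noteq> 0"
  proof
    assume "W x0 - id_blinfun = 0"
    then have "canonical_trace (W x0) = canonical_trace id_blinfun" by simp
    moreover have "canonical_trace (W x0) = 0"
      using W_eq [of x0] displacement_x0 by (auto simp: vector_state_simps canonical_trace_L)
    moreover have "canonical_trace id_blinfun = 1"
      using canonical_trace_L [of 0] by (simp add: L_zero)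
    ultimately show False by simp
  qed
qed

lemma not_simple: "\<not> cstar_simple \<sigma>"
  using closed_ideal_trace_kernel kernel_element id_notin_kernel reduced_facts(3)
  unfolding cstar_simple_def simple_cstar_def by blast

text \<open>
  The kernel is an ideal of the whole algebra, so its intersection with the base algebra is invariant
  under conjugation by the unitaries of the integers.
\<close>
lemma not_minimal: "\<not> minimal_int_action \<sigma>"
proof
  assume min: "minimal_int_action \<sigma>"
  let ?J = "trace_kernel \<inter> base_cstar \<sigma>"
  note b = subgroup_algebra_cstar [of base_group, folded base_eq]
  note b' = cstar_subalgebraD [OF b]
  note k = closed_ideal_trace_kernel [unfolded closed_ideal_def]
  have ideal: "A o\<^sub>L B \<in> trace_kernel" "B o\<^sub>L A \<in> trace_kernel"
    if "A \<in> reduced_cstar \<sigma>" "B \<in> trace_kernel" for A B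
    using k that by auto
  have "closed_ideal (base_cstar \<sigma>) ?J"
    unfolding closed_ideal_def
  proof (intro conjI ballI)
    show "csubspace ?J" using k b' by (intro csubspace_Int) auto
    show "closed ?J" using k b' by (intro closed_Int) auto
    show "A o\<^sub>L B \<in> ?J" "B o\<^sub>L A \<in> ?J" if "A \<in> base_cstar \<sigma>" "B \<in> ?J" for A B
      using that ideal [of A B] b'(2) [of A B] b'(2) [of B A] base_subset by auto
  qed auto
  moreover have "?J \<noteq> base_cstar \<sigma>"
    using id_notin_kernel id_mem [OF base_group_subgroup, folded base_eq] by auto
  moreover have "int_action \<sigma> k ` ?J \<subseteq> ?J" for k
  proof (rule image_subsetI)
    fix A assume A: "A \<in> ?J"
    have "Ad (Wr 0 k) A \<in> trace_kernel"
    proof -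
      have "adj (L (Wr 0 k)) \<in> reduced_cstar \<sigma>"
        by (intro cstar_subalgebraD(3) [OF reduced_facts(1)] reduced_facts(2))
      moreover have "L (Wr 0 k) o\<^sub>L A \<in> trace_kernel"
        using A ideal(1) reduced_facts(2) by simp
      ultimately show ?thesis
        unfolding Ad_def by (rule ideal(2))
    qed
    moreover have "Ad (Wr 0 k) A \<in> base_cstar \<sigma>"
      unfolding base_eq using A by (intro Ad_mem base_group_subgroup base_group_normal) (auto simp: base_eq)
    ultimately show "int_action \<sigma> k A \<in> ?J"
      by (simp add: int_action_eq)
  qed
  ultimately have "?J \<in> {J. closed_ideal (base_cstar \<sigma>) J \<and> J \<noteq> base_cstar \<sigma> \<and>
      (\<forall>k. int_action \<sigma> k ` J \<subseteq> J)}"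
    by simp
  then have "?J = {0}"
    unfolding min [unfolded minimal_int_action_def] by simp
  moreover have "W x0 - id_blinfun \<in> ?J"
    using kernel_element(1,3) by (rule IntI)
  ultimately have "W x0 - id_blinfun \<in> {0}" by (simp only:)
  with kernel_element(2) show False by (simp only: singleton_iff)
qed

end

theorem proposition5p7:
  fixes \<sigma> :: "'n::ab_group_add wreath_int \<Rightarrow> 'n wreath_int \<Rightarrow> complex"
  assumes "\<exists>x::'n. x \<noteq> 0"
    and "normalized_2_cocycle \<sigma>"
  shows "(kleppner (base_cocycle \<sigma>) \<longleftrightarrow> unique_trace_property \<sigma>) \<and>
    (kleppner (base_cocycle \<sigma>) \<longrightarrow> cstar_simple \<sigma>) \<and>
    (unique_trace_property \<sigma> \<longrightarrow> cstar_simple \<sigma>) \<and>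
    (countable (UNIV :: 'n set) \<longrightarrow> (cstar_simple \<sigma> \<longleftrightarrow> minimal_int_action \<sigma>))"
proof -
  interpret wreath_cocycle \<sigma>
    by unfold_locales (rule assms(2))
  show ?thesis
  proof (cases "kleppner (base_cocycle \<sigma>)")
    case True
    then show ?thesis
      using nondegenerate_consequences assms(1) by blast
  next
    case False
    then obtain g where g: "g \<in> base_group" "g \<noteq> 0" "\<forall>h\<in>base_group. \<sigma> h g = \<sigma> g h"
      by (auto simp: kleppner_base_iff)
    then obtain x0 where x0: "g = Wr x0 0" by (auto simp: base_group_def)
    interpret degenerate_cocycle \<sigma> x0
      using g by unfold_locales (auto simp: x0 base_group_def wreath_simps)
    show ?thesis
      using False not_unique_trace not_simple not_minimal by blast
  qed
qed

end
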